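(* Let $r,s\in\mathbb{N}$ with $s\le r$ and let $1\le p<\infty$. Then for $f\in\Lambda^p$ and $W>0$ $$\mathcal{K}_s(f,\Sigma_W)_p\asymp\tilde\Omega_{r,s}\left(f,\tfrac1W,\Sigma_W\right)_p,$$ i.e. each side is bounded by a positive constant times the other, with constants independent of $f$ and $W$, where $$\mathcal{K}_s(f,\Sigma_W)_p=\inf_{g\in W^s_p(\mathbb{R})}\left(\|f-g\|_{\ell_p(\Sigma_W)}+\|f-g\|_p+W^{-s}\|g^{(s)}\|_p\right).$$
   Context: Conventions: $\mathbb{N}=\{1,2,\dots\}$; functions are defined pointwise (functions equal almost everywhere are not identified); $\|\cdot\|_p$ is the $L^p(\mathbb{R})$ norm. $W^s_p(\mathbb{R})$ is the usual Sobolev space, whose elements are taken as functions $g\in L^p(\mathbb{R})$ with $g,\dots,g^{(s-1)}$ locally absolutely continuous and $g^{(s)}\in L^p(\mathbb{R})$. $M(\mathbb{R})$ is the set of bounded measurable functions on $\mathbb{R}$. A sequence $\Sigma=(x_j)_{j\in\mathbb{Z}}\subset\mathbb{R}$ is admissible if $0<\inf_j(x_j-x_{j-1})\le\sup_j(x_j-x_{j-1})<\infty$; put $\|f\|_{\ell_p(\Sigma)}=\big(\sum_{j\in\mathbb{Z}}|f(x_j)|^p(x_j-x_{j-1})\big)^{1/p}$. $\Lambda^p=\{f\in M(\mathbb{R}):\|f\|_{\ell_p(\Sigma)}<\infty\text{ for every admissible }\Sigma\}$; one has $W^s_p(\mathbb{R})\subset\Lambda^p\subset L^p(\mathbb{R})$.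 $\Sigma_W=(j/W)_{j\in\mathbb{Z}}$, so $\|f\|_{\ell_p(\Sigma_W)}=\big(\frac1W\sum_{j\in\mathbb{Z}}|f(j/W)|^p\big)^{1/p}$. Modulus of smoothness: $\Delta_h^s f(x)=\sum_{k=0}^s\binom sk(-1)^{s-k}f(x+kh)$, $\omega_s(f,\delta)_p=\sup_{0<h\le\delta}\|\Delta_h^sf\|_p$. Steklov averages ($\delta>0$): $\tilde f_{\delta,r}(x)=(-\delta)^{-r}\int_0^\delta\cdots\int_0^\delta\sum_{m=1}^r(-1)^{r-m+1}\binom rm f\big(x+\frac mr(t_1+\dots+t_r)\big)\,dt_1\cdots dt_r$. Semi-discrete modulus: $\tilde\Omega_{r,s}(f,\frac1W,\Sigma_W)_p=\|\tilde f_{1/W,r}-f\|_{\ell_p(\Sigma_W)}+\omega_s(f,1/W)_p$. *)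

theory Defs
  imports "HOL-Analysis.Analysis"
begin

text \<open>
  Functions are pointwise functions on the real line, with values of a type of class
  \<^class>\<open>real_normed_field\<close> and \<^class>\<open>euclidean_space\<close>, that is, real or complex values.
  Measurable means Lebesgue measurable. All norms and moduli are values in \<open>[0,\<infinity>]\<close>, so
  that suprema, infima and divergent sums have their usual meaning.
\<close>

definition ennreal_root :: "real \<Rightarrow> ennreal \<Rightarrow> ennreal" where
  "ennreal_root p a = (if a = \<infinity> then \<infinity> else ennreal (enn2real a powr (1 / p)))"

definition Lp_norm :: "real \<Rightarrow> (real \<Rightarrow> 'a::real_normed_vector) \<Rightarrow> ennreal" where
  "Lp_norm p f = ennreal_root p (\<integral>\<^sup>+x. ennreal (norm (f x) powr p) \<partial>lebesgue)"

definition Lp_space :: "real \<Rightarrow> (real \<Rightarrow> 'a::real_normed_vector) set" where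
  "Lp_space p = {f. f \<in> borel_measurable lebesgue \<and> Lp_norm p f < \<infinity>}"

definition abs_continuous_on_interval ::
    "real \<Rightarrow> real \<Rightarrow> (real \<Rightarrow> 'a::real_normed_vector) \<Rightarrow> bool" where
  "abs_continuous_on_interval a b g \<longleftrightarrow>
     (\<forall>\<epsilon>>0. \<exists>\<delta>>0. \<forall>(n::nat) u v.
        (\<forall>i<n. a \<le> u i \<and> u i < v i \<and> v i \<le> b) \<and>
        disjoint_family_on (\<lambda>i. {u i<..<v i}) {..<n} \<and>
        (\<Sum>i<n. v i - u i) < \<delta>
        \<longrightarrow> (\<Sum>i<n. norm (g (v i) - g (u i))) < \<epsilon>)"

definition locally_abs_continuous :: "(real \<Rightarrow> 'a::real_normed_vector) \<Rightarrow> bool" where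
  "locally_abs_continuous g \<longleftrightarrow> (\<forall>a b. abs_continuous_on_interval a b g)"

definition nth_deriv :: "nat \<Rightarrow> (real \<Rightarrow> 'a::real_normed_vector) \<Rightarrow> real \<Rightarrow> 'a" where
  "nth_deriv k g = ((\<lambda>h x. vector_derivative h (at x)) ^^ k) g"

text \<open>
  The derivatives of order less than \<open>s\<close> exist at every point. Differentiability has to be
  required explicitly because \<^const>\<open>vector_derivative\<close> is total. The derivative of order
  \<open>s\<close> is the one that exists almost everywhere by absolute continuity of the preceding one;
  its values on the exceptional null set are irrelevant.
\<close>

definition Sobolev :: "nat \<Rightarrow> real \<Rightarrow> (real \<Rightarrow> 'a::real_normed_vector) set" where
  "Sobolev s p = {g. g \<in> Lp_space p \<and>
     (\<forall>k. Suc k < s \<longrightarrow> (\<forall>x. nth_deriv k g differentiable (at x))) \<and>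
     (\<forall>k<s. locally_abs_continuous (nth_deriv k g)) \<and>
     nth_deriv s g \<in> Lp_space p}"

text \<open>The gaps are taken in \<^typ>\<open>ereal\<close> because \<open>Inf\<close> and \<open>Sup\<close> of unbounded sets of reals
  are unspecified.\<close>

definition admissible :: "(int \<Rightarrow> real) \<Rightarrow> bool" where
  "admissible x \<longleftrightarrow> 0 < (INF j. ereal (x j - x (j - 1))) \<and> (SUP j. ereal (x j - x (j - 1))) < \<infinity>"

definition lp_norm :: "real \<Rightarrow> (int \<Rightarrow> real) \<Rightarrow> (real \<Rightarrow> 'a::real_normed_vector) \<Rightarrow> ennreal" where
  "lp_norm p x f =
     ennreal_root p (\<Sum>\<^sub>\<infinity>j. ennreal (norm (f (x j)) powr p * (x j - x (j - 1))))"

definition Lambda_space :: "real \<Rightarrow> (real \<Rightarrow> 'a::real_normed_vector) set" where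
  "Lambda_space p = {f. f \<in> borel_measurable lebesgue \<and> bounded (range f) \<and>
     (\<forall>x. admissible x \<longrightarrow> lp_norm p x f < \<infinity>)}"

definition uniform_nodes :: "real \<Rightarrow> int \<Rightarrow> real" where
  "uniform_nodes W j = of_int j / W"

definition forward_diff :: "nat \<Rightarrow> real \<Rightarrow> (real \<Rightarrow> 'a::real_normed_vector) \<Rightarrow> real \<Rightarrow> 'a" where
  "forward_diff s h f x =
     (\<Sum>k=0..s. (real (s choose k) * (-1) ^ (s - k)) *\<^sub>R f (x + real k * h))"

definition modulus_smoothness ::
    "nat \<Rightarrow> real \<Rightarrow> (real \<Rightarrow> 'a::real_normed_vector) \<Rightarrow> real \<Rightarrow> ennreal" where
  "modulus_smoothness s p f \<delta> = (SUP h\<in>{0<..\<delta>}. Lp_norm p (forward_diff s h f))"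

text \<open>\<open>iterated_integral n \<delta> F\<close> is the \<open>n\<close>-fold integral of \<open>F [t\<^sub>1, \<dots>, t\<^sub>n]\<close> with every
  variable running over \<open>[0, \<delta>]\<close>.\<close>

primrec iterated_integral ::
    "nat \<Rightarrow> real \<Rightarrow> (real list \<Rightarrow> 'a) \<Rightarrow> 'a::{banach, second_countable_topology}" where
  "iterated_integral 0 \<delta> F = F []"
| "iterated_integral (Suc n) \<delta> F =
     (LINT t:{0..\<delta>}|lebesgue. iterated_integral n \<delta> (\<lambda>ts. F (t # ts)))"

definition steklov ::
    "nat \<Rightarrow> real \<Rightarrow> (real \<Rightarrow> 'a) \<Rightarrow> real \<Rightarrow> 'a::{banach, second_countable_topology}" where
  "steklov r \<delta> f x = (1 / (- \<delta>) ^ r) *\<^sub>R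
     iterated_integral r \<delta> (\<lambda>ts.
       \<Sum>m=1..r. ((-1) ^ (r - m + 1) * real (r choose m)) *\<^sub>R
         f (x + (real m / real r) * sum_list ts))"

definition semidiscrete_modulus ::
    "nat \<Rightarrow> nat \<Rightarrow> real \<Rightarrow> (real \<Rightarrow> 'a::{banach, second_countable_topology}) \<Rightarrow> real \<Rightarrow> ennreal" where
  "semidiscrete_modulus r s p f W =
     lp_norm p (uniform_nodes W) (\<lambda>x. steklov r (1 / W) f x - f x) + modulus_smoothness s p f (1 / W)"

definition K_functional ::
    "nat \<Rightarrow> real \<Rightarrow> (real \<Rightarrow> 'a::real_normed_vector) \<Rightarrow> real \<Rightarrow> ennreal" where
  "K_functional s p f W =
     (INF g\<in>Sobolev s p. lp_norm p (uniform_nodes W) (\<lambda>x. f x - g x) + Lp_norm p (\<lambda>x. f x - g x)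
        + ennreal (1 / W ^ s) * Lp_norm p (nth_deriv s g))"

end

theory Submission
  imports Defs
begin

text \<open>
Put \<open>\<delta> = 1 / W\<close> and \<open>A\<^sub>c f y = \<integral>\<^sub>0\<^sup>\<delta> f (y + c t) dt\<close>, which is \<open>smear c \<delta> f y\<close> below. Since the iterated
integral of \<open>f (y + c (t\<^sub>1 + \<dots> + t\<^sub>r))\<close> is the \<open>r\<close>-th iterate of \<open>A\<^sub>c\<close>, the Steklov mean of \<open>f\<close> is a
linear combination of the functions \<open>A\<^sub>c\<^sup>r f\<close> with \<open>c = m / r\<close>. On the other hand
the weights are those of a difference of order \<open>r\<close>, so \<open>steklov r \<delta> f - f\<close> is, up to sign, the mean
of the differences of order \<open>r\<close> of \<open>f\<close> over steps in \<open>[0, \<delta>]\<close>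
(\<open>steklov_eq_smear\<close>, \<open>steklov_minus_eq\<close>). All estimates are needed only up to constants, so the
norms are handled through the quasi-triangle inequality with factor \<open>2\<close>.

The modulus is at most a multiple of the K-functional. For any Sobolev function \<open>g\<close> and \<open>h = f - g\<close>,
\<open>steklov r \<delta> f - f = steklov r \<delta> h + (steklov r \<delta> g - g) - h\<close>. Pointwise, the first summand is bounded
by the mean of \<open>|h|\<close> over the window \<open>[x, x + r \<delta>]\<close> (\<open>steklov_le_window\<close>), and the second one by
\<open>\<delta>\<^sup>s\<^sup>-\<^sup>1\<close> times the integral of the absolute value of the \<open>s\<close>-th derivative of \<open>g\<close> over that window
(\<open>steklov_minus_Sobolev_le\<close>). As every real number lies in at most \<open>r + 1\<close> of the windows that start
at nodes, the discrete norm of a window integral is controlled by the continuous norm of the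
integrand (\<open>lp_norm_uniform_le\<close>). The same derivative bound controls the modulus of smoothness
of \<open>g\<close>.

The K-functional is at most a multiple of the modulus. Choose \<open>g = steklov r \<delta> f\<close>. The discrete
part of the K-functional is then the discrete part of the modulus, and Minkowski's integral
inequality bounds \<open>f - g\<close> by differences of order \<open>r\<close>, hence by differences of order \<open>s\<close>
(\<open>Lp_norm_steklov_minus_le\<close>). The derivative of \<open>A\<^sub>c f\<close> is a difference quotient, so the
derivative of order \<open>s\<close> of \<open>A\<^sub>c\<^sup>r f\<close> is \<open>c\<^sup>-\<^sup>s\<close> times the difference of order \<open>s\<close> and step \<open>c \<delta>\<close> of
\<open>A\<^sub>c\<^sup>r\<^sup>-\<^sup>s f\<close>; its norm is bounded by the modulus of smoothness (\<open>Lp_norm_steklov_deriv_le\<close>). For \<open>s = r\<close>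
the last derivative exists only almost everywhere. That \<open>g\<close> lies in the Sobolev space uses
that functions of \<open>Lambda_space p\<close> have finite norm (\<open>Lambda_space_imp_Lp_finite\<close>).

The analytic input is the theory of absolutely continuous functions \<open>G\<close>: they are differentiable
almost everywhere, and \<open>|G b - G a|\<close> is at most the integral of \<open>|G'|\<close>. Both facts are derived
from the Vitali covering theorem. Covering almost all of a set by finitely many disjoint
intervals leaves gaps of small total length, and absolute continuity makes the increment of \<open>G\<close>
over the gaps small.
\<close>

section \<open>Coverings by finitely many intervals\<close>

abbreviation nonoverlapping :: "(real \<times> real) set \<Rightarrow> bool" where
  "nonoverlapping Q \<equiv> pairwise (\<lambda>i j. disjnt {fst i<..<snd i} {fst j<..<snd j}) Q"

abbreviation separated :: "(real \<times> real) set \<Rightarrow> bool" where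
  "separated Q \<equiv> pairwise (\<lambda>i j. disjnt {fst i..snd i} {fst j..snd j}) Q"

abbreviation subintervals :: "(real \<times> real) set \<Rightarrow> (real \<times> real) set \<Rightarrow> bool" where
  "subintervals Q R \<equiv> \<forall>(u, v)\<in>Q. u < v \<and> (\<exists>c d. (c, d) \<in> R \<and> c \<le> u \<and> v \<le> d)"

abbreviation total_length :: "(real \<times> real) set \<Rightarrow> real" where
  "total_length Q \<equiv> \<Sum>(u, v)\<in>Q. v - u"

abbreviation total_increment :: "(real \<Rightarrow> 'a::ab_group_add) \<Rightarrow> (real \<times> real) set \<Rightarrow> 'a" where
  "total_increment G Q \<equiv> \<Sum>(u, v)\<in>Q. G v - G u"

abbreviation variation_over :: "(real \<Rightarrow> 'a::real_normed_vector) \<Rightarrow> (real \<times> real) set \<Rightarrow> real" where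
  "variation_over G Q \<equiv> \<Sum>(u, v)\<in>Q. norm (G v - G u)"

text \<open>
The number \<open>m\<close> is a lower bound for the outer measure of \<open>E\<close>, expressed through measurable
supersets. The Vitali covering theorem gives countably many disjoint intervals that cover \<open>E\<close> up to a null set, so their union has measure at least \<open>m\<close>, and
finitely many of them carry all but \<open>\<eta>\<close> of it.
\<close>

lemma Vitali_covering_intervals:
  fixes P :: "real \<Rightarrow> real \<Rightarrow> bool"
  assumes "open U" "U \<in> lmeasurable" "E \<subseteq> U" "0 < \<eta>"
    and outer: "\<And>T. E \<subseteq> T \<Longrightarrow> T \<in> lmeasurable \<Longrightarrow> m \<le> measure lebesgue T"
    and cover: "\<And>x d. x \<in> E \<Longrightarrow> 0 < d \<Longrightarrow> \<exists>u v. u < v \<and> u \<le> x \<and> x \<le> v \<and> v - u < d \<and> P u v"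
  obtains L where "finite L" "\<And>u v. (u, v) \<in> L \<Longrightarrow> u < v \<and> {u..v} \<subseteq> U \<and> P u v"
    "separated L" "m - \<eta> < total_length L"
    "total_length L \<le> measure lebesgue U"
proof -
  define K where "K = {(u, v). u < v \<and> {u..v} \<subseteq> U \<and> P u v}"
  define a where "a = (\<lambda>i::real\<times>real. (fst i + snd i) / 2)"
  define \<rho> where "\<rho> = (\<lambda>i::real\<times>real. (snd i - fst i) / 2)"
  have ball: "cball (a i) (\<rho> i) = {fst i..snd i}" for i
    unfolding a_def \<rho>_def cball_eq_atLeastAtMost by (auto simp: field_simps)
  have cov: "\<exists>i. i \<in> K \<and> x \<in> cball (a i) (\<rho> i) \<and> \<rho> i < d" if "x \<in> E" "0 < d" for x d
  proof -
    have "x \<in> U" using that assms by auto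
    then obtain e where e: "e > 0" "cball x e \<subseteq> U"
      using \<open>open U\<close> open_contains_cball by blast
    from cover[OF that(1), of "min d e"] that e obtain u v
      where uv: "u < v" "u \<le> x" "x \<le> v" "v - u < min d e" "P u v" by auto
    have "{u..v} \<subseteq> cball x e" using uv by (auto simp: dist_real_def)
    then have "(u, v) \<in> K" using uv e by (auto simp: K_def)
    moreover have "\<rho> (u, v) < d" using uv by (auto simp: \<rho>_def)
    ultimately show ?thesis using uv ball[of "(u,v)"] by (intro exI[of _ "(u,v)"]) auto
  qed
  have pos: "0 < \<rho> i" if "i \<in> K" for i using that by (auto simp: K_def \<rho>_def)
  obtain C where C: "countable C" "C \<subseteq> K"
     "pairwise (\<lambda>i j. disjnt (cball (a i) (\<rho> i)) (cball (a j) (\<rho> j))) C"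
     "negligible (E - (\<Union>i\<in>C. cball (a i) (\<rho> i)))"
    by (rule Vitali_covering_theorem_cballs[OF pos cov])
  define I where "I = (\<lambda>i::real\<times>real. {fst i..snd i})"
  have disj: "pairwise (\<lambda>i j. disjnt (I i) (I j)) C"
    using C(3) unfolding ball I_def by blast
  have neg: "negligible (E - (\<Union>i\<in>C. I i))" using C(4) unfolding ball I_def by blast
  have IU: "I i \<subseteq> U" if "i \<in> C" for i using that C(2) by (cases i) (auto simp: K_def I_def)
  have lt: "fst i < snd i" if "i \<in> C" for i using that C(2) by (auto simp: K_def)
  have lm: "T \<in> lmeasurable" if "T \<in> I ` C" for T using that by (auto simp: I_def)
  have bd: "measure lebesgue (\<Union>D) \<le> measure lebesgue U" if "D \<subseteq> I ` C" "finite D" for D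
  proof (rule measure_mono_fmeasurable[OF _ _ \<open>U \<in> lmeasurable\<close>])
    show "\<Union>D \<subseteq> U"
    proof (rule Union_least)
      fix X assume "X \<in> D"
      then obtain i where "i \<in> C" "X = I i" using \<open>D \<subseteq> I ` C\<close> by blast
      then show "X \<subseteq> U" using IU by simp
    qed
    show "\<Union>D \<in> sets lebesgue" using that lm by (meson fmeasurableD sets.finite_Union subset_iff)
  qed
  obtain D where D: "D \<subseteq> I ` C" "finite D"
     "measure lebesgue (\<Union>(I ` C)) - \<eta> < measure lebesgue (\<Union>D)"
    using measure_countable_Union_approachable[of "I ` C" \<eta>] C(1) \<open>0 < \<eta>\<close> lm bd
    by (metis countable_image)
  obtain L where L: "L \<subseteq> C" "finite L" "D = I ` L"
    using D by (metis finite_subset_image)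
  have UnC: "\<Union>(I ` C) \<in> lmeasurable"
  proof (rule fmeasurableI2[OF \<open>U \<in> lmeasurable\<close>])
    show "\<Union>(I ` C) \<subseteq> U" using IU by auto
    show "\<Union>(I ` C) \<in> sets lebesgue"
      using C(1) by (intro sets.countable_UN') (auto simp: I_def)
  qed
  have "m \<le> measure lebesgue (\<Union>(I ` C) \<union> (E - (\<Union>i\<in>C. I i)))"
  proof (rule outer)
    show "\<Union>(I ` C) \<union> (E - (\<Union>i\<in>C. I i)) \<in> lmeasurable"
      by (rule fmeasurable.Un[OF UnC negligible_imp_measurable[OF neg]])
  qed blast
  also have "\<dots> \<le> measure lebesgue (\<Union>(I ` C)) + measure lebesgue (E - (\<Union>i\<in>C. I i))"
    using UnC neg by (intro measure_Un_le) (auto simp: negligible_imp_sets)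
  also have "\<dots> = measure lebesgue (\<Union>(I ` C))"
    using neg by (simp add: negligible_imp_measure0)
  finally have "m \<le> measure lebesgue (\<Union>(I ` C))" .
  moreover have "measure lebesgue (\<Union>D) = (\<Sum>i\<in>L. measure lebesgue (I i))"
    unfolding L(3)
    using L disj by (intro measure_UNION') (auto simp: I_def intro: pairwise_subset)
  moreover have "(\<Sum>i\<in>L. measure lebesgue (I i)) = total_length L"
  proof (rule sum.cong[OF refl])
    fix i assume "i \<in> L"
    then have "fst i < snd i" using L lt by auto
    then show "measure lebesgue (I i) = (case i of (u, v) \<Rightarrow> v - u)"
      by (cases i) (simp add: I_def)
  qed
  ultimately have "m - \<eta> < total_length L" "total_length L \<le> measure lebesgue U"
    using D(3) bd[OF D(1,2)] by linarith+
  moreover have "u < v \<and> {u..v} \<subseteq> U \<and> P u v" if "(u, v) \<in> L" for u v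
    using that L(1) C(2) by (auto simp: K_def)
  moreover have "separated L"
    using pairwise_subset[OF disj L(1)] by (simp add: I_def)
  ultimately show thesis using that L(2) by blast
qed

text \<open>
Removing disjoint closed intervals \<open>J\<close> from a family \<open>R\<close> leaves a family \<open>Q\<close> of gaps. Increments
are additive, so the increment of any function over \<open>R\<close> splits into those over \<open>J\<close> and
over \<open>Q\<close>; lengths are the increments of the identity. Removing one interval \<open>[u, v]\<close> from
\<open>(c, d)\<close> leaves \<open>(c, u)\<close> and \<open>(v, d)\<close>, and the other intervals of \<open>J\<close> avoid \<open>[u, v]\<close>, so each of them
still lies inside one interval of the remaining family.
\<close>

lemma interval_gaps:
  fixes J R :: "(real \<times> real) set"
  assumes "finite J" "finite R" "\<And>c d. (c, d) \<in> R \<Longrightarrow> c < d"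
    and "nonoverlapping R"
    and "separated J"
    and "\<And>u v. (u, v) \<in> J \<Longrightarrow> u < v \<and> (\<exists>c d. (c, d) \<in> R \<and> c \<le> u \<and> v \<le> d)"
  shows "\<exists>Q. finite Q \<and> subintervals Q R \<and>
    nonoverlapping Q \<and>
    (\<forall>G :: real \<Rightarrow> 'a::ab_group_add.
      total_increment G R = total_increment G J + total_increment G Q) \<and>
      total_length R = total_length J + total_length Q"
  using assms
proof (induction J arbitrary: R rule: finite_induct)
  case empty
  then show ?case by (intro exI[of _ R]) auto
next
  case (insert j J)
  obtain u v where j: "j = (u, v)" by (cases j)
  from insert.prems(5)[of u v] obtain c d where cd: "(c, d) \<in> R" "c \<le> u" "v \<le> d" and uv: "u < v"
    by (auto simp: j)
  define N where "N = {(x, y). ((x, y) = (c, u) \<or> (x, y) = (v, d)) \<and> x < y}"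
  define R' where "R' = (R - {(c, d)}) \<union> N"
  have N: "N \<subseteq> {(c, u), (v, d)}" by (auto simp: N_def)
  have finN: "finite N" using finite_subset[OF N] by auto
  have lt': "x < y" if "(x, y) \<in> R'" for x y using that insert.prems by (auto simp: R'_def N_def)
  have Rd: "{x<..<y} \<inter> {c<..<d} = {}" if "(x, y) \<in> R - {(c, d)}" for x y
    using insert.prems(3) cd that unfolding pairwise_def disjnt_def by fastforce
  have disjR': "nonoverlapping R'"
    unfolding R'_def pairwise_def
  proof (intro ballI impI)
    fix i j assume ij: "i \<in> R - {(c, d)} \<union> N" "j \<in> R - {(c, d)} \<union> N" "i \<noteq> j"
    have NR: "disjnt {fst i<..<snd i} {fst j<..<snd j}" if "i \<in> R - {(c, d)}" "j \<in> N" for i j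
    proof -
      have "{fst j<..<snd j} \<subseteq> {c<..<d}" using that cd uv by (auto simp: N_def)
      moreover have "{fst i<..<snd i} \<inter> {c<..<d} = {}" using that Rd[of "fst i" "snd i"] by simp
      ultimately show ?thesis unfolding disjnt_def by blast
    qed
    have "(i \<in> R \<and> j \<in> R) \<or> (i \<in> R - {(c,d)} \<and> j \<in> N) \<or> (j \<in> R - {(c,d)} \<and> i \<in> N) \<or> (i \<in> N \<and> j \<in> N)"
      using ij(1,2) by fast
    then consider "i \<in> R" "j \<in> R" | "i \<in> R - {(c,d)}" "j \<in> N" | "j \<in> R - {(c,d)}" "i \<in> N" | "i \<in> N" "j \<in> N"
      by argo
    then show "disjnt {fst i<..<snd i} {fst j<..<snd j}"
    proof cases
      case 1 then show ?thesis using pairwiseD[OF insert.prems(3)] ij(3) by simp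
    next
      case 2 then show ?thesis using NR by blast
    next
      case 3 then show ?thesis using NR disjnt_sym by blast
    next
      case 4
      then have "i \<in> {(c, u), (v, d)}" "j \<in> {(c, u), (v, d)}" using subsetD[OF N] by simp_all
      then show ?thesis using ij(3) uv by (auto simp: disjnt_def)
    qed
  qed
  have RN: "(R - {(c, d)}) \<inter> N = {}"
  proof -
    have False if "(x, y) \<in> R - {(c, d)}" "(x, y) \<in> N" for x y
    proof -
      have "x < y" "c \<le> x" "y \<le> d" using that uv cd by (auto simp: N_def)
      then have "(x + y) / 2 \<in> {x<..<y} \<inter> {c<..<d}" by auto
      then show False using Rd[OF that(1)] by blast
    qed
    then show ?thesis by auto
  qed
  have sumN: "(\<Sum>(x, y)\<in>N. G y - G x) = (G u - G c) + (G d - G v)" for G :: "real \<Rightarrow> 'b::ab_group_add"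
  proof -
    have "(\<Sum>(x, y)\<in>N. G y - G x) = (\<Sum>(x, y)\<in>{(c, u), (v, d)}. G y - G x)"
      using N cd uv by (intro sum.mono_neutral_left) (auto simp: N_def)
    also have "\<dots> = (G u - G c) + (G d - G v)" using uv cd by (subst sum.insert) auto
    finally show ?thesis .
  qed
  have sumR': "(\<Sum>(x, y)\<in>R. G y - G x) = (G v - G u) + (\<Sum>(x, y)\<in>R'. G y - G x)" for G :: "real \<Rightarrow> 'b::ab_group_add"
  proof -
    have A: "(\<Sum>(x, y)\<in>R'. G y - G x) = (\<Sum>(x, y)\<in>R - {(c, d)}. G y - G x) + (\<Sum>(x, y)\<in>N. G y - G x)"
      unfolding R'_def using insert.prems(1) finN RN by (intro sum.union_disjoint) auto
    have B: "(\<Sum>(x, y)\<in>R. G y - G x) = (G d - G c) + (\<Sum>(x, y)\<in>R - {(c, d)}. G y - G x)"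
      using insert.prems(1) cd(1) by (subst sum.remove[of R "(c, d)"]) auto
    show ?thesis unfolding A B sumN by (simp add: algebra_simps)
  qed
  have R'R: "\<exists>c d. (c, d) \<in> R \<and> c \<le> x \<and> y \<le> d" if "(x, y) \<in> R'" for x y
  proof (cases "(x, y) \<in> R")
    case True
    then show ?thesis by (intro exI[of _ x] exI[of _ y]) auto
  next
    case False
    then show ?thesis using that cd uv by (intro exI[of _ c] exI[of _ d]) (auto simp: R'_def N_def)
  qed
  have "\<exists>Q. finite Q \<and> subintervals Q R' \<and>
    nonoverlapping Q \<and>
    (\<forall>G :: real \<Rightarrow> 'a.
      total_increment G R' = total_increment G J + total_increment G Q) \<and>
      total_length R' = total_length J + total_length Q"
  proof (rule insert.IH)
    show "finite R'" using insert.prems finN by (auto simp: R'_def)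
    show "separated J"
      using insert.prems(4) by (rule pairwise_subset) auto
    fix x y assume xy: "(x, y) \<in> J"
    then obtain c' d' where cd': "(c', d') \<in> R" "c' \<le> x" "y \<le> d'" and "x < y"
      using insert.prems(5)[of x y] by auto
    have "\<exists>c d. (c, d) \<in> R' \<and> c \<le> x \<and> y \<le> d"
    proof (cases "(c', d') = (c, d)")
      case True
      have "disjnt {x..y} {u..v}"
        using insert.prems(4) insert.hyps(2) xy unfolding pairwise_def j by fastforce
      then have "y < u \<or> v < x" using uv \<open>x < y\<close> unfolding disjnt_def
        by (metis atLeastAtMost_iff disjoint_iff less_eq_real_def linorder_not_less)
      then show ?thesis
      proof
        assume "y < u"
        then have "(c, u) \<in> R'" using cd' True \<open>x < y\<close> by (auto simp: R'_def N_def)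
        then show ?thesis using cd' True \<open>y < u\<close> by (intro exI[of _ c] exI[of _ u]) auto
      next
        assume "v < x"
        then have "(v, d) \<in> R'" using cd' True \<open>x < y\<close> by (auto simp: R'_def N_def)
        then show ?thesis using cd' True \<open>v < x\<close> by (intro exI[of _ v] exI[of _ d]) auto
      qed
    next
      case False
      then have "(c', d') \<in> R'" using cd' by (auto simp: R'_def)
      then show ?thesis using cd' by auto
    qed
    then show "x < y \<and> (\<exists>c d. (c, d) \<in> R' \<and> c \<le> x \<and> y \<le> d)" using \<open>x < y\<close> by simp
  qed (use lt' disjR' in auto)
  then obtain Q where Q: "finite Q" and "subintervals Q R'"
    and Q3: "nonoverlapping Q"
    and Q4: "\<forall>G :: real \<Rightarrow> 'a.
      total_increment G R' = total_increment G J + total_increment G Q"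
    and Q5: "total_length R' = total_length J + total_length Q"
    by (elim exE conjE)
  then have Q2: "\<And>u v. (u, v)\<in>Q \<Longrightarrow> u < v \<and> (\<exists>c d. (c, d) \<in> R' \<and> c \<le> u \<and> v \<le> d)" by blast
  have sub: "\<exists>c d. (c, d) \<in> R \<and> c \<le> x \<and> y \<le> d" if "(x, y) \<in> Q" for x y
  proof -
    from Q2[OF that] obtain c1 d1 where 1: "(c1, d1) \<in> R'" "c1 \<le> x" "y \<le> d1" by auto
    from R'R[OF 1(1)] obtain c2 d2 where "(c2, d2) \<in> R" "c2 \<le> c1" "d1 \<le> d2" by auto
    then show ?thesis using 1 by (intro exI[of _ c2] exI[of _ d2]) auto
  qed
  show ?case
  proof (intro exI[of _ Q] conjI allI)
    show "finite Q" by fact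
    show "subintervals Q R" using Q2 sub by auto
    show "nonoverlapping Q" by (fact Q3)
    show "total_increment G R = total_increment G (insert j J) + total_increment G Q" for G :: "real \<Rightarrow> 'a"
      unfolding sumR'[of G] Q4[rule_format, of G] using insert.hyps by (simp add: j algebra_simps)
    show "total_length R = total_length (insert j J) + total_length Q"
      using sumR'[of "\<lambda>x. x"] Q5 insert.hyps by (simp add: j algebra_simps)
  qed
qed

text \<open>
The definition enumerates the intervals; finite sets of endpoint pairs are easier to combine
with \<open>interval_gaps\<close>.
\<close>

lemma abs_continuous_finite:
  assumes "abs_continuous_on_interval a b G" "0 < \<epsilon>"
  obtains \<delta> where "0 < \<delta>"
    "\<And>Q. finite Q \<Longrightarrow> (\<And>u v. (u, v) \<in> Q \<Longrightarrow> a \<le> u \<and> u < v \<and> v \<le> b) \<Longrightarrow>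
       nonoverlapping Q \<Longrightarrow>
       total_length Q < \<delta> \<Longrightarrow> variation_over G Q < \<epsilon>"
proof -
  define AC where "AC = (\<lambda>\<delta>. \<forall>(n::nat) u v.
        (\<forall>i<n. a \<le> u i \<and> u i < v i \<and> v i \<le> b) \<and>
        disjoint_family_on (\<lambda>i. {u i<..<v i}) {..<n} \<and>
        (\<Sum>i<n. v i - u i) < \<delta>
        \<longrightarrow> (\<Sum>i<n. norm (G (v i) - G (u i))) < \<epsilon>)"
  have "\<exists>\<delta>>0. AC \<delta>"
    using assms unfolding abs_continuous_on_interval_def AC_def by (elim allE[of _ \<epsilon>] impE)
  then obtain \<delta> where "0 < \<delta>" and AC: "AC \<delta>" by blast
  have \<delta>: "(\<Sum>i<n. norm (G (v i) - G (u i))) < \<epsilon>"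
    if "\<forall>i<n. a \<le> u i \<and> u i < v i \<and> v i \<le> b" "disjoint_family_on (\<lambda>i. {u i<..<v i}) {..<n}"
      "(\<Sum>i<n. v i - u i) < \<delta>" for n :: nat and u v
    using AC[unfolded AC_def, rule_format, of n u v] that by simp
  show thesis
  proof (rule that[OF \<open>0 < \<delta>\<close>])
    fix Q assume Q: "finite Q" "\<And>u v. (u, v) \<in> Q \<Longrightarrow> a \<le> u \<and> u < v \<and> v \<le> b"
       "nonoverlapping Q" "total_length Q < \<delta>"
    obtain h where h: "bij_betw h {..<card Q} Q"
      using ex_bij_betw_nat_finite[OF Q(1)] by (auto simp: lessThan_atLeast0)
    have hQ: "h i \<in> Q" if "i < card Q" for i using h that by (auto simp: bij_betw_def)
    have eq: "(\<Sum>i<card Q. F (h i)) = sum F Q" for F :: "real \<times> real \<Rightarrow> real"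
      using sum.reindex_bij_betw[OF h] by simp
    have "(\<Sum>i<card Q. norm (G (snd (h i)) - G (fst (h i)))) < \<epsilon>"
    proof (rule \<delta>)
      show "\<forall>i<card Q. a \<le> fst (h i) \<and> fst (h i) < snd (h i) \<and> snd (h i) \<le> b"
        using hQ Q(2)[of "fst (h i)" "snd (h i)" for i] by auto
      show "disjoint_family_on (\<lambda>i. {fst (h i)<..<snd (h i)}) {..<card Q}"
        unfolding disjoint_family_on_def
      proof (intro ballI impI)
        fix i k assume ik: "i \<in> {..<card Q}" "k \<in> {..<card Q}" "i \<noteq> k"
        then have "h i \<noteq> h k" using h by (auto simp: bij_betw_def inj_on_def)
        then show "{fst (h i)<..<snd (h i)} \<inter> {fst (h k)<..<snd (h k)} = {}"
          using Q(3) hQ ik unfolding pairwise_def disjnt_def by auto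
      qed
      show "(\<Sum>i<card Q. snd (h i) - fst (h i)) < \<delta>"
        using Q(4) eq[of "\<lambda>(u,v). v - u"] by (simp add: case_prod_beta)
    qed
    then show "variation_over G Q < \<epsilon>"
      using eq[of "\<lambda>(u,v). norm (G v - G u)"] by (simp add: case_prod_beta)
  qed
qed

section \<open>Absolutely continuous functions\<close>

text \<open>
The number \<open>m\<close> is the outer measure of \<open>E\<close>, approximated from outside by open sets.
\<close>

lemma outer_measure_witness:
  fixes a b :: real
  assumes "E \<subseteq> {a<..<b}" "\<not> negligible E"
  obtains m where "0 < m" "\<And>T. E \<subseteq> T \<Longrightarrow> T \<in> lmeasurable \<Longrightarrow> m \<le> measure lebesgue T"
    "\<And>\<eta>. 0 < \<eta> \<Longrightarrow> \<exists>U. open U \<and> U \<in> lmeasurable \<and> E \<subseteq> U \<and> U \<subseteq> {a<..<b} \<and> measure lebesgue U < m + \<eta>"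
proof -
  define \<M> where "\<M> = measure lebesgue ` {T. E \<subseteq> T \<and> T \<in> lmeasurable}"
  define m where "m = Inf \<M>"
  have ne: "\<M> \<noteq> {}" using assms(1) by (auto simp: \<M>_def)
  have bdd: "bdd_below \<M>" by (auto simp: \<M>_def intro!: bdd_belowI[of _ 0])
  obtain e where e: "e > 0" "\<And>T. E \<subseteq> T \<Longrightarrow> T \<in> lmeasurable \<Longrightarrow> e \<le> measure lebesgue T"
    using assms(2) unfolding negligible_outer by (meson not_less)
  have "e \<le> m" unfolding m_def using ne e by (intro cInf_greatest) (auto simp: \<M>_def)
  have lower: "m \<le> measure lebesgue T" if "E \<subseteq> T" "T \<in> lmeasurable" for T
    unfolding m_def using bdd that by (intro cInf_lower) (auto simp: \<M>_def)
  have "\<exists>U. open U \<and> U \<in> lmeasurable \<and> E \<subseteq> U \<and> U \<subseteq> {a<..<b} \<and> measure lebesgue U < m + \<eta>" if \<eta>: "0 < \<eta>" for \<eta>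
  proof -
    have "\<exists>x\<in>\<M>. x < m + \<eta> / 2"
      using ne bdd that unfolding m_def by (subst cInf_less_iff[symmetric]) auto
    then obtain T where T: "E \<subseteq> T" "T \<in> lmeasurable" "measure lebesgue T < m + \<eta> / 2"
      by (auto simp: \<M>_def)
    obtain V where V: "open V" "T \<subseteq> V" "V - T \<in> lmeasurable" "emeasure lebesgue (V - T) < ennreal (\<eta> / 2)"
      using sets_lebesgue_outer_open[of T "\<eta> / 2"] fmeasurableD[OF T(2)] half_gt_zero[OF \<eta>] by metis
    have mV: "measure lebesgue (V - T) < \<eta> / 2"
      using V that by (simp add: emeasure_eq_measure2 ennreal_less_iff)
    have VT: "V = T \<union> (V - T)" using V by auto
    have Vl: "V \<in> lmeasurable" by (subst VT) (rule fmeasurable.Un[OF T(2) V(3)])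
    have "measure lebesgue V \<le> measure lebesgue T + measure lebesgue (V - T)"
      by (subst VT) (rule measure_Un_le, use T V in auto)
    then have "measure lebesgue V < m + \<eta>" using T(3) mV by linarith
    moreover have "measure lebesgue (V \<inter> {a<..<b}) \<le> measure lebesgue V"
      using Vl by (intro measure_mono_fmeasurable) auto
    moreover have "V \<inter> {a<..<b} \<in> lmeasurable"
      using Vl by (intro fmeasurable_Int_fmeasurable) auto
    ultimately show ?thesis
      using V T assms by (intro exI[of _ "V \<inter> {a<..<b}"]) auto
  qed
  with that[of m] e(1) \<open>e \<le> m\<close> lower show thesis by auto
qed

text \<open>
Suppose that \<open>E\<close> has outer measure \<open>m > 0\<close>. Disjoint intervals \<open>F\<close> of slope at least \<open>q\<close>, inside an open
set \<open>U\<close> hardly larger than \<open>E\<close>, cover almost all of \<open>E\<close>; inside these, disjoint intervals \<open>L\<close>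
of slope at most \<open>p\<close> still cover almost all of \<open>E\<close>. The gaps between \<open>F\<close> and \<open>L\<close> then have tiny total
length, but carry an increment of about \<open>(q - p) m\<close>, which absolute continuity excludes.
\<close>

lemma abs_continuous_crossing_slopes_negligible:
  fixes G :: "real \<Rightarrow> real"
  assumes ac: "abs_continuous_on_interval a b G" and E: "E \<subseteq> {a<..<b}" and "p < q"
    and up: "\<And>x d. x \<in> E \<Longrightarrow> 0 < d \<Longrightarrow> \<exists>u v. u < v \<and> u \<le> x \<and> x \<le> v \<and> v - u < d \<and> q * (v - u) \<le> G v - G u"
    and down: "\<And>x d. x \<in> E \<Longrightarrow> 0 < d \<Longrightarrow> \<exists>u v. u < v \<and> u \<le> x \<and> x \<le> v \<and> v - u < d \<and> G v - G u \<le> p * (v - u)"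
  shows "negligible E"
proof (rule ccontr)
  assume "\<not> negligible E"
  then obtain m where m: "0 < m" "\<And>T. E \<subseteq> T \<Longrightarrow> T \<in> lmeasurable \<Longrightarrow> m \<le> measure lebesgue T"
    and U: "\<And>\<eta>. 0 < \<eta> \<Longrightarrow> \<exists>U. open U \<and> U \<in> lmeasurable \<and> E \<subseteq> U \<and> U \<subseteq> {a<..<b} \<and> measure lebesgue U < m + \<eta>"
    by (rule outer_measure_witness[OF E]) blast
  define \<epsilon> where "\<epsilon> = (q - p) * m / 4"
  have "\<epsilon> > 0" using m \<open>p < q\<close> by (simp add: \<epsilon>_def)
  obtain \<delta> where \<delta>: "0 < \<delta>"
    "\<And>Q. finite Q \<Longrightarrow> (\<And>u v. (u, v) \<in> Q \<Longrightarrow> a \<le> u \<and> u < v \<and> v \<le> b) \<Longrightarrow>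
       nonoverlapping Q \<Longrightarrow>
       total_length Q < \<delta> \<Longrightarrow> variation_over G Q < \<epsilon>"
    using abs_continuous_finite[OF ac \<open>\<epsilon> > 0\<close>] by blast
  \<comment> \<open>The gaps have total length below \<open>4 \<eta>\<close>, which has to stay below \<open>\<delta>\<close>; the intervals in \<open>L\<close> have
      total length above \<open>m - 3 \<eta>\<close>, which has to stay above \<open>m / 2\<close>; and the slope \<open>q\<close> contributes
      at most \<open>4 \<eta> |q|\<close>.\<close>
  define \<eta> where "\<eta> = min (m / 6) (min (\<delta> / 5) (\<epsilon> / (5 * (\<bar>q\<bar> + 1))))"
  have "\<eta> \<le> m / 6" "\<eta> \<le> \<delta> / 5" "\<eta> \<le> \<epsilon> / (5 * (\<bar>q\<bar> + 1))"
    unfolding \<eta>_def by linarith+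
  moreover have "\<eta> > 0" using m(1) \<delta>(1) \<open>\<epsilon> > 0\<close> by (simp add: \<eta>_def)
  ultimately have \<eta>: "6 * \<eta> \<le> m" "5 * \<eta> \<le> \<delta>" "5 * \<eta> * (\<bar>q\<bar> + 1) \<le> \<epsilon>" "\<eta> > 0"
    by (auto simp: field_simps)
  obtain U where U: "open U" "U \<in> lmeasurable" "E \<subseteq> U" "U \<subseteq> {a<..<b}" "measure lebesgue U < m + \<eta>"
    using U[OF \<open>\<eta> > 0\<close>] by blast
  obtain F where F: "finite F" "\<And>u v. (u, v) \<in> F \<Longrightarrow> u < v \<and> {u..v} \<subseteq> U \<and> q * (v - u) \<le> G v - G u"
    "separated F" "m - \<eta> < total_length F"
    "total_length F \<le> measure lebesgue U"
    by (rule Vitali_covering_intervals[OF U(1,2,3) \<open>\<eta> > 0\<close> m(2) up]) blast+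
  define V where "V = (\<Union>(u, v)\<in>F. {u<..<v})"
  have "open V" unfolding V_def by auto
  have VU: "V \<subseteq> U" using F(2) by (fastforce simp: V_def)
  have Vl: "V \<in> lmeasurable"
    by (rule fmeasurableI2[OF U(2) VU]) (use \<open>open V\<close> in auto)
  have mV: "measure lebesgue V = total_length F"
  proof -
    have "measure lebesgue (\<Union>i\<in>F. {fst i<..<snd i}) = (\<Sum>i\<in>F. measure lebesgue {fst i<..<snd i})"
    proof (rule measure_UNION')
      show "nonoverlapping F"
        using F(3) by (rule pairwise_mono) (auto simp: disjnt_def disjoint_iff)
    qed (use F in auto)
    also have "\<dots> = total_length F"
      using F(2) by (intro sum.cong) (auto simp: less_imp_le)
    also have "(\<Union>i\<in>F. {fst i<..<snd i}) = V" by (auto simp: V_def)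
    finally show ?thesis .
  qed
  \<comment> \<open>The open intervals of \<open>F\<close> miss at most \<open>2 \<eta>\<close> of the outer measure of \<open>E\<close>.\<close>
  have out: "m - 2 * \<eta> \<le> measure lebesgue T" if T: "E \<inter> V \<subseteq> T" "T \<in> lmeasurable" for T
  proof -
    have "m \<le> measure lebesgue (T \<union> (U - V))"
      using T U Vl by (intro m(2)) (auto intro!: fmeasurable.Un fmeasurable_Diff fmeasurableD)
    also have "\<dots> \<le> measure lebesgue T + measure lebesgue (U - V)"
      using T U Vl by (intro measure_Un_le) (auto intro!: fmeasurableD)
    also have "measure lebesgue (U - V) = measure lebesgue U - measure lebesgue V"
      using U Vl VU by (intro measurable_measure_Diff) auto
    finally show ?thesis using U(5) F(4) mV by linarith
  qed
  obtain L where L: "finite L" "\<And>u v. (u, v) \<in> L \<Longrightarrow> u < v \<and> {u..v} \<subseteq> V \<and> G v - G u \<le> p * (v - u)"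
    "separated L" "m - 2 * \<eta> - \<eta> < total_length L"
    "total_length L \<le> measure lebesgue V"
    by (rule Vitali_covering_intervals[OF \<open>open V\<close> Vl _ \<open>\<eta> > 0\<close> out, where P = "\<lambda>u v. G v - G u \<le> p * (v - u)"])
      (use down in auto)
  have inside: "\<exists>c d. (c, d) \<in> F \<and> c \<le> u \<and> v \<le> d" if "(u, v) \<in> L" for u v
  proof -
    have uv: "u < v" "{u..v} \<subseteq> V" using L(2)[OF that] by auto
    then have "u \<in> V" by auto
    then obtain c d where cd: "(c, d) \<in> F" "c < u" "u < d" by (auto simp: V_def)
    have "v \<le> d"
    proof (rule ccontr)
      assume "\<not> v \<le> d"
      then have "d \<in> V" using uv cd by (auto simp: subset_iff)
      then obtain c' d' where cd': "(c', d') \<in> F" "c' < d" "d < d'" by (auto simp: V_def)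
      then have "(c', d') \<noteq> (c, d)" by auto
      then have "disjnt {c'..d'} {c..d}" using pairwiseD[OF F(3) cd'(1) cd(1)] by simp
      then show False using cd cd' by (auto simp: disjnt_def disjoint_iff)
    qed
    then show ?thesis using cd by (intro exI[of _ c] exI[of _ d]) auto
  qed
  have "\<exists>Q. finite Q \<and> subintervals Q F \<and>
    nonoverlapping Q \<and>
    (\<forall>G :: real \<Rightarrow> real.
      total_increment G F = total_increment G L + total_increment G Q) \<and>
      total_length F = total_length L + total_length Q"
  proof (rule interval_gaps[OF L(1) F(1)])
    show "nonoverlapping F"
      using F(3) by (rule pairwise_mono) (auto simp: disjnt_def disjoint_iff)
  qed (use F(2) L(2,3) inside in auto)
  then obtain Q where Q: "finite Q" and Q2: "subintervals Q F"
    and Q3: "nonoverlapping Q"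
    and Q4: "\<forall>G :: real \<Rightarrow> real.
      total_increment G F = total_increment G L + total_increment G Q"
    and Q5: "total_length F = total_length L + total_length Q"
    by (elim exE conjE)
  have Qab: "a \<le> u \<and> u < v \<and> v \<le> b" if uv: "(u, v) \<in> Q" for u v
  proof -
    obtain c d where cd: "(c, d) \<in> F" "c \<le> u" "v \<le> d" "u < v" using Q2 uv by blast
    then have "c \<in> {a<..<b}" "d \<in> {a<..<b}" using F(2)[of c d] U(4) by (auto simp: subset_iff)
    then show ?thesis using cd by auto
  qed
  define SF where "SF = total_length F"
  define SL where "SL = total_length L"
  have lenQ: "total_length Q = SF - SL" using Q5 by (simp add: SF_def SL_def)
  have SF_SL: "SF - SL < 4 * \<eta>" "0 \<le> SF - SL" using F(5) U(5) L(4,5) mV by (auto simp: SF_def SL_def)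
  have "variation_over G Q < \<epsilon>"
    by (rule \<delta>(2)[OF Q Qab Q3]) (use lenQ SF_SL \<eta> in auto)
  moreover have "total_increment G Q \<le> variation_over G Q"
    by (intro sum_mono) auto
  moreover have "q * SF \<le> total_increment G F"
    unfolding SF_def sum_distrib_left using F(2) by (intro sum_mono) auto
  moreover have "total_increment G L \<le> p * SL"
    unfolding SL_def sum_distrib_left using L(2) by (intro sum_mono) auto
  ultimately have "q * SF - p * SL < \<epsilon>" using Q4[rule_format, of G] by linarith
  moreover have "q * SF - p * SL = (q - p) * SL + q * (SF - SL)" by (simp add: algebra_simps)
  moreover have "- (q * (SF - SL)) \<le> \<epsilon>"
  proof -
    have "- (q * (SF - SL)) \<le> \<bar>q\<bar> * (SF - SL)" using SF_SL(2) by (simp add: abs_if mult_le_0_iff mult_right_mono)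
    also have "\<dots> \<le> (\<bar>q\<bar> + 1) * (5 * \<eta>)" using SF_SL \<eta> by (intro mult_mono) auto
    finally show ?thesis using \<eta>(3) by (simp add: mult.commute)
  qed
  moreover have "(q - p) * (m / 2) \<le> (q - p) * SL"
    using L(4) \<eta> \<open>p < q\<close> by (intro mult_left_mono) (auto simp: SL_def)
  ultimately show False unfolding \<epsilon>_def using \<open>p < q\<close> m(1) by (simp add: field_simps)
qed

text \<open>
On an interval that is shorter than the \<open>\<delta>\<close> belonging to \<open>\<epsilon> = 1\<close>, the total variation
is at most \<open>1\<close>, while intervals of slope at least \<open>n\<close> that cover a set of outer measure \<open>m\<close>
contribute about \<open>n m\<close>.
\<close>

lemma abs_continuous_unbounded_slopes_negligible:
  fixes G :: "real \<Rightarrow> 'a::real_normed_vector"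
  assumes ac: "abs_continuous_on_interval a b G" and E: "E \<subseteq> {a<..<b}"
    and steep: "\<And>x d n. x \<in> E \<Longrightarrow> 0 < d \<Longrightarrow>
      \<exists>u v. u < v \<and> u \<le> x \<and> x \<le> v \<and> v - u < d \<and> real n * (v - u) \<le> norm (G v - G u)"
  shows "negligible E"
proof -
  obtain \<delta> where \<delta>: "0 < \<delta>"
    "\<And>Q. finite Q \<Longrightarrow> (\<And>u v. (u, v) \<in> Q \<Longrightarrow> a \<le> u \<and> u < v \<and> v \<le> b) \<Longrightarrow>
       nonoverlapping Q \<Longrightarrow>
       total_length Q < \<delta> \<Longrightarrow> variation_over G Q < 1"
    using abs_continuous_finite[OF ac, of 1] by auto
  \<comment> \<open>Overlapping open intervals of length \<open>2 \<delta> / 3 < \<delta>\<close> cover the line.\<close>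
  define B where "B = (\<lambda>k::int. {a<..<b} \<inter> {(of_int k - 1) * (\<delta> / 3)<..<(of_int k + 1) * (\<delta> / 3)})"
  have neg: "negligible (E \<inter> B k)" for k
  proof (rule ccontr)
    assume "\<not> negligible (E \<inter> B k)"
    with E obtain m where m: "0 < m" "\<And>T. E \<inter> B k \<subseteq> T \<Longrightarrow> T \<in> lmeasurable \<Longrightarrow> m \<le> measure lebesgue T"
      using outer_measure_witness[of "E \<inter> B k" a b] by (metis inf.coboundedI1)
    obtain n where n: "2 / m < real n" using reals_Archimedean2 by blast
    have Bl: "B k \<in> lmeasurable" "open (B k)"
      by (auto simp: B_def intro!: fmeasurable_Int_fmeasurable)
    have "measure lebesgue (B k) \<le> measure lebesgue {(of_int k - 1) * (\<delta> / 3)<..<(of_int k + 1) * (\<delta> / 3)}"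
      using Bl by (intro measure_mono_fmeasurable) (auto simp: B_def)
    also have "\<dots> < \<delta>" using \<delta>(1) by (simp add: field_simps)
    finally have mB: "measure lebesgue (B k) < \<delta>" .
    obtain L where L: "finite L" "\<And>u v. (u, v) \<in> L \<Longrightarrow> u < v \<and> {u..v} \<subseteq> B k \<and> real n * (v - u) \<le> norm (G v - G u)"
      "separated L" "m - m / 2 < total_length L"
      "total_length L \<le> measure lebesgue (B k)"
      by (rule Vitali_covering_intervals[OF Bl(2,1) _ _ m(2), where \<eta> = "m / 2" and P = "\<lambda>u v. real n * (v - u) \<le> norm (G v - G u)"])
        (use steep m(1) in auto)
    have "variation_over G L < 1"
    proof (rule \<delta>(2)[OF L(1)])
      fix u v assume "(u, v) \<in> L"
      then have "u < v" "{u..v} \<subseteq> B k" using L(2)[of u v] by auto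
      then have "u < v" "u \<in> {a<..<b}" "v \<in> {a<..<b}" by (auto simp: B_def subset_iff)
      then show "a \<le> u \<and> u < v \<and> v \<le> b" by auto
    next
      show "nonoverlapping L"
        using L(3) by (rule pairwise_mono) (auto simp: disjnt_def disjoint_iff)
    qed (use L mB in auto)
    moreover have "real n * total_length L \<le> variation_over G L"
      unfolding sum_distrib_left using L(2) by (intro sum_mono) auto
    moreover have "real n * (m / 2) \<le> real n * total_length L"
      using L(4) by (intro mult_left_mono) auto
    ultimately show False using n m(1) by (simp add: field_simps)
  qed
  have "E \<subseteq> (\<Union>k. E \<inter> B k)"
  proof
    fix x assume "x \<in> E"
    define k where "k = \<lfloor>x / (\<delta> / 3)\<rfloor>"
    have "of_int k \<le> x / (\<delta> / 3)" "x / (\<delta> / 3) < of_int k + 1" unfolding k_def by linarith+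
    then have "of_int k * (\<delta> / 3) \<le> x" "x < (of_int k + 1) * (\<delta> / 3)" using \<delta>(1)
      by (auto simp: field_simps)
    moreover have "(of_int k - 1) * (\<delta> / 3) < of_int k * (\<delta> / 3)" using \<delta>(1) by (simp add: field_simps)
    ultimately have "x \<in> B k" using E \<open>x \<in> E\<close> by (auto simp: B_def)
    then show "x \<in> (\<Union>k. E \<inter> B k)" using \<open>x \<in> E\<close> by auto
  qed
  moreover have "negligible (\<Union>k\<in>(UNIV :: int set). E \<inter> B k)"
    using negligible_countable_Union[of "range (\<lambda>k. E \<inter> B k)"] neg by auto
  ultimately show ?thesis using negligible_subset by blast
qed

text \<open>
If the difference quotient at \<open>x\<close> has no finite limit, then either its lower limit is smaller than
its upper limit, and two rational slopes \<open>p < q\<close> separate them, or it is unbounded near \<open>x\<close>. The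
first set is a countable union of null sets by \<open>abs_continuous_crossing_slopes_negligible\<close>, the
second one is null by \<open>abs_continuous_unbounded_slopes_negligible\<close>.
\<close>

lemma abs_continuous_real_differentiable_AE:
  fixes G :: "real \<Rightarrow> real"
  assumes ac: "abs_continuous_on_interval a b G"
  shows "negligible {x \<in> {a<..<b}. \<not> G differentiable (at x)}"
proof -
  define \<sigma> where "\<sigma> = (\<lambda>x y. (G y - G x) / (y - x))"
  have near: "\<exists>u v. u < v \<and> u \<le> x \<and> x \<le> v \<and> v - u < d \<and> P ((G v - G u) / (v - u))"
    if "frequently (\<lambda>y. P (\<sigma> x y)) (at x)" "0 < d" for P x d
  proof -
    have "\<exists>y. y \<noteq> x \<and> dist y x < d \<and> P (\<sigma> x y)"
      using that unfolding frequently_def eventually_at by (metis UNIV_I)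
    then obtain y where y: "y \<noteq> x" "\<bar>y - x\<bar> < d" "P (\<sigma> x y)" by (auto simp: dist_real_def)
    show ?thesis
    proof (cases "x < y")
      case True
      then show ?thesis using y by (intro exI[of _ x] exI[of _ y]) (auto simp: \<sigma>_def)
    next
      case False
      have "\<sigma> x y = (G x - G y) / (x - y)" unfolding \<sigma>_def by (metis minus_diff_eq minus_divide_divide)
      then show ?thesis using y False by (intro exI[of _ y] exI[of _ x]) auto
    qed
  qed
  define D where "D = (\<lambda>p q. {x \<in> {a<..<b}. frequently (\<lambda>y. \<sigma> x y \<le> p) (at x) \<and> frequently (\<lambda>y. q \<le> \<sigma> x y) (at x)})"
  define I where "I = {x \<in> {a<..<b}. \<forall>n::nat. frequently (\<lambda>y. real n \<le> \<bar>\<sigma> x y\<bar>) (at x)}"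
  have "negligible (D p q)" if "p < q" for p q
  proof (rule abs_continuous_crossing_slopes_negligible[OF ac _ that])
    fix x d :: real assume "x \<in> D p q" "0 < d"
    then have f: "frequently (\<lambda>y. \<sigma> x y \<le> p) (at x)" "frequently (\<lambda>y. q \<le> \<sigma> x y) (at x)" by (auto simp: D_def)
    show "\<exists>u v. u < v \<and> u \<le> x \<and> x \<le> v \<and> v - u < d \<and> G v - G u \<le> p * (v - u)"
      using near[OF f(1) \<open>0 < d\<close>] by (simp add: divide_le_eq cong: conj_cong)
    show "\<exists>u v. u < v \<and> u \<le> x \<and> x \<le> v \<and> v - u < d \<and> q * (v - u) \<le> G v - G u"
      using near[OF f(2) \<open>0 < d\<close>] by (simp add: le_divide_eq cong: conj_cong)
  qed (auto simp: D_def)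
  moreover have "negligible I"
  proof (rule abs_continuous_unbounded_slopes_negligible[OF ac])
    fix x d :: real and n assume "x \<in> I" "0 < d"
    then have f: "frequently (\<lambda>y. real n \<le> \<bar>\<sigma> x y\<bar>) (at x)" by (auto simp: I_def)
    show "\<exists>u v. u < v \<and> u \<le> x \<and> x \<le> v \<and> v - u < d \<and> real n * (v - u) \<le> norm (G v - G u)"
      using near[OF f \<open>0 < d\<close>] by (simp add: le_divide_eq abs_divide cong: conj_cong)
  qed (auto simp: I_def)
  moreover have "{x \<in> {a<..<b}. \<not> G differentiable (at x)} \<subseteq> I \<union> (\<Union>(p, q)\<in>{(p, q). p \<in> \<rat> \<and> q \<in> \<rat> \<and> p < q}. D p q)"
  proof
    fix x assume x: "x \<in> {x \<in> {a<..<b}. \<not> G differentiable (at x)}"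
    define l where "l = Liminf (at x) (\<lambda>y. ereal (\<sigma> x y))"
    define r where "r = Limsup (at x) (\<lambda>y. ereal (\<sigma> x y))"
    have "l \<le> r" unfolding l_def r_def by (intro Liminf_le_Limsup) auto
    have fl: "frequently (\<lambda>y. \<sigma> x y \<le> p) (at x)" if "l < ereal p" for p
    proof (rule ccontr)
      assume "\<not> frequently (\<lambda>y. \<sigma> x y \<le> p) (at x)"
      then have "eventually (\<lambda>y. ereal p \<le> ereal (\<sigma> x y)) (at x)"
        unfolding frequently_def by (auto elim: eventually_mono)
      from Liminf_bounded[OF this] that show False by (auto simp: l_def)
    qed
    have fr: "frequently (\<lambda>y. q \<le> \<sigma> x y) (at x)" if "ereal q < r" for q
    proof (rule ccontr)
      assume "\<not> frequently (\<lambda>y. q \<le> \<sigma> x y) (at x)"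
      then have "eventually (\<lambda>y. ereal (\<sigma> x y) \<le> ereal q) (at x)"
        unfolding frequently_def by (auto elim: eventually_mono)
      from Limsup_bounded[OF this] that show False by (auto simp: r_def)
    qed
    show "x \<in> I \<union> (\<Union>(p, q)\<in>{(p, q). p \<in> \<rat> \<and> q \<in> \<rat> \<and> p < q}. D p q)"
    proof (cases "l < r")
      case True
      then obtain p' q' where "l < ereal p'" "ereal p' < ereal q'" "ereal q' < r"
        by (metis ereal_dense2)
      moreover obtain p where "p \<in> \<rat>" "p' < p" "p < (p' + q') / 2"
        using Rats_dense_in_real[of p' "(p' + q') / 2"] \<open>ereal p' < ereal q'\<close> by auto
      moreover obtain q where "q \<in> \<rat>" "(p' + q') / 2 < q" "q < q'"
        using Rats_dense_in_real[of "(p' + q') / 2" q'] \<open>ereal p' < ereal q'\<close> by auto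
      ultimately have pq: "p \<in> \<rat>" "q \<in> \<rat>" "p < q" "l < ereal p" "ereal q < r"
        using less_trans[of l "ereal p'" "ereal p"] less_trans[of "ereal q" "ereal q'" r] by auto
      then have "x \<in> D p q" using x fl fr by (auto simp: D_def)
      then show ?thesis using pq by auto
    next
      case False
      then have "l = r" using \<open>l \<le> r\<close> by auto
      show ?thesis
      proof (cases l)
        case (real c)
        then have "((\<lambda>y. ereal (\<sigma> x y)) \<longlongrightarrow> ereal c) (at x)"
          using \<open>l = r\<close> unfolding l_def r_def by (intro Liminf_eq_Limsup) auto
        then have "(\<sigma> x \<longlongrightarrow> c) (at x)" by simp
        then have "(G has_field_derivative c) (at x)"
          unfolding has_field_derivative_iff \<sigma>_def by simp
        then have "G differentiable (at x)" using real_differentiable_def by blast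
        then show ?thesis using x by auto
      next
        case PInf
        then have f: "frequently (\<lambda>y. real n \<le> \<sigma> x y) (at x)" for n using \<open>l = r\<close> by (intro fr) auto
        have "frequently (\<lambda>y. real n \<le> \<bar>\<sigma> x y\<bar>) (at x)" for n by (rule frequently_elim1[OF f[of n]]) auto
        then show ?thesis using x by (auto simp: I_def)
      next
        case MInf
        then have f: "frequently (\<lambda>y. \<sigma> x y \<le> - real n) (at x)" for n by (intro fl) auto
        have "frequently (\<lambda>y. real n \<le> \<bar>\<sigma> x y\<bar>) (at x)" for n by (rule frequently_elim1[OF f[of n]]) auto
        then show ?thesis using x by (auto simp: I_def)
      qed
    qed
  qed
  moreover have "negligible (\<Union>(p, q)\<in>{(p, q). p \<in> \<rat> \<and> q \<in> \<rat> \<and> p < q}. D p q)"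
  proof (rule negligible_countable_Union)
    have "{(p, q). p \<in> \<rat> \<and> q \<in> \<rat> \<and> p < (q::real)} \<subseteq> \<rat> \<times> \<rat>" by auto
    moreover have "countable (\<rat> \<times> (\<rat> :: real set))" by (intro countable_SIGMA countable_rat)
    ultimately have "countable {(p, q). p \<in> \<rat> \<and> q \<in> \<rat> \<and> p < (q::real)}"
      by (rule countable_subset)
    then show "countable ((\<lambda>(p, q). D p q) ` {(p, q). p \<in> \<rat> \<and> q \<in> \<rat> \<and> p < q})"
      by (rule countable_image)
  qed (use \<open>\<And>p q. p < q \<Longrightarrow> negligible (D p q)\<close> in auto)
  ultimately show ?thesis by (meson negligible_Un negligible_subset)
qed

lemma abs_continuous_differentiable_AE:
  fixes G :: "real \<Rightarrow> 'a::euclidean_space"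
  assumes ac: "abs_continuous_on_interval a b G"
  shows "negligible {x \<in> {a<..<b}. \<not> G differentiable (at x)}"
proof -
  have "abs_continuous_on_interval a b (\<lambda>x. G x \<bullet> i)" if "i \<in> Basis" for i
    unfolding abs_continuous_on_interval_def
  proof (intro allI impI)
    fix \<epsilon> :: real assume "0 < \<epsilon>"
    then obtain \<delta> where "\<delta> > 0" and \<delta>: "\<forall>(n::nat) u v.
        (\<forall>i<n. a \<le> u i \<and> u i < v i \<and> v i \<le> b) \<and>
        disjoint_family_on (\<lambda>i. {u i<..<v i}) {..<n} \<and>
        (\<Sum>i<n. v i - u i) < \<delta>
        \<longrightarrow> (\<Sum>i<n. norm (G (v i) - G (u i))) < \<epsilon>"
      using ac unfolding abs_continuous_on_interval_def by blast
    have "(\<Sum>k<n. norm (G (v k) \<bullet> i - G (u k) \<bullet> i)) \<le> (\<Sum>k<n. norm (G (v k) - G (u k)))"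
      for n :: nat and u v :: "nat \<Rightarrow> real"
      using that by (intro sum_mono) (simp add: Basis_le_norm flip: inner_diff_left)
    then show "\<exists>\<delta>>0. \<forall>(n::nat) u v.
        (\<forall>k<n. a \<le> u k \<and> u k < v k \<and> v k \<le> b) \<and>
        disjoint_family_on (\<lambda>k. {u k<..<v k}) {..<n} \<and>
        (\<Sum>k<n. v k - u k) < \<delta>
        \<longrightarrow> (\<Sum>k<n. norm (G (v k) \<bullet> i - G (u k) \<bullet> i)) < \<epsilon>"
      using \<open>\<delta> > 0\<close> \<delta> by (intro exI[of _ \<delta>]) (meson le_less_trans)
  qed
  then have "negligible (\<Union>i\<in>Basis. {x \<in> {a<..<b}. \<not> (\<lambda>x. G x \<bullet> i) differentiable (at x)})"
    using abs_continuous_real_differentiable_AE by (intro negligible_Union) auto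
  moreover have "G differentiable (at x)" if "\<And>i. i \<in> Basis \<Longrightarrow> (\<lambda>x. G x \<bullet> i) differentiable (at x)" for x
  proof -
    have "(\<lambda>x. \<Sum>i\<in>Basis. (G x \<bullet> i) *\<^sub>R i) differentiable (at x)"
      using that by (intro differentiable_sum ballI differentiable_scaleR) auto
    then show ?thesis by (simp add: euclidean_representation)
  qed
  then have "{x \<in> {a<..<b}. \<not> G differentiable (at x)} \<subseteq> (\<Union>i\<in>Basis. {x \<in> {a<..<b}. \<not> (\<lambda>x. G x \<bullet> i) differentiable (at x)})"
    by blast
  ultimately show ?thesis by (rule negligible_subset)
qed

abbreviation window_integral :: "real \<Rightarrow> real \<Rightarrow> (real \<Rightarrow> real) \<Rightarrow> ennreal" where
  "window_integral a b \<phi> \<equiv> \<integral>\<^sup>+t. indicator {a..b} t * ennreal (\<phi> t) \<partial>lebesgue"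

text \<open>
Let \<open>\<Phi>\<close> be the indefinite integral of \<open>|G'|\<close>. At almost every \<open>x\<close> the function \<open>G\<close> is
differentiable and \<open>\<Phi>\<close> has the right derivative \<open>|G' x|\<close>, so all short intervals \<open>[x, x + h]\<close>
satisfy \<open>|G (x + h) - G x| \<le> \<Phi> (x + h) - \<Phi> x + 2 \<epsilon> h\<close>. Finitely many disjoint intervals
of this kind cover \<open>[a, b]\<close> up to gaps over which \<open>G\<close> changes by less than \<open>\<epsilon>\<close>.
\<close>

lemma abs_continuous_norm_increment_le:
  fixes G :: "real \<Rightarrow> 'a::euclidean_space"
  assumes ac: "abs_continuous_on_interval a b G" and "a \<le> b"
    and meas: "(\<lambda>x. vector_derivative G (at x)) \<in> borel_measurable lebesgue"
  shows "ennreal (norm (G b - G a)) \<le>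
    window_integral a b (\<lambda>x. norm (vector_derivative G (at x)))" (is "_ \<le> ?I")
proof (cases "?I = \<infinity> \<or> a = b")
  case True
  then show ?thesis by auto
next
  case False
  then have "a < b" using \<open>a \<le> b\<close> by auto
  define \<phi> where "\<phi> = (\<lambda>x. indicator {a..b} x * norm (vector_derivative G (at x)))"
  have \<phi>m: "\<phi> \<in> borel_measurable lebesgue" unfolding \<phi>_def
    by (intro borel_measurable_times borel_measurable_indicator measurable_compose[OF meas borel_measurable_norm]) auto
  have I: "?I = (\<integral>\<^sup>+x. ennreal (\<phi> x) \<partial>lebesgue)"
    unfolding \<phi>_def by (intro nn_integral_cong) (auto simp: indicator_def)
  have \<phi>0: "0 \<le> \<phi> x" for x by (simp add: \<phi>_def)
  have \<phi>i: "integrable lebesgue \<phi>"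
    using False by (intro integrableI_nonneg \<phi>m) (auto simp: I \<phi>0 less_top)
  then have \<phi>c: "\<phi> integrable_on {u..v}" for u v
    by (intro integrable_on_subinterval[OF integrable_on_lebesgue]) auto
  have total: "?I = ennreal (integral UNIV \<phi>)"
    unfolding I integral_lebesgue[OF \<phi>i] using \<phi>i \<phi>0 by (intro nn_integral_eq_integral) auto
  define \<Phi> where "\<Phi> = (\<lambda>x. integral {a..x} \<phi>)"
  have \<Phi>: "integral {u..v} \<phi> = \<Phi> v - \<Phi> u" if "a \<le> u" "u \<le> v" for u v
    using Henstock_Kurzweil_Integration.integral_combine[OF that \<phi>c] by (simp add: \<Phi>_def)
  obtain N where N: "negligible N" "\<And>x e. \<lbrakk>x \<notin> N; 0 < e\<rbrakk> \<Longrightarrow>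
      \<exists>d>0. \<forall>h. 0 < h \<and> h < d \<longrightarrow> norm (integral (cbox x (x + h *\<^sub>R One)) \<phi> /\<^sub>R h ^ DIM(real) - \<phi> x) < e"
    using integrable_ccontinuous_explicit[of \<phi>] \<phi>c by (metis box_real(2))
  define E where "E = {a<..<b} - N - {x \<in> {a<..<b}. \<not> G differentiable (at x)}"
  have negE: "negligible ({a<..<b} - E)"
    by (rule negligible_subset[OF negligible_Un[OF N(1) abs_continuous_differentiable_AE[OF ac]]])
      (auto simp: E_def)
  have outer: "b - a \<le> measure lebesgue T" if "E \<subseteq> T" "T \<in> lmeasurable" for T
  proof -
    have "b - a = measure lebesgue {a<..<b}" using \<open>a < b\<close> by simp
    also have "\<dots> \<le> measure lebesgue (T \<union> ({a<..<b} - E))"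
      using that negE by (intro measure_mono_fmeasurable)
        (auto intro: fmeasurable.Un negligible_imp_measurable)
    also have "\<dots> \<le> measure lebesgue T + measure lebesgue ({a<..<b} - E)"
      using that negE by (intro measure_Un_le) (auto intro: negligible_imp_sets)
    finally show ?thesis using negE by (simp add: negligible_imp_measure0)
  qed
  have bound: "norm (G b - G a) \<le> integral UNIV \<phi> + \<epsilon> * (2 * (b - a) + 1)" if \<epsilon>: "0 < \<epsilon>" for \<epsilon>
  proof -
    obtain \<delta> where \<delta>: "0 < \<delta>"
      "\<And>Q. finite Q \<Longrightarrow> (\<And>u v. (u, v) \<in> Q \<Longrightarrow> a \<le> u \<and> u < v \<and> v \<le> b) \<Longrightarrow>
         nonoverlapping Q \<Longrightarrow>
         total_length Q < \<delta> \<Longrightarrow> variation_over G Q < \<epsilon>"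
      using abs_continuous_finite[OF ac \<epsilon>] by blast
    define P where "P = (\<lambda>u v. norm (G v - G u) \<le> integral {u..v} \<phi> + 2 * \<epsilon> * (v - u))"
    have cover: "\<exists>u v. u < v \<and> u \<le> x \<and> x \<le> v \<and> v - u < d \<and> P u v" if x: "x \<in> E" and d: "0 < d" for x d
    proof -
      have xab: "x \<in> {a..b}" "x \<notin> N" "G differentiable (at x)" using x by (auto simp: E_def)
      define g where "g = vector_derivative G (at x)"
      have "(G has_vector_derivative g) (at x)"
        using xab(3) unfolding g_def vector_derivative_works .
      then obtain d1 where d1: "d1 > 0" "\<And>y. norm (y - x) < d1 \<Longrightarrow> norm (G y - G x - (y - x) *\<^sub>R g) \<le> \<epsilon> * norm (y - x)"
        unfolding has_vector_derivative_def has_derivative_at_alt using \<open>0 < \<epsilon>\<close> by blast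
      obtain d2 where d2: "d2 > 0" "\<And>h. 0 < h \<Longrightarrow> h < d2 \<Longrightarrow> \<bar>integral {x..x + h} \<phi> / h - \<phi> x\<bar> < \<epsilon>"
        using N(2)[OF xab(2) \<open>0 < \<epsilon>\<close>] by (auto simp: divide_inverse mult.commute)
      define h where "h = min d (min d1 d2) / 2"
      have h: "0 < h" "h < d" "h < d1" "h < d2" using d d1(1) d2(1) by (auto simp: h_def)
      have \<phi>x: "\<phi> x = norm g" using xab by (simp add: \<phi>_def g_def)
      have "norm (G (x + h) - G x) \<le> norm (h *\<^sub>R g) + \<epsilon> * h"
        using d1(2)[of "x + h"] h norm_triangle_sub[of "G (x + h) - G x" "h *\<^sub>R g"] by simp
      also have "\<dots> = \<phi> x * h + \<epsilon> * h" using h(1) by (simp add: \<phi>x mult.commute)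
      also have "\<phi> x * h \<le> (integral {x..x + h} \<phi> / h + \<epsilon>) * h"
        using d2(2)[OF h(1,4)] h(1) by (intro mult_right_mono) auto
      finally have "P x (x + h)" using h(1) by (simp add: P_def algebra_simps)
      then show ?thesis using h by (intro exI[of _ x] exI[of _ "x + h"]) auto
    qed
    have EU: "E \<subseteq> {a<..<b}" and lm: "{a<..<b} \<in> lmeasurable" by (auto simp: E_def)
    obtain L where L: "finite L" "\<And>u v. (u, v) \<in> L \<Longrightarrow> u < v \<and> {u..v} \<subseteq> {a<..<b} \<and> P u v"
      "separated L" "b - a - \<delta> < total_length L"
      "total_length L \<le> measure lebesgue {a<..<b}"
      by (rule Vitali_covering_intervals[OF open_greaterThanLessThan lm EU \<delta>(1) outer cover]) blast+
    have Lab: "a \<le> u \<and> u < v \<and> v \<le> b \<and> P u v" if "(u, v) \<in> L" for u v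
    proof -
      have "u < v" "{u..v} \<subseteq> {a<..<b}" "P u v" using L(2)[OF that] by auto
      then have "u \<in> {a<..<b}" "v \<in> {a<..<b}" by (auto simp: subset_iff)
      then show ?thesis using \<open>u < v\<close> \<open>P u v\<close> by auto
    qed
    have Lin: "u < v \<and> (\<exists>c d. (c, d) \<in> {(a, b)} \<and> c \<le> u \<and> v \<le> d)" if "(u, v) \<in> L" for u v
      using Lab[OF that] by auto
    have ab: "c < d" if "(c, d) \<in> {(a, b)}" for c d using that \<open>a < b\<close> by simp
    have "\<exists>Q. finite Q \<and> subintervals Q {(a, b)} \<and>
      nonoverlapping Q \<and>
      (\<forall>G :: real \<Rightarrow> 'a.
        total_increment G {(a, b)} = total_increment G L + total_increment G Q) \<and>
        total_length {(a, b)} = total_length L + total_length Q"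
      by (rule interval_gaps[OF L(1) _ ab _ L(3) Lin]) simp_all
    then obtain Q where Q: "finite Q" and
      Q2: "subintervals Q {(a, b)}" and
      Q3: "nonoverlapping Q" and
      Q4: "\<forall>G :: real \<Rightarrow> 'a.
        total_increment G {(a, b)} = total_increment G L + total_increment G Q" and
      Q5: "total_length {(a, b)} = total_length L + total_length Q"
      by (elim exE conjE)
    have Qab: "a \<le> u \<and> u < v \<and> v \<le> b" if "(u, v) \<in> Q" for u v using Q2 that by blast
    have GQ: "G b - G a = total_increment G L + total_increment G Q"
      using Q4[rule_format, of G] by simp
    have "\<exists>Q. finite Q \<and> subintervals Q {(a, b)} \<and>
      nonoverlapping Q \<and>
      (\<forall>G :: real \<Rightarrow> real.
        total_increment G {(a, b)} = total_increment G L + total_increment G Q) \<and>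
        total_length {(a, b)} = total_length L + total_length Q"
      by (rule interval_gaps[OF L(1) _ ab _ L(3) Lin]) simp_all
    then obtain Q' where
      Q'2: "subintervals Q' {(a, b)}" and
      Q'4: "\<forall>G :: real \<Rightarrow> real.
        total_increment G {(a, b)} = total_increment G L + total_increment G Q'"
      by (elim exE conjE)
    have Q': "a \<le> u \<and> u < v \<and> v \<le> b" if "(u, v) \<in> Q'" for u v using Q'2 that by blast
    have \<Phi>Q: "\<Phi> b - \<Phi> a = total_increment \<Phi> L + total_increment \<Phi> Q'"
      using Q'4[rule_format, of \<Phi>] by simp
    have "0 \<le> total_increment \<Phi> Q'"
    proof (rule sum_nonneg, clarify)
      fix u v assume "(u, v) \<in> Q'"
      then have "\<Phi> v - \<Phi> u = integral {u..v} \<phi>" using Q'[of u v] by (intro \<Phi>[symmetric]) auto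
      then show "0 \<le> \<Phi> v - \<Phi> u" using \<phi>0 \<phi>c by (auto intro!: integral_nonneg)
    qed
    then have "total_increment \<Phi> L \<le> \<Phi> b - \<Phi> a" using \<Phi>Q by linarith
    also have "\<Phi> b - \<Phi> a \<le> integral UNIV \<phi>"
    proof -
      have "\<Phi> a = 0" by (simp add: \<Phi>_def)
      moreover have "\<Phi> b \<le> integral UNIV \<phi>" unfolding \<Phi>_def
        using \<phi>c \<phi>0 integrable_on_lebesgue[OF \<phi>i] by (intro integral_subset_le) auto
      ultimately show ?thesis by simp
    qed
    finally have SL: "total_increment \<Phi> L \<le> integral UNIV \<phi>" .
    have "norm (G b - G a) \<le> variation_over G L + variation_over G Q"
      unfolding GQ case_prod_beta by (intro norm_triangle_le add_mono norm_sum)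
    also have "variation_over G Q \<le> \<epsilon>"
      by (rule less_imp_le[OF \<delta>(2)[OF Q Qab Q3]]) (use Q5 L(4) in auto)
    also have "variation_over G L \<le> (\<Sum>(u, v)\<in>L. (\<Phi> v - \<Phi> u) + 2 * \<epsilon> * (v - u))"
    proof (intro sum_mono, clarify)
      fix u v assume "(u, v) \<in> L"
      then show "norm (G v - G u) \<le> \<Phi> v - \<Phi> u + 2 * \<epsilon> * (v - u)"
        using Lab[of u v] \<Phi>[of u v] by (auto simp: P_def)
    qed
    also have "\<dots> = total_increment \<Phi> L + 2 * \<epsilon> * total_length L"
      by (simp add: case_prod_beta sum.distrib sum_distrib_left)
    also have "\<dots> \<le> integral UNIV \<phi> + 2 * \<epsilon> * (b - a)"
      using SL L(5) \<open>a < b\<close> \<open>0 < \<epsilon>\<close> by (intro add_mono mult_left_mono) auto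
    finally show ?thesis by (simp add: algebra_simps)
  qed
  have "norm (G b - G a) \<le> integral UNIV \<phi>"
  proof (rule field_le_epsilon)
    fix e :: real assume "0 < e"
    define k where "k = 2 * (b - a) + 1"
    have "k > 0" using \<open>a < b\<close> by (simp add: k_def)
    then show "norm (G b - G a) \<le> integral UNIV \<phi> + e"
      using bound[of "e / k"] \<open>0 < e\<close> unfolding k_def[symmetric] by simp
  qed
  then show ?thesis unfolding total by (rule ennreal_leI)
qed


section \<open>Norms up to constants\<close>

lemma ennreal_root_mono: "a \<le> b \<Longrightarrow> 0 < p \<Longrightarrow> ennreal_root p a \<le> ennreal_root p b"
  unfolding ennreal_root_def
  by (auto intro!: ennreal_leI powr_mono2 enn2real_mono simp: less_top top_unique)

lemma ennreal_root_le_iff: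
  assumes "0 < p" "0 \<le> k"
  shows "ennreal_root p a \<le> ennreal k \<longleftrightarrow> a \<le> ennreal (k powr p)"
proof (cases a)
  case (real x)
  have "x powr (1 / p) \<le> k \<longleftrightarrow> x \<le> k powr p"
  proof
    assume "x powr (1 / p) \<le> k"
    then have "(x powr (1 / p)) powr p \<le> k powr p" using assms by (intro powr_mono2) auto
    then show "x \<le> k powr p" using assms real by (simp add: powr_powr)
  next
    assume "x \<le> k powr p"
    then have "x powr (1 / p) \<le> (k powr p) powr (1 / p)" using assms real by (intro powr_mono2) auto
    then show "x powr (1 / p) \<le> k" using assms by (simp add: powr_powr)
  qed
  then show ?thesis using real assms by (simp add: ennreal_root_def)
qed (simp add: ennreal_root_def top_unique)

lemma ennreal_root_cmult:
  assumes "0 < p" "0 \<le> c"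
  shows "ennreal_root p (ennreal (c powr p) * a) = ennreal c * ennreal_root p a"
proof (cases a)
  case (real x)
  then have "ennreal (c powr p) * a = ennreal (c powr p * x)" by (simp add: ennreal_mult)
  then have "ennreal_root p (ennreal (c powr p) * a) = ennreal ((c powr p * x) powr (1 / p))"
    using real by (simp only: ennreal_root_def) simp
  also have "(c powr p * x) powr (1 / p) = c * x powr (1 / p)"
    using assms real by (simp add: powr_mult powr_powr)
  finally show ?thesis using real assms by (simp add: ennreal_root_def ennreal_mult)
next
  case top
  then show ?thesis using assms
    by (cases "c = 0") (auto simp: ennreal_root_def ennreal_mult_top ennreal_top_mult)
qed

lemma powr_superadditive:
  fixes a b p :: real
  assumes "0 \<le> a" "0 \<le> b" "1 \<le> p"
  shows "a powr p + b powr p \<le> (a + b) powr p"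
proof -
  have *: "x powr p = x * x powr (p - 1)" if "0 \<le> x" for x :: real
    using that powr_mult_base[of x "p - 1"] by simp
  have "a powr p + b powr p = a * a powr (p - 1) + b * b powr (p - 1)"
    using assms * by simp
  also have "\<dots> \<le> a * (a + b) powr (p - 1) + b * (a + b) powr (p - 1)"
    using assms by (intro add_mono mult_left_mono powr_mono2) auto
  also have "\<dots> = (a + b) powr p" using assms *[of "a + b"] by (simp add: algebra_simps)
  finally show ?thesis .
qed

lemma powr_add_le_double:
  fixes a b p :: real
  assumes "0 \<le> a" "0 \<le> b" "1 \<le> p"
  shows "(a + b) powr p \<le> 2 powr p * (a powr p + b powr p)"
proof -
  have "(a + b) powr p \<le> (2 * max a b) powr p" using assms by (intro powr_mono2) auto
  also have "\<dots> = 2 powr p * max a b powr p" by (rule powr_mult)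
  also have "\<dots> \<le> 2 powr p * (a powr p + b powr p)" by (intro mult_left_mono) (auto simp: max_def)
  finally show ?thesis .
qed

text \<open>
The common core of the quasi-triangle inequalities for the continuous and the discrete norm.
\<close>

lemma ennreal_root_quasi_add:
  assumes "1 \<le> p" and le: "c \<le> ennreal (2 powr p) * (a + b)"
  shows "ennreal_root p c \<le> 2 * (ennreal_root p a + ennreal_root p b)"
proof (cases "a = \<infinity> \<or> b = \<infinity>")
  case True
  then show ?thesis by (auto simp: ennreal_root_def ennreal_mult_top)
next
  case False
  then obtain x y where xy: "0 \<le> x" "0 \<le> y" "a = ennreal x" "b = ennreal y"
    by (cases a; cases b) auto
  define X where "X = x powr (1 / p)"
  define Y where "Y = y powr (1 / p)"
  have "x = X powr p" "y = Y powr p" using xy assms by (auto simp: X_def Y_def powr_powr)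
  have "c \<le> ennreal (2 powr p * (x + y))"
    using le xy by (simp add: ennreal_mult flip: ennreal_plus)
  also have "2 powr p * (x + y) \<le> 2 powr p * (X + Y) powr p"
    unfolding \<open>x = X powr p\<close> \<open>y = Y powr p\<close> using assms
    by (intro mult_left_mono powr_superadditive) (auto simp: X_def Y_def)
  also have "2 powr p * (X + Y) powr p = (2 * (X + Y)) powr p"
    by (rule powr_mult[symmetric])
  finally have "c \<le> ennreal ((2 * (X + Y)) powr p)" by (simp add: ennreal_leI)
  then have "ennreal_root p c \<le> ennreal (2 * (X + Y))"
    using assms by (subst ennreal_root_le_iff) (auto simp: X_def Y_def)
  also have "\<dots> = 2 * (ennreal_root p a + ennreal_root p b)"
    using xy by (simp add: ennreal_root_def X_def Y_def ennreal_mult)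
  finally show ?thesis .
qed

lemma Lp_norm_le_iff:
  assumes "0 < p" "0 \<le> k"
  shows "Lp_norm p f \<le> ennreal k \<longleftrightarrow> (\<integral>\<^sup>+x. ennreal (norm (f x) powr p) \<partial>lebesgue) \<le> ennreal (k powr p)"
  unfolding Lp_norm_def by (rule ennreal_root_le_iff[OF assms])

lemma Lp_norm_mono_AE:
  assumes "0 < p" "AE x in lebesgue. norm (f x) \<le> norm (g x)"
  shows "Lp_norm p f \<le> Lp_norm p g"
  unfolding Lp_norm_def
proof (rule ennreal_root_mono[OF nn_integral_mono_AE assms(1)])
  show "AE x in lebesgue. ennreal (norm (f x) powr p) \<le> ennreal (norm (g x) powr p)"
    using assms(2) by eventually_elim (use assms(1) in \<open>auto intro!: ennreal_leI powr_mono2\<close>)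
qed

lemma Lp_norm_cong_AE:
  assumes "0 < p" "AE x in lebesgue. norm (f x) = norm (g x)"
  shows "Lp_norm p f = Lp_norm p g"
  using assms by (intro antisym Lp_norm_mono_AE) auto

text \<open>
The factor \<open>2\<close> comes from \<open>(a + b)\<^sup>p \<le> 2\<^sup>p (a\<^sup>p + b\<^sup>p)\<close>. The function \<open>h\<close> may be any function
dominated by \<open>|f| + |g|\<close>, so that the lemma covers sums and differences alike.
\<close>

lemma Lp_norm_quasi_add:
  fixes f :: "real \<Rightarrow> 'a::real_normed_vector" and g :: "real \<Rightarrow> 'b::real_normed_vector"
    and h :: "real \<Rightarrow> 'c::real_normed_vector"
  assumes [measurable]: "f \<in> borel_measurable lebesgue" "g \<in> borel_measurable lebesgue"
    and "1 \<le> p" and le: "\<And>x. norm (h x) \<le> norm (f x) + norm (g x)"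
  shows "Lp_norm p h \<le> 2 * (Lp_norm p f + Lp_norm p g)"
  unfolding Lp_norm_def
proof (rule ennreal_root_quasi_add[OF \<open>1 \<le> p\<close>])
  have "(\<integral>\<^sup>+x. ennreal (norm (h x) powr p) \<partial>lebesgue) \<le>
      (\<integral>\<^sup>+x. ennreal (2 powr p) * (ennreal (norm (f x) powr p) + ennreal (norm (g x) powr p)) \<partial>lebesgue)"
  proof (rule nn_integral_mono)
    fix x
    have "norm (h x) powr p \<le> (norm (f x) + norm (g x)) powr p"
      using \<open>1 \<le> p\<close> le by (intro powr_mono2) auto
    also have "\<dots> \<le> 2 powr p * (norm (f x) powr p + norm (g x) powr p)"
      using \<open>1 \<le> p\<close> by (intro powr_add_le_double) auto
    finally show "ennreal (norm (h x) powr p) \<le> ennreal (2 powr p) * (ennreal (norm (f x) powr p) + ennreal (norm (g x) powr p))"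
      by (simp flip: ennreal_mult ennreal_plus add: ennreal_leI)
  qed
  also have "\<dots> = ennreal (2 powr p) * ((\<integral>\<^sup>+x. ennreal (norm (f x) powr p) \<partial>lebesgue) + (\<integral>\<^sup>+x. ennreal (norm (g x) powr p) \<partial>lebesgue))"
    by (subst nn_integral_cmult, measurable) (subst nn_integral_add, auto)
  finally show "(\<integral>\<^sup>+x. ennreal (norm (h x) powr p) \<partial>lebesgue) \<le> \<dots>" .
qed

lemma Lp_norm_cmult:
  assumes [measurable]: "f \<in> borel_measurable lebesgue" and "0 < p"
    and eq: "\<And>x. norm (h x) = \<bar>c\<bar> * norm (f x)"
  shows "Lp_norm p h = ennreal \<bar>c\<bar> * Lp_norm p f"
proof -
  have "(\<integral>\<^sup>+x. ennreal (norm (h x) powr p) \<partial>lebesgue) = (\<integral>\<^sup>+x. ennreal (\<bar>c\<bar> powr p) * ennreal (norm (f x) powr p) \<partial>lebesgue)"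
    unfolding eq using \<open>0 < p\<close> by (intro nn_integral_cong) (simp add: powr_mult ennreal_mult)
  also have "\<dots> = ennreal (\<bar>c\<bar> powr p) * (\<integral>\<^sup>+x. ennreal (norm (f x) powr p) \<partial>lebesgue)"
    by (rule nn_integral_cmult) measurable
  finally show ?thesis unfolding Lp_norm_def using \<open>0 < p\<close> by (simp add: ennreal_root_cmult)
qed

lemma Lp_norm_zero: "0 < p \<Longrightarrow> Lp_norm p (\<lambda>x. 0) = 0"
  by (simp add: Lp_norm_def ennreal_root_def)

text \<open>
Iterating \<open>Lp_norm_quasi_add\<close> doubles the constant with every summand.
\<close>

lemma Lp_norm_sum_le:
  fixes f :: "'i \<Rightarrow> real \<Rightarrow> 'a::euclidean_space"
  assumes "finite S" "\<And>i. i \<in> S \<Longrightarrow> f i \<in> borel_measurable lebesgue" "1 \<le> p"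
    and "\<And>i. i \<in> S \<Longrightarrow> Lp_norm p (f i) \<le> ennreal (c i) * K" "\<And>i. i \<in> S \<Longrightarrow> 0 \<le> c i"
  shows "Lp_norm p (\<lambda>x. \<Sum>i\<in>S. f i x) \<le> ennreal (2 ^ card S * (\<Sum>i\<in>S. c i)) * K"
  using assms
proof (induction S rule: finite_induct)
  case empty
  then show ?case by (simp add: Lp_norm_zero)
next
  case (insert i S)
  have c0: "0 \<le> (\<Sum>i\<in>S. c i)" using insert.prems by (auto intro: sum_nonneg)
  have "Lp_norm p (\<lambda>x. \<Sum>i\<in>insert i S. f i x) \<le> 2 * (Lp_norm p (f i) + Lp_norm p (\<lambda>x. \<Sum>i\<in>S. f i x))"
  proof (rule Lp_norm_quasi_add)
    show "f i \<in> borel_measurable lebesgue" using insert.prems by auto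
    show "(\<lambda>x. \<Sum>i\<in>S. f i x) \<in> borel_measurable lebesgue"
      using insert.prems by (intro borel_measurable_sum) auto
    show "norm (\<Sum>i\<in>insert i S. f i x) \<le> norm (f i x) + norm (\<Sum>i\<in>S. f i x)" for x
      using insert.hyps by (simp add: norm_triangle_ineq)
  qed fact
  also have "\<dots> \<le> 2 * (ennreal (c i) * K + ennreal (2 ^ card S * (\<Sum>i\<in>S. c i)) * K)"
    using insert by (intro mult_left_mono add_mono) auto
  also have "\<dots> = ennreal (2 * (c i + 2 ^ card S * (\<Sum>i\<in>S. c i))) * K"
    using insert.prems(4)[of i] c0 by (simp add: ennreal_mult distrib_left distrib_right mult.assoc)
  also have "\<dots> \<le> ennreal (2 ^ card (insert i S) * (\<Sum>i\<in>insert i S. c i)) * K"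
  proof (intro mult_right_mono ennreal_leI)
    have "c i \<le> 2 ^ card S * c i" using insert.prems(4)[of i] mult_right_mono[of 1 "2 ^ card S" "c i"] by simp
    then show "2 * (c i + 2 ^ card S * (\<Sum>i\<in>S. c i)) \<le> 2 ^ card (insert i S) * (\<Sum>i\<in>insert i S. c i)"
      using insert.hyps by (simp add: algebra_simps)
  qed simp
  finally show ?case .
qed

lemma measurable_affine_lebesgue:
  fixes f :: "real \<Rightarrow> 'a::topological_space"
  assumes "f \<in> borel_measurable lebesgue" "c \<noteq> 0"
  shows "(\<lambda>x. f (y + c * x)) \<in> borel_measurable lebesgue"
proof -
  have "(\<lambda>x. y + c * x) \<in> lebesgue \<rightarrow>\<^sub>M lebesgue"
    using lebesgue_affine_measurable[of "\<lambda>_. c" y] assms by simp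
  from measurable_compose[OF this assms(1)] show ?thesis .
qed

lemma Lp_norm_translate:
  fixes f :: "real \<Rightarrow> 'a::euclidean_space"
  assumes "f \<in> borel_measurable lebesgue"
  shows "Lp_norm p (\<lambda>x. f (x + h)) = Lp_norm p f"
proof -
  have "(\<lambda>x. ennreal (norm (f x) powr p)) \<in> borel_measurable lebesgue"
    using assms by measurable
  from nn_integral_real_affine_lebesgue[OF this, of 1 h] show ?thesis
    unfolding Lp_norm_def by (simp add: add.commute)
qed

section \<open>Power means and Minkowski estimates\<close>

text \<open>
The graph of the convex function \<open>x\<^sup>p\<close> lies above its tangent at \<open>m\<close>.
\<close>

lemma powr_tangent:
  fixes m h p :: real
  assumes "0 < m" "0 \<le> h" "1 \<le> p"
  shows "p * m powr (p - 1) * h \<le> h powr p + (p - 1) * m powr p"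
proof (cases "h = 0")
  case False
  have "h powr p - m powr p \<ge> p * m powr (p - 1) * (h - m)"
  proof (rule convex_on_imp_above_tangent[OF powr_convex[OF assms(3)]])
    show "((\<lambda>x. x powr p) has_real_derivative p * m powr (p - 1)) (at m within {0<..})"
      using assms by (auto intro!: derivative_eq_intros)
  qed (use assms False in \<open>auto simp: interior_open\<close>)
  moreover have "m * m powr (p - 1) = m powr p" using assms powr_mult_base[of m "p - 1"] by simp
  then have "p * m powr (p - 1) * (h - m) = p * m powr (p - 1) * h - p * m powr p"
    by (simp add: right_diff_distrib flip: \<open>m * m powr (p - 1) = m powr p\<close>)
  ultimately show ?thesis by (simp only: left_diff_distrib)
qed (use assms in auto)

text \<open>
Jensen's inequality for the normalised measure on \<open>A\<close>: integrate the tangent inequality at the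
mean \<open>m = a / L\<close>. Stating it for a real lower bound \<open>a\<close> of the integral avoids
powers of extended reals.
\<close>

lemma nn_integral_power_mean:
  assumes [measurable]: "H \<in> borel_measurable M" "A \<in> sets M" and A: "emeasure M A = ennreal L"
    and "0 < L" "1 \<le> p" "0 \<le> a" and H: "\<And>x. 0 \<le> H x"
    and le: "ennreal a \<le> (\<integral>\<^sup>+x. indicator A x * ennreal (H x) \<partial>M)"
  shows "ennreal (a powr p) \<le> ennreal (L powr (p - 1)) * (\<integral>\<^sup>+x. indicator A x * ennreal (H x powr p) \<partial>M)"
    (is "_ \<le> _ * ?I")
proof (cases "?I = \<infinity> \<or> a = 0")
  case True
  then show ?thesis using \<open>0 < L\<close> by (auto simp: ennreal_mult_top)
next
  case False
  then obtain I where I: "?I = ennreal I" "0 \<le> I" by (cases ?I) auto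
  define m where "m = a / L"
  have "m > 0" using False assms by (auto simp: m_def)
  have "ennreal (p * m powr (p - 1) * a) = ennreal (p * m powr (p - 1)) * ennreal a"
    using assms by (intro ennreal_mult) auto
  also have "\<dots> \<le> ennreal (p * m powr (p - 1)) * (\<integral>\<^sup>+x. indicator A x * ennreal (H x) \<partial>M)"
    using le by (rule mult_left_mono) simp
  also have "\<dots> = (\<integral>\<^sup>+x. ennreal (p * m powr (p - 1)) * (indicator A x * ennreal (H x)) \<partial>M)"
    by (rule nn_integral_cmult[symmetric]) measurable
  also have "\<dots> \<le> (\<integral>\<^sup>+x. indicator A x * ennreal (H x powr p) + ennreal ((p - 1) * m powr p) * indicator A x \<partial>M)"
  proof (rule nn_integral_mono)
    fix x
    have "ennreal (p * m powr (p - 1)) * ennreal (H x) \<le> ennreal (H x powr p) + ennreal ((p - 1) * m powr p)"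
      using powr_tangent[OF \<open>m > 0\<close> H \<open>1 \<le> p\<close>] \<open>1 \<le> p\<close> H
      by (simp flip: ennreal_mult ennreal_plus add: ennreal_leI)
    then show "ennreal (p * m powr (p - 1)) * (indicator A x * ennreal (H x)) \<le>
        indicator A x * ennreal (H x powr p) + ennreal ((p - 1) * m powr p) * indicator A x"
      by (auto simp: indicator_def)
  qed
  also have "\<dots> = ?I + ennreal ((p - 1) * m powr p) * ennreal L"
    by (subst nn_integral_add) (auto simp: nn_integral_cmult_indicator A)
  also have "ennreal ((p - 1) * m powr p) * ennreal L = ennreal ((p - 1) * m powr p * L)"
    using assms by (intro ennreal_mult[symmetric]) auto
  also have "?I + \<dots> = ennreal (I + (p - 1) * m powr p * L)"
    using I assms by (subst I(1), intro ennreal_plus[symmetric]) auto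
  finally have "p * m powr (p - 1) * a \<le> I + (p - 1) * m powr p * L"
    using I assms by (subst (asm) ennreal_le_iff) auto
  moreover have "p * m powr (p - 1) * a = p * m powr p * L"
  proof -
    have "m * m powr (p - 1) = m powr p" using \<open>m > 0\<close> powr_mult_base[of m "p - 1"] by simp
    moreover have "a = m * L" using \<open>0 < L\<close> by (simp add: m_def)
    ultimately show ?thesis by (simp add: mult_ac)
  qed
  ultimately have "p * m powr p * L \<le> I + (p - 1) * m powr p * L" by (simp only:)
  then have "m powr p * L \<le> I" by (simp add: algebra_simps)
  then have "L powr (p - 1) * (m powr p * L) \<le> L powr (p - 1) * I" by (rule mult_left_mono) simp
  moreover have "L powr (p - 1) * (m powr p * L) = a powr p"
  proof -
    have "L * L powr (p - 1) = L powr p" using \<open>0 < L\<close> powr_mult_base[of L "p - 1"] by simp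
    then have "L powr (p - 1) * (m powr p * L) = m powr p * L powr p" by (simp add: mult_ac)
    also have "\<dots> = (m * L) powr p" using \<open>m > 0\<close> \<open>0 < L\<close> by (simp add: powr_mult)
    also have "m * L = a" using \<open>0 < L\<close> by (simp add: m_def)
    finally show ?thesis .
  qed
  ultimately show ?thesis using I by (simp flip: ennreal_mult add: ennreal_leI)
qed

text \<open>
Minkowski's integral inequality for an interval of length \<open>\<delta>\<close>: apply the power mean inequality
in \<open>t\<close> and exchange the integrals.
\<close>

lemma Lp_norm_integral_le:
  fixes H :: "real \<Rightarrow> real \<Rightarrow> real" and u :: "real \<Rightarrow> 'a::real_normed_vector"
  assumes [measurable]: "(\<lambda>(t, x). H t x) \<in> borel_measurable borel"
    and "0 < \<delta>" "1 \<le> p" and H: "\<And>t x. 0 \<le> H t x"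
    and le: "\<And>x. ennreal (norm (u x)) \<le> (\<integral>\<^sup>+t. indicator {0..\<delta>} t * ennreal (H t x) \<partial>lborel)"
    and K: "\<And>t. t \<in> {0..\<delta>} \<Longrightarrow> Lp_norm p (H t) \<le> K"
  shows "Lp_norm p u \<le> ennreal \<delta> * K"
proof (cases K)
  case top
  then show ?thesis using \<open>0 < \<delta>\<close> by (simp add: ennreal_mult_top)
next
  case (real k)
  have "(\<lambda>(t, x). H t x) = (\<lambda>z. H (fst z) (snd z))" by auto
  then have [measurable]: "(\<lambda>z. H (fst z) (snd z)) \<in> borel_measurable (borel \<Otimes>\<^sub>M borel)"
    using assms(1) by (simp only: borel_prod)
  have H2 [measurable]: "(\<lambda>z. H (snd z) (fst z)) \<in> borel_measurable (borel \<Otimes>\<^sub>M borel)"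
    using measurable_compose[of "\<lambda>z. (snd z, fst z)" "borel \<Otimes>\<^sub>M borel" "borel \<Otimes>\<^sub>M borel" "\<lambda>z. H (fst z) (snd z)" borel]
    by simp
  have [measurable]: "(\<lambda>t. H t x) \<in> borel_measurable borel" for x
    using measurable_compose[of "\<lambda>t. (t, x)" borel "borel \<Otimes>\<^sub>M borel" "\<lambda>z. H (fst z) (snd z)" borel]
    by simp
  have "(\<integral>\<^sup>+x. ennreal (norm (u x) powr p) \<partial>lebesgue) = (\<integral>\<^sup>+x. ennreal (norm (u x) powr p) \<partial>lborel)"
    by (rule nn_integral_completion)
  also have "\<dots> \<le> (\<integral>\<^sup>+x. ennreal (\<delta> powr (p - 1)) * (\<integral>\<^sup>+t. indicator {0..\<delta>} t * ennreal (H t x powr p) \<partial>lborel) \<partial>lborel)"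
    using assms by (intro nn_integral_mono nn_integral_power_mean) auto
  also have "\<dots> = ennreal (\<delta> powr (p - 1)) * (\<integral>\<^sup>+x. (\<integral>\<^sup>+t. indicator {0..\<delta>} t * ennreal (H t x powr p) \<partial>lborel) \<partial>lborel)"
    by (rule nn_integral_cmult) measurable
  also have "(\<integral>\<^sup>+x. (\<integral>\<^sup>+t. indicator {0..\<delta>} t * ennreal (H t x powr p) \<partial>lborel) \<partial>lborel) =
      (\<integral>\<^sup>+t. (\<integral>\<^sup>+x. indicator {0..\<delta>} t * ennreal (H t x powr p) \<partial>lborel) \<partial>lborel)"
    by (rule lborel_pair.Fubini') measurable
  also have "\<dots> \<le> (\<integral>\<^sup>+t. ennreal (k powr p) * indicator {0..\<delta>} t \<partial>lborel)"
  proof (rule nn_integral_mono)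
    fix t :: real
    have "(\<integral>\<^sup>+x. ennreal (H t x powr p) \<partial>lborel) \<le> ennreal (k powr p)" if "t \<in> {0..\<delta>}"
      using K[OF that] real assms unfolding real
      by (subst (asm) Lp_norm_le_iff) (auto simp: nn_integral_completion)
    then show "(\<integral>\<^sup>+x. indicator {0..\<delta>} t * ennreal (H t x powr p) \<partial>lborel) \<le> ennreal (k powr p) * indicator {0..\<delta>} t"
      by (auto simp: indicator_def)
  qed
  also have "\<dots> = ennreal (k powr p) * ennreal \<delta>"
    using \<open>0 < \<delta>\<close> by (subst nn_integral_cmult_indicator) auto
  also have "ennreal (\<delta> powr (p - 1)) * (ennreal (k powr p) * ennreal \<delta>) = ennreal ((\<delta> * k) powr p)"
  proof -
    have "\<delta> * \<delta> powr (p - 1) = \<delta> powr p" using \<open>0 < \<delta>\<close> powr_mult_base[of \<delta> "p - 1"] by simp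
    then have "\<delta> powr (p - 1) * (k powr p * \<delta>) = \<delta> powr p * k powr p" by (simp add: mult_ac)
    also have "\<dots> = (\<delta> * k) powr p" using \<open>0 < \<delta>\<close> real by (simp add: powr_mult)
    finally show ?thesis using \<open>0 < \<delta>\<close> by (simp flip: ennreal_mult)
  qed
  finally have "(\<integral>\<^sup>+x. ennreal (norm (u x) powr p) \<partial>lebesgue) \<le> ennreal ((\<delta> * k) powr p)"
    by (simp add: mult_left_mono)
  then have "Lp_norm p u \<le> ennreal (\<delta> * k)"
    using assms real by (subst Lp_norm_le_iff) auto
  then show ?thesis using real assms by (simp add: ennreal_mult)
qed

section \<open>Discrete norms\<close>

lemma infsum_ennreal_SUP:
  fixes f :: "'i \<Rightarrow> ennreal"
  shows "infsum f UNIV = (SUP F\<in>{F. finite F}. sum f F)"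
  by (subst nonneg_infsum_complete) auto

lemma infsum_ennreal_leI:
  fixes f :: "'i \<Rightarrow> ennreal"
  assumes "\<And>F. finite F \<Longrightarrow> sum f F \<le> b"
  shows "infsum f UNIV \<le> b"
  unfolding infsum_ennreal_SUP using assms by (intro SUP_least) auto

lemma finite_sum_le_infsum_ennreal:
  fixes f :: "'i \<Rightarrow> ennreal"
  assumes "finite F"
  shows "sum f F \<le> infsum f UNIV"
  unfolding infsum_ennreal_SUP using assms by (intro SUP_upper) auto

abbreviation lp_summand :: "real \<Rightarrow> (int \<Rightarrow> real) \<Rightarrow> (real \<Rightarrow> 'a::real_normed_vector) \<Rightarrow> int \<Rightarrow> ennreal" where
  "lp_summand p x f j \<equiv> ennreal (norm (f (x j)) powr p * (x j - x (j - 1)))"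

lemma lp_norm_quasi_add:
  assumes "1 \<le> p" "\<And>j. x (j - 1) \<le> x j" "\<And>j. norm (h (x j)) \<le> norm (f (x j)) + norm (g (x j))"
  shows "lp_norm p x h \<le> 2 * (lp_norm p x f + lp_norm p x g)"
  unfolding lp_norm_def
proof (rule ennreal_root_quasi_add[OF \<open>1 \<le> p\<close> infsum_ennreal_leI])
  fix F :: "int set" assume "finite F"
  have "(\<Sum>j\<in>F. lp_summand p x h j) \<le>
      (\<Sum>j\<in>F. ennreal (2 powr p) * (lp_summand p x f j +
         lp_summand p x g j))"
  proof (rule sum_mono)
    fix j
    have "norm (h (x j)) powr p \<le> (norm (f (x j)) + norm (g (x j))) powr p"
      using assms by (intro powr_mono2) auto
    also have "\<dots> \<le> 2 powr p * (norm (f (x j)) powr p + norm (g (x j)) powr p)"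
      using assms by (intro powr_add_le_double) auto
    finally have "norm (h (x j)) powr p * (x j - x (j - 1)) \<le>
        2 powr p * (norm (f (x j)) powr p + norm (g (x j)) powr p) * (x j - x (j - 1))"
      using assms by (intro mult_right_mono) auto
    then have "lp_summand p x h j \<le>
        ennreal (2 powr p * (norm (f (x j)) powr p * (x j - x (j - 1)) + norm (g (x j)) powr p * (x j - x (j - 1))))"
      by (intro ennreal_leI) (simp add: algebra_simps)
    also have "\<dots> = ennreal (2 powr p) * (lp_summand p x f j +
         lp_summand p x g j)"
      using assms(2)[of j] by (subst ennreal_mult) (auto intro!: ennreal_plus)
    finally show "lp_summand p x h j \<le>
      ennreal (2 powr p) * (lp_summand p x f j +
         lp_summand p x g j)"
      .
  qed
  also have "\<dots> = ennreal (2 powr p) * ((\<Sum>j\<in>F. lp_summand p x f j) +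
         (\<Sum>j\<in>F. lp_summand p x g j))"
    by (simp only: sum_distrib_left[symmetric] sum.distrib)
  also have "\<dots> \<le> ennreal (2 powr p) * ((\<Sum>\<^sub>\<infinity>j. lp_summand p x f j) +
         (\<Sum>\<^sub>\<infinity>j. lp_summand p x g j))"
    using \<open>finite F\<close> by (intro mult_left_mono add_mono finite_sum_le_infsum_ennreal) auto
  finally show "(\<Sum>j\<in>F. lp_summand p x h j) \<le> \<dots>" .
qed

lemma uniform_nodes_gap: "uniform_nodes W j - uniform_nodes W (j - 1) = 1 / W"
  by (simp add: uniform_nodes_def diff_divide_distrib)

lemma uniform_nodes_mono: "0 < W \<Longrightarrow> uniform_nodes W (j - 1) \<le> uniform_nodes W j"
  using uniform_nodes_gap[of W j] by (smt (verit) divide_pos_pos)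

text \<open>
The windows \<open>[j / W, (j + r) / W]\<close> that contain \<open>t\<close> are those with \<open>t W - r \<le> j \<le> t W\<close>, and
an interval of length \<open>r\<close> contains at most \<open>r + 1\<close> integers.
\<close>

lemma sum_window_indicator_le:
  fixes W t :: real
  assumes "0 < W" "finite F"
  shows "(\<Sum>j\<in>F. indicator {uniform_nodes W j..uniform_nodes W j + real r / W} t) \<le> (ennreal (real r + 1))"
proof -
  define S where "S = {j\<in>F. t \<in> {uniform_nodes W j..uniform_nodes W j + real r / W}}"
  have "finite S" using assms by (simp add: S_def)
  have "S \<subseteq> {\<lfloor>t * W\<rfloor> - int r..\<lfloor>t * W\<rfloor>}"
  proof
    fix j assume "j \<in> S"
    then have "of_int j \<le> t * W" "t * W \<le> of_int j + real r"
      using assms(1) by (auto simp: S_def uniform_nodes_def field_simps)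
    then show "j \<in> {\<lfloor>t * W\<rfloor> - int r..\<lfloor>t * W\<rfloor>}" by (auto simp: le_floor_iff) linarith
  qed
  then have "card S \<le> card {\<lfloor>t * W\<rfloor> - int r..\<lfloor>t * W\<rfloor>}" by (intro card_mono) auto
  also have "\<dots> = r + 1" by simp
  finally have "card S \<le> r + 1" .
  have "(\<Sum>j\<in>F. indicator {uniform_nodes W j..uniform_nodes W j + real r / W} t) = (\<Sum>j\<in>F. if j \<in> S then 1 else 0 :: ennreal)"
    by (intro sum.cong) (auto simp: S_def indicator_def)
  also have "\<dots> = (\<Sum>j\<in>S. 1)" using assms(2) by (subst sum.inter_restrict[symmetric]) (auto simp: S_def Int_def)
  also have "\<dots> = ennreal (real (card S))" by (simp add: ennreal_of_nat_eq_real_of_nat)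
  also have "\<dots> \<le> ennreal (real r + 1)" using \<open>card S \<le> r + 1\<close> by (intro ennreal_leI) auto
  finally show ?thesis .
qed

text \<open>
A sampling inequality: by the power mean inequality the \<open>p\<close>-th power of the sample at a node is bounded
by a multiple of the integral of \<open>\<phi>\<^sup>p\<close> over the window that starts there, and the windows overlap at most \<open>r + 1\<close> times.
\<close>

lemma lp_norm_uniform_le:
  fixes \<phi> :: "real \<Rightarrow> real" and v :: "real \<Rightarrow> 'a::real_normed_vector"
  assumes [measurable]: "\<phi> \<in> borel_measurable lebesgue" and \<phi>: "\<And>x. 0 \<le> \<phi> x"
    and "0 < W" "1 \<le> p" "1 \<le> r"
    and le: "\<And>x. ennreal (norm (v x)) \<le> window_integral x (x + real r / W) \<phi>"
  shows "lp_norm p (uniform_nodes W) v \<le> ennreal ((real r + 1) / W) * Lp_norm p \<phi>"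
proof -
  define L where "L = real r / W"
  define A where "A = (\<lambda>j. {uniform_nodes W j..uniform_nodes W j + L})"
  have "0 < L" using assms by (simp add: L_def)
  have [measurable]: "A j \<in> sets lebesgue" for j by (simp add: A_def)
  define I where "I = (\<integral>\<^sup>+t. ennreal (\<phi> t powr p) \<partial>lebesgue)"
  have "(\<Sum>\<^sub>\<infinity>j. ennreal (norm (v (uniform_nodes W j)) powr p * (uniform_nodes W j - uniform_nodes W (j - 1)))) \<le>
    ennreal (((real r + 1) / W) powr p) * I"
  proof (rule infsum_ennreal_leI)
    fix F :: "int set" assume "finite F"
    have "(\<Sum>j\<in>F. ennreal (norm (v (uniform_nodes W j)) powr p * (uniform_nodes W j - uniform_nodes W (j - 1)))) =
      (\<Sum>j\<in>F. ennreal (1 / W) * ennreal (norm (v (uniform_nodes W j)) powr p))"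
      using assms by (intro sum.cong) (auto simp: uniform_nodes_gap mult.commute simp flip: ennreal_mult)
    also have "\<dots> \<le> (\<Sum>j\<in>F. ennreal (1 / W) * (ennreal (L powr (p - 1)) * (\<integral>\<^sup>+t. indicator (A j) t * ennreal (\<phi> t powr p) \<partial>lebesgue)))"
    proof (intro sum_mono mult_left_mono nn_integral_power_mean)
      fix j
      show "emeasure lebesgue (A j) = ennreal L" using \<open>0 < L\<close> by (simp add: A_def)
      show "ennreal (norm (v (uniform_nodes W j))) \<le> (\<integral>\<^sup>+t. indicator (A j) t * ennreal (\<phi> t) \<partial>lebesgue)"
        using le by (simp add: A_def L_def)
    qed (use \<open>0 < L\<close> assms in auto)
    also have "\<dots> = ennreal (1 / W) * ennreal (L powr (p - 1)) * (\<integral>\<^sup>+t. (\<Sum>j\<in>F. indicator (A j) t) * ennreal (\<phi> t powr p) \<partial>lebesgue)"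
      by (simp add: sum_distrib_left sum_distrib_right nn_integral_sum mult.assoc)
    also have "(\<integral>\<^sup>+t. (\<Sum>j\<in>F. indicator (A j) t) * ennreal (\<phi> t powr p) \<partial>lebesgue) \<le>
      (\<integral>\<^sup>+t. ennreal (real r + 1) * ennreal (\<phi> t powr p) \<partial>lebesgue)"
      using sum_window_indicator_le[OF \<open>0 < W\<close> \<open>finite F\<close>]
      by (intro nn_integral_mono mult_right_mono) (auto simp: A_def L_def)
    also have "\<dots> = ennreal (real r + 1) * I" unfolding I_def by (rule nn_integral_cmult) measurable
    also have "ennreal (1 / W) * ennreal (L powr (p - 1)) * (ennreal (real r + 1) * I) =
       ennreal (1 / W * L powr (p - 1) * (real r + 1)) * I"
    proof -
      have "ennreal (1 / W * L powr (p - 1) * (real r + 1)) =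
          ennreal (1 / W * L powr (p - 1)) * ennreal (real r + 1)"
        using \<open>0 < W\<close> by (intro ennreal_mult) auto
      also have "ennreal (1 / W * L powr (p - 1)) = ennreal (1 / W) * ennreal (L powr (p - 1))"
        using \<open>0 < W\<close> by (intro ennreal_mult) auto
      finally show ?thesis by (simp only: mult.assoc)
    qed
    also have "\<dots> \<le> ennreal (((real r + 1) / W) powr p) * I"
    proof (intro mult_right_mono ennreal_leI)
      have "1 / W * L powr (p - 1) * (real r + 1) = ((real r + 1) / W) * L powr (p - 1)" by simp
      also have "\<dots> \<le> ((real r + 1) / W) * ((real r + 1) / W) powr (p - 1)"
        using assms \<open>0 < L\<close> by (intro mult_left_mono powr_mono2) (auto simp: L_def divide_right_mono)
      also have "\<dots> = ((real r + 1) / W) powr p"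
        using assms powr_mult_base[of "(real r + 1) / W" "p - 1"] by simp
      finally show "1 / W * L powr (p - 1) * (real r + 1) \<le> ((real r + 1) / W) powr p" .
    qed simp
    finally show "(\<Sum>j\<in>F. ennreal (norm (v (uniform_nodes W j)) powr p * (uniform_nodes W j - uniform_nodes W (j - 1)))) \<le>
      ennreal (((real r + 1) / W) powr p) * I" by (simp add: mult_left_mono)
  qed
  then have "lp_norm p (uniform_nodes W) v \<le> ennreal_root p (ennreal (((real r + 1) / W) powr p) * I)"
    unfolding lp_norm_def using assms by (intro ennreal_root_mono) auto
  also have "\<dots> = ennreal ((real r + 1) / W) * ennreal_root p I"
    using assms by (intro ennreal_root_cmult) auto
  also have "ennreal_root p I = Lp_norm p \<phi>" using \<phi> by (simp add: I_def Lp_norm_def)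
  finally show ?thesis .
qed


section \<open>Averages over intervals and Steklov means\<close>

text \<open>
The class contains the bounded measurable functions and the continuous ones, thus both \<open>f\<close> and
a Sobolev function \<open>g\<close>, and it is stable under the averages below.
\<close>

definition locally_bounded_measurable :: "(real \<Rightarrow> 'a::euclidean_space) \<Rightarrow> bool" where
  "locally_bounded_measurable f \<longleftrightarrow> f \<in> borel_measurable lebesgue \<and> (\<forall>a b. bounded (f ` {a..b}))"

lemma lbm_measurable: "locally_bounded_measurable f \<Longrightarrow> f \<in> borel_measurable lebesgue"
  by (simp add: locally_bounded_measurable_def)

lemma lbm_boundE:
  assumes "locally_bounded_measurable f"
  obtains B where "0 < B" "\<And>x. x \<in> {a..b} \<Longrightarrow> norm (f x) \<le> B"
proof -
  have "bounded (f ` {a..b})" using assms by (simp add: locally_bounded_measurable_def)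
  then obtain B where "0 < B" "\<forall>x\<in>f ` {a..b}. norm x \<le> B" unfolding bounded_pos by blast
  then show thesis by (intro that[of B]) auto
qed

lemma lbmI:
  assumes "f \<in> borel_measurable lebesgue" "\<And>a b. \<exists>B. \<forall>x\<in>{a..b}. norm (f x) \<le> B"
  shows "locally_bounded_measurable f"
  using assms unfolding locally_bounded_measurable_def bounded_iff by auto

lemma lbm_const: "locally_bounded_measurable (\<lambda>x. c)"
  by (rule lbmI) auto

lemma lbm_continuous:
  assumes "continuous_on UNIV f"
  shows "locally_bounded_measurable f"
proof -
  have "bounded (f ` {a..b})" for a b
    by (intro compact_imp_bounded compact_continuous_image) (auto intro: continuous_on_subset[OF assms])
  moreover have "f \<in> borel_measurable lebesgue"
    using assms by (intro measurable_completion) (auto intro: borel_measurable_continuous_onI)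
  ultimately show ?thesis by (auto simp: locally_bounded_measurable_def)
qed

lemma lbm_bounded: "f \<in> borel_measurable lebesgue \<Longrightarrow> bounded (range f) \<Longrightarrow> locally_bounded_measurable f"
  unfolding locally_bounded_measurable_def by (auto intro: bounded_subset)

lemma lbm_diff:
  assumes "locally_bounded_measurable f" "locally_bounded_measurable g"
  shows "locally_bounded_measurable (\<lambda>x. f x - g x)"
proof (rule lbmI)
  show "(\<lambda>x. f x - g x) \<in> borel_measurable lebesgue"
    using assms by (intro borel_measurable_diff) (auto dest: lbm_measurable)
  fix a b :: real
  obtain B where "\<And>x. x \<in> {a..b} \<Longrightarrow> norm (f x) \<le> B" using lbm_boundE[OF assms(1)] by metis
  moreover obtain C where "\<And>x. x \<in> {a..b} \<Longrightarrow> norm (g x) \<le> C" using lbm_boundE[OF assms(2)] by metis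
  ultimately have "norm (f x - g x) \<le> B + C" if "x \<in> {a..b}" for x
    using norm_triangle_ineq4[of "f x" "g x"] that by fastforce
  then show "\<exists>B. \<forall>x\<in>{a..b}. norm (f x - g x) \<le> B" by blast
qed

lemma lbm_affine:
  assumes "locally_bounded_measurable f"
  shows "locally_bounded_measurable (\<lambda>t. f (y + c * t))"
proof (cases "c = 0")
  case True
  then show ?thesis by (simp add: lbm_const)
next
  case False
  show ?thesis
  proof (rule lbmI)
    show "(\<lambda>t. f (y + c * t)) \<in> borel_measurable lebesgue"
      by (rule measurable_affine_lebesgue[OF lbm_measurable[OF assms] False])
    fix a b :: real
    define M where "M = \<bar>c\<bar> * (\<bar>a\<bar> + \<bar>b\<bar>)"
    obtain B where B: "\<And>x. x \<in> {y - M..y + M} \<Longrightarrow> norm (f x) \<le> B" using lbm_boundE[OF assms] by metis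
    have "norm (f (y + c * t)) \<le> B" if "t \<in> {a..b}" for t
    proof (rule B)
      have "\<bar>c * t\<bar> \<le> M" unfolding M_def abs_mult using that by (intro mult_left_mono) auto
      then show "y + c * t \<in> {y - M..y + M}" by auto
    qed
    then show "\<exists>B. \<forall>t\<in>{a..b}. norm (f (y + c * t)) \<le> B" by blast
  qed
qed

lemma lbm_translate: "locally_bounded_measurable f \<Longrightarrow> locally_bounded_measurable (\<lambda>t. f (t + h))"
  using lbm_affine[of f h 1] by (simp add: add.commute)

lemma lbm_set_integrable:
  assumes "locally_bounded_measurable f"
  shows "set_integrable lebesgue {a..b} f"
proof -
  obtain B where "\<And>x. x \<in> {a..b} \<Longrightarrow> norm (f x) \<le> B" using lbm_boundE[OF assms] by metis
  then show ?thesis unfolding set_integrable_def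
    by (intro integrableI_bounded_set_indicator[where B = B] lbm_measurable[OF assms])
      (auto simp: emeasure_lborel_Icc_eq)
qed

lemma lbm_integrable_on: "locally_bounded_measurable f \<Longrightarrow> f integrable_on {a..b}"
  by (rule set_lebesgue_integral_eq_integral(1)[OF lbm_set_integrable])

lemma lbm_integral_diff:
  assumes "locally_bounded_measurable f" "a \<le> u" "u \<le> v"
  shows "integral {a..v} f - integral {a..u} f = integral {u..v} f"
  using Henstock_Kurzweil_Integration.integral_combine[OF assms(2,3) lbm_integrable_on[OF assms(1)]] by (simp add: algebra_simps)

lemma norm_set_integral_le_nn_integral:
  fixes f :: "real \<Rightarrow> 'a::euclidean_space"
  shows "ennreal (norm (LINT t:{a..b}|lebesgue. f t)) \<le> window_integral a b (\<lambda>t. norm (f t))"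
proof (cases "integrable lebesgue (\<lambda>t. indicator {a..b} t *\<^sub>R f t)")
  case True
  have "ennreal (norm (LINT t|lebesgue. indicator {a..b} t *\<^sub>R f t)) \<le> (\<integral>\<^sup>+t. ennreal (norm (indicator {a..b} t *\<^sub>R f t)) \<partial>lebesgue)"
    by (rule integral_norm_bound_ennreal[OF True])
  also have "\<dots> = window_integral a b (\<lambda>t. norm (f t))"
    by (intro nn_integral_cong) (auto simp: indicator_def)
  finally show ?thesis by (simp add: set_lebesgue_integral_def)
next
  case False
  then show ?thesis by (simp add: set_lebesgue_integral_def not_integrable_integral_eq)
qed

text \<open>
This is \<open>\<delta>\<close> times the mean of \<open>f\<close> over \<open>[y, y + c \<delta>]\<close>, in the form in which it occurs in the
Steklov mean.
\<close>

definition smear :: "real \<Rightarrow> real \<Rightarrow> (real \<Rightarrow> 'a::euclidean_space) \<Rightarrow> real \<Rightarrow> 'a" where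
  "smear c \<delta> f y = (LINT t:{0..\<delta>}|lebesgue. f (y + c * t))"

text \<open>
The substitution \<open>x = y + c t\<close> exhibits the average as an integral with moving endpoints.
\<close>

lemma smear_eq_integral:
  assumes "locally_bounded_measurable f" "0 < c" "0 < \<delta>"
  shows "smear c \<delta> f y = (1 / c) *\<^sub>R integral {y..y + c * \<delta>} f"
proof -
  have "(f has_integral integral {y..y + c * \<delta>} f) (cbox y (y + c * \<delta>))"
    using lbm_integrable_on[OF assms(1)] by (simp add: has_integral_integral)
  from has_integral_affinity[OF this, of c y] assms(2,3)
  have "((\<lambda>t. f (c * t + y)) has_integral (1 / c) *\<^sub>R integral {y..y + c * \<delta>} f) ((\<lambda>x. (1 / c) *\<^sub>R x + - ((1 / c) *\<^sub>R y)) ` {y..y + c * \<delta>})"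
    by (simp add: inverse_eq_divide)
  also have "(\<lambda>x. (1 / c) *\<^sub>R x + - ((1 / c) *\<^sub>R y)) ` {y..y + c * \<delta>} = {0..\<delta>}"
    using image_affinity_atLeastAtMost[of "1 / c" "- (y / c)" y "y + c * \<delta>"] assms(2,3)
    by (simp add: field_simps)
  finally have "((\<lambda>t. f (y + c * t)) has_integral (1 / c) *\<^sub>R integral {y..y + c * \<delta>} f) {0..\<delta>}"
    by (simp add: add.commute)
  moreover have "smear c \<delta> f y = integral {0..\<delta>} (\<lambda>t. f (y + c * t))"
    unfolding smear_def by (intro set_lebesgue_integral_eq_integral lbm_set_integrable lbm_affine assms)
  ultimately show ?thesis by (simp add: integral_unique)
qed

lemma smear_zero: "0 < \<delta> \<Longrightarrow> smear 0 \<delta> f y = \<delta> *\<^sub>R f y"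
  by (simp add: smear_def set_lebesgue_integral_def)

text \<open>
Moving the window from \<open>u\<close> to \<open>v\<close> only exchanges the two end pieces of length \<open>v - u\<close>.
\<close>

lemma smear_increment_bound:
  assumes f: "locally_bounded_measurable f" and "0 < c" "0 < \<delta>"
    and B: "\<And>x. x \<in> {u..v + c * \<delta>} \<Longrightarrow> norm (f x) \<le> B" and "u \<le> v"
  shows "norm (smear c \<delta> f v - smear c \<delta> f u) \<le> (2 * B / c) * (v - u)"
proof -
  define P where "P = (\<lambda>x. integral {u..x} f)"
  have P: "P y - P x = integral {x..y} f" if "u \<le> x" "x \<le> y" for x y
    unfolding P_def using lbm_integral_diff[OF f that] .
  have bd: "norm (integral {x..y} f) \<le> B * (y - x)" if "u \<le> x" "x \<le> y" "y \<le> v + c * \<delta>" for x y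
  proof -
    have "0 \<le> B" using B[of u] norm_ge_zero[of "f u"] \<open>u \<le> v\<close> assms(2,3) by (smt (verit) atLeastAtMost_iff mult_pos_pos)
    then have "norm (integral (cbox x y) f) \<le> B * measure lborel (cbox x y)"
      using lbm_integrable_on[OF f] that by (intro integrable_bound) (auto intro!: B)
    then show ?thesis using that by simp
  qed
  have pos: "0 < c * \<delta>" using assms by simp
  have "smear c \<delta> f v - smear c \<delta> f u = (1 / c) *\<^sub>R ((P (v + c * \<delta>) - P v) - (P (u + c * \<delta>) - P u))"
    unfolding smear_eq_integral[OF f assms(2,3)] using pos \<open>u \<le> v\<close> by (simp add: P scaleR_diff_right)
  also have "(P (v + c * \<delta>) - P v) - (P (u + c * \<delta>) - P u) = integral {u + c * \<delta>..v + c * \<delta>} f - integral {u..v} f"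
    using P[of "u + c * \<delta>" "v + c * \<delta>"] P[of u v] pos \<open>u \<le> v\<close> by (simp add: algebra_simps)
  finally have "norm (smear c \<delta> f v - smear c \<delta> f u) = (1 / c) * norm (integral {u + c * \<delta>..v + c * \<delta>} f - integral {u..v} f)"
    using assms by simp
  also have "\<dots> \<le> (1 / c) * (B * (v - u) + B * (v - u))"
    using bd[of "u + c * \<delta>" "v + c * \<delta>"] bd[of u v] pos \<open>u \<le> v\<close> assms
    by (intro mult_left_mono order_trans[OF norm_triangle_ineq4] add_mono) auto
  finally show ?thesis by (simp add: field_simps)
qed

lemma smear_continuous:
  assumes f: "locally_bounded_measurable f" and "0 < c" "0 < \<delta>"
  shows "continuous_on UNIV (smear c \<delta> f)"
proof -
  have "isCont (smear c \<delta> f) x" for x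
  proof -
    obtain B where B: "0 < B" "\<And>y. y \<in> {x - 1..x + 1 + c * \<delta>} \<Longrightarrow> norm (f y) \<le> B"
      using lbm_boundE[OF f] by metis
    have "(2 * B / c)-lipschitz_on {x - 1..x + 1} (smear c \<delta> f)"
    proof (rule lipschitz_onI)
      fix u v assume uv: "u \<in> {x - 1..x + 1}" "v \<in> {x - 1..x + 1}"
      show "dist (smear c \<delta> f u) (smear c \<delta> f v) \<le> 2 * B / c * dist u v"
      proof (cases "u \<le> v")
        case True
        show ?thesis using smear_increment_bound[OF assms, of u v B] B uv True
          by (simp add: dist_norm norm_minus_commute)
      next
        case False
        show ?thesis using smear_increment_bound[OF assms, of v u B] B uv False
          by (simp add: dist_norm norm_minus_commute)
      qed
    qed (use B assms in auto)
    then have "continuous_on {x - 1..x + 1} (smear c \<delta> f)" by (rule lipschitz_on_continuous_on)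
    then show ?thesis by (rule continuous_on_interior) simp
  qed
  then show ?thesis by (simp add: continuous_on_eq_continuous_at)
qed

lemma lbm_smear:
  assumes f: "locally_bounded_measurable f" and "0 \<le> c" "0 < \<delta>"
  shows "locally_bounded_measurable (smear c \<delta> f)"
proof (cases "c = 0")
  case True
  have "locally_bounded_measurable (\<lambda>y. \<delta> *\<^sub>R f y)"
  proof (rule lbmI)
    show "(\<lambda>y. \<delta> *\<^sub>R f y) \<in> borel_measurable lebesgue"
      using lbm_measurable[OF f] by (intro borel_measurable_scaleR) auto
    fix a b
    obtain B where "\<And>x. x \<in> {a..b} \<Longrightarrow> norm (f x) \<le> B" using lbm_boundE[OF f] by metis
    then show "\<exists>B. \<forall>x\<in>{a..b}. norm (\<delta> *\<^sub>R f x) \<le> B"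
      using assms by (intro exI[of _ "\<delta> * B"]) auto
  qed
  then show ?thesis using True smear_zero[OF assms(3)] by (metis (no_types, lifting) ext)
next
  case False
  then show ?thesis using smear_continuous[OF f] assms by (intro lbm_continuous) auto
qed

lemma lbm_smear_funpow:
  assumes "locally_bounded_measurable f" "0 \<le> c" "0 < \<delta>"
  shows "locally_bounded_measurable ((smear c \<delta> ^^ n) f)"
  by (induction n) (use assms lbm_smear in auto)

lemma smear_zero_funpow: "0 < \<delta> \<Longrightarrow> (smear 0 \<delta> ^^ n) f y = \<delta> ^ n *\<^sub>R f y"
  by (induction n arbitrary: y) (auto simp: smear_zero)

lemma smear_diff:
  assumes "locally_bounded_measurable f" "locally_bounded_measurable g"
  shows "smear c \<delta> (\<lambda>x. f x - g x) y = smear c \<delta> f y - smear c \<delta> g y"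
  unfolding smear_def
  by (rule set_integral_diff(2)) (intro lbm_set_integrable lbm_affine assms)+

lemma smear_funpow_diff:
  assumes "locally_bounded_measurable f" "locally_bounded_measurable g" "0 \<le> c" "0 < \<delta>"
  shows "(smear c \<delta> ^^ n) (\<lambda>x. f x - g x) = (\<lambda>x. (smear c \<delta> ^^ n) f x - (smear c \<delta> ^^ n) g x)"
  by (induction n) (auto simp: smear_diff lbm_smear_funpow assms)

lemma smear_funpow_translate:
  "(smear c \<delta> ^^ n) (\<lambda>x. f (x + h)) = (\<lambda>x. (smear c \<delta> ^^ n) f (x + h))"
  by (induction n) (auto simp: smear_def algebra_simps)

text \<open>
Each integration over \<open>[0, \<delta>]\<close> is an application of \<open>smear\<close>, because the integrand depends on the
variables only through their sum. The case \<open>c m = 0\<close> is included, as it carries the summand \<open>f x\<close> in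
\<open>steklov_minus_eq\<close>.
\<close>

lemma iterated_integral_sum_affine:
  fixes f :: "real \<Rightarrow> 'a::euclidean_space" and a c y :: "'i \<Rightarrow> real"
  assumes f: "locally_bounded_measurable f" and "finite S" "\<And>m. m \<in> S \<Longrightarrow> 0 \<le> c m" "0 < \<delta>"
  shows "iterated_integral n \<delta> (\<lambda>ts. \<Sum>m\<in>S. a m *\<^sub>R f (y m + c m * sum_list ts)) =
    (\<Sum>m\<in>S. a m *\<^sub>R (smear (c m) \<delta> ^^ n) f (y m))"
proof (induction n arbitrary: y)
  case (Suc n)
  define F where "F = (\<lambda>m. (smear (c m) \<delta> ^^ n) f)"
  have int: "set_integrable lebesgue {0..\<delta>} (\<lambda>t. F m (y m + c m * t))" if "m \<in> S" for m
    unfolding F_def using assms that by (intro lbm_set_integrable lbm_affine lbm_smear_funpow) auto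
  have "iterated_integral (Suc n) \<delta> (\<lambda>ts. \<Sum>m\<in>S. a m *\<^sub>R f (y m + c m * sum_list ts)) =
    (LINT t:{0..\<delta>}|lebesgue. iterated_integral n \<delta> (\<lambda>ts. \<Sum>m\<in>S. a m *\<^sub>R f ((y m + c m * t) + c m * sum_list ts)))"
    by (simp add: algebra_simps)
  also have "\<dots> = (LINT t:{0..\<delta>}|lebesgue. (\<Sum>m\<in>S. a m *\<^sub>R F m (y m + c m * t)))"
    by (simp only: Suc.IH F_def)
  also have "\<dots> = (LINT t|lebesgue. (\<Sum>m\<in>S. a m *\<^sub>R (indicator {0..\<delta>} t *\<^sub>R F m (y m + c m * t))))"
    unfolding set_lebesgue_integral_def by (simp add: scaleR_sum_right mult.commute)
  also have "\<dots> = (\<Sum>m\<in>S. a m *\<^sub>R (LINT t:{0..\<delta>}|lebesgue. F m (y m + c m * t)))"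
    unfolding set_lebesgue_integral_def
  proof (subst Bochner_Integration.integral_sum)
    fix m assume "m \<in> S"
    then have "integrable lebesgue (\<lambda>t. indicator {0..\<delta>} t *\<^sub>R F m (y m + c m * t))"
      using int by (simp only: set_integrable_def)
    then show "integrable lebesgue (\<lambda>t. a m *\<^sub>R (indicator {0..\<delta>} t *\<^sub>R F m (y m + c m * t)))"
      by (intro integrable_scaleR_right)
  qed (simp only: integral_scaleR_right)
  also have "\<dots> = (\<Sum>m\<in>S. a m *\<^sub>R (smear (c m) \<delta> ^^ Suc n) f (y m))"
    by (simp add: smear_def F_def)
  finally show ?case .
qed simp

definition steklov_weight :: "nat \<Rightarrow> real \<Rightarrow> nat \<Rightarrow> real" where
  "steklov_weight r \<delta> m = (1 / (- \<delta>) ^ r) * ((-1) ^ (r - m + 1) * real (r choose m))"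

lemma steklov_eq_smear:
  fixes f :: "real \<Rightarrow> 'a::euclidean_space"
  assumes "locally_bounded_measurable f" "0 < \<delta>"
  shows "steklov r \<delta> f x = (\<Sum>m=1..r. steklov_weight r \<delta> m *\<^sub>R (smear (real m / real r) \<delta> ^^ r) f x)"
  unfolding steklov_def steklov_weight_def
  by (subst iterated_integral_sum_affine) (use assms in \<open>auto simp: scaleR_sum_right\<close>)

text \<open>
In the difference of order \<open>r\<close> with step \<open>(t\<^sub>1 + \<dots> + t\<^sub>r) / r\<close>, the summand for \<open>m = 0\<close> is constant in
the variables and integrates to \<open>(- \<delta>)\<^sup>r f x\<close>; the others form, up to a factor, the Steklov mean.
\<close>

lemma steklov_minus_eq:
  fixes f :: "real \<Rightarrow> 'a::euclidean_space"
  assumes f: "locally_bounded_measurable f" and "0 < \<delta>"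
  shows "steklov r \<delta> f x - f x =
    - (1 / (- \<delta>) ^ r) *\<^sub>R iterated_integral r \<delta> (\<lambda>ts. forward_diff r (sum_list ts / real r) f x)"
proof -
  define w where "w = (\<lambda>m. real (r choose m) * (-1) ^ (r - m))"
  have "iterated_integral r \<delta> (\<lambda>ts. forward_diff r (sum_list ts / real r) f x) =
    iterated_integral r \<delta> (\<lambda>ts. \<Sum>m=0..r. w m *\<^sub>R f (x + (real m / real r) * sum_list ts))"
    by (simp add: forward_diff_def w_def)
  also have "\<dots> = (\<Sum>m=0..r. w m *\<^sub>R (smear (real m / real r) \<delta> ^^ r) f x)"
    using assms by (intro iterated_integral_sum_affine) auto
  also have "\<dots> = w 0 *\<^sub>R (smear 0 \<delta> ^^ r) f x + (\<Sum>m=1..r. w m *\<^sub>R (smear (real m / real r) \<delta> ^^ r) f x)"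
    by (subst sum.atLeast_Suc_atMost) auto
  also have "w 0 *\<^sub>R (smear 0 \<delta> ^^ r) f x = (- \<delta>) ^ r *\<^sub>R f x"
    using assms by (simp add: w_def smear_zero_funpow power_minus[of \<delta>])
  finally have "- (1 / (- \<delta>) ^ r) *\<^sub>R iterated_integral r \<delta> (\<lambda>ts. forward_diff r (sum_list ts / real r) f x) =
    - f x + (\<Sum>m=1..r. (- (1 / (- \<delta>) ^ r) * w m) *\<^sub>R (smear (real m / real r) \<delta> ^^ r) f x)"
    using assms by (simp add: scaleR_add_right scaleR_sum_right sum_negf)
  also have "(\<Sum>m=1..r. (- (1 / (- \<delta>) ^ r) * w m) *\<^sub>R (smear (real m / real r) \<delta> ^^ r) f x) = steklov r \<delta> f x"
    unfolding steklov_eq_smear[OF assms] by (intro sum.cong refl) (simp add: w_def steklov_weight_def)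
  finally show ?thesis by simp
qed

lemma abs_steklov_weight: "0 < \<delta> \<Longrightarrow> \<bar>steklov_weight r \<delta> m\<bar> = real (r choose m) / \<delta> ^ r"
  by (simp add: steklov_weight_def abs_mult power_abs)

lemma steklov_diff:
  fixes f g :: "real \<Rightarrow> 'a::euclidean_space"
  assumes "locally_bounded_measurable f" "locally_bounded_measurable g" "0 < \<delta>"
  shows "steklov r \<delta> (\<lambda>x. f x - g x) x = steklov r \<delta> f x - steklov r \<delta> g x"
  using assms by (simp add: steklov_eq_smear lbm_diff smear_funpow_diff scaleR_diff_right sum_subtractf)

section \<open>Forward differences\<close>

lemma forward_diff_0 [simp]: "forward_diff 0 h f x = f x"
  by (simp add: forward_diff_def)

text \<open>
Pascal's rule. This recursion turns the explicit sum into an iterated difference operator, from which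
all further properties follow by induction.
\<close>

lemma forward_diff_Suc:
  "forward_diff (Suc s) h f x = forward_diff s h f (x + h) - forward_diff s h f x"
proof -
  define a where "a = (\<lambda>k::nat. f (x + real k * h))"
  define w where "w = (\<lambda>k. real (s choose k) * (-1) ^ (s - k))"
  have "forward_diff (Suc s) h f x = (\<Sum>k=0..Suc s. (real (Suc s choose k) * (-1) ^ (Suc s - k)) *\<^sub>R a k)"
    by (simp add: forward_diff_def a_def)
  also have "\<dots> = ((-1) ^ Suc s) *\<^sub>R a 0 + (\<Sum>k=0..s. (real (Suc s choose Suc k) * (-1) ^ (s - k)) *\<^sub>R a (Suc k))"
    by (subst sum.atLeast0_atMost_Suc_shift) simp
  also have "(\<Sum>k=0..s. (real (Suc s choose Suc k) * (-1) ^ (s - k)) *\<^sub>R a (Suc k)) =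
     (\<Sum>k=0..s. w k *\<^sub>R a (Suc k)) + (\<Sum>k=0..s. (real (s choose Suc k) * (-1) ^ (s - k)) *\<^sub>R a (Suc k))"
    by (simp add: w_def distrib_right scaleR_add_left sum.distrib)
  also have "(\<Sum>k=0..s. (real (s choose Suc k) * (-1) ^ (s - k)) *\<^sub>R a (Suc k)) = - (\<Sum>k=0..s. w (Suc k) *\<^sub>R a (Suc k))"
    unfolding sum_negf[symmetric]
  proof (rule sum.cong[OF refl])
    fix k assume "k \<in> {0..s}"
    show "(real (s choose Suc k) * (-1) ^ (s - k)) *\<^sub>R a (Suc k) = - (w (Suc k) *\<^sub>R a (Suc k))"
    proof (cases "k = s")
      case False
      then have "s - k = Suc (s - Suc k)" using \<open>k \<in> {0..s}\<close> by auto
      then show ?thesis by (simp add: w_def)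
    qed (simp add: w_def binomial_eq_0)
  qed
  also have "(\<Sum>k=0..s. w (Suc k) *\<^sub>R a (Suc k)) = (\<Sum>k=0..s. w k *\<^sub>R a k) - w 0 *\<^sub>R a 0"
  proof -
    have "(\<Sum>k=0..Suc s. w k *\<^sub>R a k) = w 0 *\<^sub>R a 0 + (\<Sum>k=0..s. w (Suc k) *\<^sub>R a (Suc k))"
      by (rule sum.atLeast0_atMost_Suc_shift[unfolded comp_def])
    then show ?thesis by (simp add: w_def binomial_eq_0)
  qed
  finally have "forward_diff (Suc s) h f x = (\<Sum>k=0..s. w k *\<^sub>R a (Suc k)) - (\<Sum>k=0..s. w k *\<^sub>R a k)"
    by (simp add: w_def)
  moreover have "forward_diff s h f (x + h) = (\<Sum>k=0..s. w k *\<^sub>R a (Suc k))"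
    unfolding forward_diff_def w_def a_def by (intro sum.cong refl) (simp add: algebra_simps)
  moreover have "forward_diff s h f x = (\<Sum>k=0..s. w k *\<^sub>R a k)"
    by (simp add: forward_diff_def w_def a_def)
  ultimately show ?thesis by simp
qed

lemma forward_diff_add: "forward_diff (m + n) h f x = forward_diff m h (forward_diff n h f) x"
  by (induction m arbitrary: x) (simp_all add: forward_diff_Suc)

lemma forward_diff_diff: "forward_diff n h (\<lambda>x. f x - g x) x = forward_diff n h f x - forward_diff n h g x"
  by (induction n arbitrary: x) (simp_all add: forward_diff_Suc)

lemma forward_diff_zero_step: "0 < n \<Longrightarrow> forward_diff n 0 f x = 0"
  by (cases n) (simp_all add: forward_diff_Suc)

lemma norm_forward_diff_le:
  assumes "\<And>y. y \<in> {x..x + real n * h} \<Longrightarrow> norm (f y) \<le> M" "0 \<le> h"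
  shows "norm (forward_diff n h f x) \<le> 2 ^ n * M"
  using assms(1)
proof (induction n arbitrary: x)
  case (Suc n)
  have "norm (forward_diff n h f (x + h)) \<le> 2 ^ n * M" "norm (forward_diff n h f x) \<le> 2 ^ n * M"
    by (rule Suc.IH, rule Suc.prems, use \<open>0 \<le> h\<close> in \<open>simp add: algebra_simps\<close>)+
  then show ?case unfolding forward_diff_Suc
    using norm_triangle_ineq4[of "forward_diff n h f (x + h)" "forward_diff n h f x"] by simp
qed simp

lemma lbm_forward_diff:
  assumes "locally_bounded_measurable f"
  shows "locally_bounded_measurable (forward_diff n h f)"
proof (induction n)
  case (Suc n)
  have "forward_diff (Suc n) h f = (\<lambda>x. forward_diff n h f (x + h) - forward_diff n h f x)"
    by (rule ext) (rule forward_diff_Suc)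
  then show ?case using Suc by (simp add: lbm_diff lbm_translate)
next
  case 0
  have "forward_diff 0 h f = f" by (rule ext) simp
  then show ?case using assms by simp
qed

text \<open>
Averages are linear and commute with translations.
\<close>

lemma smear_funpow_forward_diff:
  assumes f: "locally_bounded_measurable f" and "0 \<le> c" "0 < \<delta>"
  shows "(smear c \<delta> ^^ n) (forward_diff k h f) = forward_diff k h ((smear c \<delta> ^^ n) f)"
proof (induction k)
  case (Suc k)
  have "forward_diff (Suc k) h g = (\<lambda>x. forward_diff k h g (x + h) - forward_diff k h g x)" for g :: "real \<Rightarrow> 'a"
    by (rule ext) (rule forward_diff_Suc)
  then show ?case using Suc lbm_forward_diff[OF f] assms(2,3)
    by (simp add: smear_funpow_diff lbm_translate smear_funpow_translate)
next
  case 0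
  have "forward_diff 0 h g = g" for g :: "real \<Rightarrow> 'a" by (rule ext) simp
  then show ?case by simp
qed


section \<open>Borel representatives and window integrals\<close>

lemma nth_deriv_0 [simp]: "nth_deriv 0 g = g"
  by (simp add: nth_deriv_def)

lemma nth_deriv_Suc: "nth_deriv (Suc k) g = (\<lambda>x. vector_derivative (nth_deriv k g) (at x))"
  by (simp add: nth_deriv_def)

lemma ex_borel_version:
  fixes f :: "real \<Rightarrow> 'a::euclidean_space"
  assumes "f \<in> borel_measurable lebesgue"
  obtains f0 where "f0 \<in> borel_measurable borel" "AE x in lebesgue. f x = f0 x"
proof -
  have "\<exists>g\<in>borel_measurable lborel. AE x in lborel. f x \<bullet> i = g x" for i
    using assms by (intro completion_ex_borel_measurable_real) auto
  then obtain g where g: "\<And>i. g i \<in> borel_measurable lborel" "\<And>i. AE x in lborel. f x \<bullet> i = g i x"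
    by metis
  define f0 where "f0 = (\<lambda>x. \<Sum>i\<in>Basis. g i x *\<^sub>R i)"
  have "AE x in lborel. \<forall>i\<in>Basis. f x \<bullet> i = g i x"
    using g(2) by (intro AE_finite_allI) auto
  then have "AE x in lborel. f x = f0 x"
  proof eventually_elim
    case (elim x)
    have "f x = (\<Sum>i\<in>Basis. (f x \<bullet> i) *\<^sub>R i)" by (rule euclidean_representation[symmetric])
    also have "\<dots> = f0 x" using elim by (simp add: f0_def)
    finally show ?case .
  qed
  then have "AE x in lebesgue. f x = f0 x" by (rule AE_completion)
  moreover have "f0 \<in> borel_measurable borel" using g(1) by (simp add: f0_def)
  ultimately show thesis using that by blast
qed

lemma measurable_window_integrand:
  fixes f :: "real \<Rightarrow> real"
  assumes "f \<in> borel_measurable lebesgue"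
  shows "(\<lambda>t. indicator {a..b} t * ennreal (f t)) \<in> borel_measurable lebesgue"
  using assms by (intro borel_measurable_times_ennreal borel_measurable_indicator) auto

lemma window_integral_cmult:
  fixes h :: "real \<Rightarrow> 'a::euclidean_space"
  assumes "h \<in> borel_measurable lebesgue" "0 \<le> k"
  shows "ennreal k * window_integral a b (\<lambda>t. norm (h t)) =
    window_integral a b (\<lambda>t. k * norm (h t))"
proof -
  have "(\<lambda>t. norm (h t)) \<in> borel_measurable lebesgue" using assms(1) by measurable
  then have "ennreal k * window_integral a b (\<lambda>t. norm (h t)) =
      (\<integral>\<^sup>+t. ennreal k * (indicator {a..b} t * ennreal (norm (h t))) \<partial>lebesgue)"
    by (intro nn_integral_cmult[symmetric] measurable_window_integrand)
  also have "\<dots> = window_integral a b (\<lambda>t. k * norm (h t))"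
    using assms(2) by (intro nn_integral_cong) (simp add: ennreal_mult mult_ac)
  finally show ?thesis .
qed

lemma sum_choose_le: "(\<Sum>m=1..r. real (r choose m)) \<le> 2 ^ r"
proof -
  have "(\<Sum>m=1..r. real (r choose m)) \<le> (\<Sum>m\<le>r. real (r choose m))" by (intro sum_mono2) auto
  also have "\<dots> = 2 ^ r" using choose_row_sum[of r] by (metis of_nat_numeral of_nat_power of_nat_sum)
  finally show ?thesis .
qed

lemma ennreal_mult_mult: "0 \<le> a \<Longrightarrow> 0 \<le> b \<Longrightarrow> ennreal a * (ennreal b * c) = ennreal (a * b) * c"
  by (simp add: ennreal_mult mult.assoc)

lemma lp_norm_uniform_cmult_le:
  fixes h :: "real \<Rightarrow> 'a::euclidean_space" and v :: "real \<Rightarrow> 'b::real_normed_vector"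
  assumes h: "h \<in> borel_measurable lebesgue" and "0 \<le> k" "0 < W" "1 \<le> p" "1 \<le> r"
    and le: "\<And>x. ennreal (norm (v x)) \<le> ennreal k * window_integral x (x + real r / W) (\<lambda>t. norm (h t))"
  shows "lp_norm p (uniform_nodes W) v \<le> ennreal ((real r + 1) / W * k) * Lp_norm p h"
proof -
  have "lp_norm p (uniform_nodes W) v \<le> ennreal ((real r + 1) / W) * Lp_norm p (\<lambda>t. k * norm (h t))"
    using le[unfolded window_integral_cmult[OF h \<open>0 \<le> k\<close>]] assms(2-5) h
    by (intro lp_norm_uniform_le borel_measurable_times) auto
  also have "Lp_norm p (\<lambda>t. k * norm (h t)) = ennreal \<bar>k\<bar> * Lp_norm p h"
    using h \<open>1 \<le> p\<close> by (intro Lp_norm_cmult) (auto simp: abs_mult)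
  finally show ?thesis using assms(2,3) by (simp add: ennreal_mult_mult)
qed

lemma nn_integral_shift_interval:
  fixes \<phi> :: "real \<Rightarrow> real"
  assumes [measurable]: "\<phi> \<in> borel_measurable lebesgue"
  shows "window_integral x (x + L) \<phi> =
    window_integral 0 L (\<lambda>t. \<phi> (x + t))"
proof -
  have "(\<lambda>t. indicator {x..x + L} t * ennreal (\<phi> t)) \<in> borel_measurable lebesgue"
    by (rule measurable_window_integrand[OF assms])
  from nn_integral_real_affine_lebesgue[OF this, of 1 x]
  have "window_integral x (x + L) \<phi> =
    (\<integral>\<^sup>+t. indicator {x..x + L} (x + t) * ennreal (\<phi> (x + t)) \<partial>lebesgue)" by simp
  also have "\<dots> = window_integral 0 L (\<lambda>t. \<phi> (x + t))"
    by (intro nn_integral_cong) (auto simp: indicator_def)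
  finally show ?thesis .
qed

text \<open>
A window integral is an average of the translates of \<open>\<phi>\<close>, all of which have the same norm. The
passage to a Borel function makes \<open>\<phi> (x + t)\<close> jointly measurable in \<open>(t, x)\<close>.
\<close>

lemma Lp_norm_window_integral_le:
  fixes \<phi> :: "real \<Rightarrow> real" and u :: "real \<Rightarrow> 'a::real_normed_vector"
  assumes \<phi>: "\<phi> \<in> borel_measurable lebesgue" "\<And>x. 0 \<le> \<phi> x" and "0 < L" "1 \<le> p"
    and le: "\<And>x. ennreal (norm (u x)) \<le> window_integral x (x + L) \<phi>"
  shows "Lp_norm p u \<le> ennreal L * Lp_norm p \<phi>"
proof -
  obtain \<psi>' where \<psi>': "\<psi>' \<in> borel_measurable borel" "AE x in lebesgue. \<phi> x = \<psi>' x"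
    using ex_borel_version[OF \<phi>(1)] .
  define \<psi> where "\<psi> = (\<lambda>x. \<bar>\<psi>' x\<bar>)"
  have \<psi>m [measurable]: "\<psi> \<in> borel_measurable borel" using \<psi>'(1) by (simp add: \<psi>_def)
  have \<psi>l: "\<psi> \<in> borel_measurable lebesgue" by (rule measurable_completion) simp
  have ae: "AE x in lebesgue. \<phi> x = \<psi> x"
    using \<psi>'(2) by eventually_elim (use \<phi>(2) in \<open>auto simp: \<psi>_def\<close>, metis abs_of_nonneg)
  show ?thesis
  proof (rule Lp_norm_integral_le[where H = "\<lambda>t x. \<psi> (x + t)"])
    show "(\<lambda>(t, x). \<psi> (x + t)) \<in> borel_measurable borel"
      unfolding borel_prod[symmetric] by measurable
    show "0 \<le> \<psi> (x + t)" for t x by (simp add: \<psi>_def)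
    fix x
    note le[of x]
    also have "window_integral x (x + L) \<phi> =
       window_integral x (x + L) \<psi>"
      by (rule nn_integral_cong_AE) (use ae in \<open>eventually_elim, auto\<close>)
    also have "\<dots> = (\<integral>\<^sup>+t. indicator {0..L} t * ennreal (\<psi> (x + t)) \<partial>lborel)"
      unfolding nn_integral_shift_interval[OF \<psi>l] by (rule nn_integral_completion)
    finally show "ennreal (norm (u x)) \<le> (\<integral>\<^sup>+t. indicator {0..L} t * ennreal (\<psi> (x + t)) \<partial>lborel)" .
  next
    fix t :: real
    have "Lp_norm p (\<lambda>x. \<psi> (x + t)) = Lp_norm p \<psi>"
      by (rule Lp_norm_translate[OF \<psi>l])
    also have "\<dots> = Lp_norm p \<phi>"
    proof (rule Lp_norm_cong_AE)
      show "AE x in lebesgue. norm (\<psi> x) = norm (\<phi> x)" using ae by eventually_elim simp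
    qed (use \<open>1 \<le> p\<close> in simp)
    finally show "Lp_norm p (\<lambda>x. \<psi> (x + t)) \<le> Lp_norm p \<phi>" by simp
  qed fact+
qed

section \<open>Differences and Steklov means of Sobolev functions\<close>

text \<open>
Here \<open>G k\<close> is the \<open>k\<close>-th derivative of \<open>G 0\<close>. One difference of the whole chain is again a chain of
derivatives, and it costs one factor \<open>h\<close> by the mean value inequality.
\<close>

lemma norm_forward_diff_le_deriv:
  fixes G :: "nat \<Rightarrow> real \<Rightarrow> 'a::real_normed_vector"
  assumes "\<And>k y. k < n \<Longrightarrow> (G k has_vector_derivative G (Suc k) y) (at y)"
    and "0 \<le> h" and "\<And>y. y \<in> {x..x + real n * h} \<Longrightarrow> norm (G n y) \<le> B"
  shows "norm (forward_diff n h (G 0) x) \<le> h ^ n * B"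
  using assms(1,3)
proof (induction n arbitrary: G x B)
  case (Suc n)
  define H where "H = (\<lambda>k. forward_diff 1 h (G k))"
  have H: "H k y = G k (y + h) - G k y" for k y
    using forward_diff_Suc[of 0 h "G k" y] by (simp add: H_def)
  have "norm (forward_diff n h (H 0) x) \<le> h ^ n * (h * B)"
  proof (rule Suc.IH)
    fix k y assume "k < n"
    then have d: "(G k has_vector_derivative G (Suc k) y) (at y)" for y using Suc.prems(1) by auto
    have "((G k \<circ> (\<lambda>y. y + h)) has_vector_derivative (1 *\<^sub>R G (Suc k) (y + h))) (at y)"
      by (rule vector_diff_chain_at) (use d in \<open>auto intro!: derivative_eq_intros\<close>)
    then show "(H k has_vector_derivative H (Suc k) y) (at y)"
      unfolding H[abs_def] using d by (auto simp: o_def intro!: has_vector_derivative_diff)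
  next
    fix y assume y: "y \<in> {x..x + real n * h}"
    have "norm (G n (y + h) - G n y) \<le> B * norm ((y + h) - y)"
    proof (rule differentiable_bound[of "{y..y + h}"])
      fix z assume z: "z \<in> {y..y + h}"
      show "(G n has_derivative (\<lambda>t. t *\<^sub>R G (Suc n) z)) (at z within {y..y + h})"
        using Suc.prems(1)[of n z] unfolding has_vector_derivative_def by (auto intro: has_derivative_at_withinI)
      have "norm (G (Suc n) z) \<le> B" using y z \<open>0 \<le> h\<close> by (intro Suc.prems(2)) (auto simp: algebra_simps)
      then show "onorm (\<lambda>t. t *\<^sub>R G (Suc n) z) \<le> B"
        by (simp add: onorm_scaleR_left onorm_id bounded_linear_ident)
    qed (use \<open>0 \<le> h\<close> in auto)
    then show "norm (H n y) \<le> h * B" using \<open>0 \<le> h\<close> by (simp add: H mult.commute)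
  qed
  moreover have "forward_diff (Suc n) h (G 0) x = forward_diff n h (H 0) x"
    using forward_diff_add[of n 1 h "G 0" x] by (simp add: H_def)
  ultimately show ?case by (simp add: mult_ac)
qed simp

lemma locally_abs_continuous_imp_continuous:
  assumes "locally_abs_continuous g"
  shows "continuous_on UNIV g"
proof -
  have "\<exists>d>0. \<forall>y. dist y x < d \<longrightarrow> dist (g y) (g x) < e" if e: "0 < e" for x e
  proof -
    have "abs_continuous_on_interval (x - 1) (x + 1) g" using assms by (simp add: locally_abs_continuous_def)
    then obtain \<delta> where \<delta>: "0 < \<delta>"
      "\<And>Q. finite Q \<Longrightarrow> (\<And>u v. (u, v) \<in> Q \<Longrightarrow> x - 1 \<le> u \<and> u < v \<and> v \<le> x + 1) \<Longrightarrow>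
         nonoverlapping Q \<Longrightarrow>
         total_length Q < \<delta> \<Longrightarrow> variation_over g Q < e"
      using abs_continuous_finite[OF _ e] by blast
    have "dist (g y) (g x) < e" if "dist y x < min \<delta> 1" for y
    proof -
      consider "y = x" | "y < x" | "x < y" by linarith
      then show ?thesis
      proof cases
        case 2
        then show ?thesis using \<delta>(2)[of "{(y, x)}"] that by (simp add: dist_real_def dist_norm norm_minus_commute)
      next
        case 3
        then show ?thesis using \<delta>(2)[of "{(x, y)}"] that by (simp add: dist_real_def dist_norm)
      qed (use \<open>0 < e\<close> in simp)
    qed
    then show ?thesis using \<delta>(1) by (intro exI[of _ "min \<delta> 1"]) auto
  qed
  then show ?thesis unfolding continuous_on_iff by auto
qed

lemma Sobolev_lbm:
  fixes g :: "real \<Rightarrow> 'a::euclidean_space"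
  assumes "g \<in> Sobolev s p" "1 \<le> s"
  shows "locally_bounded_measurable g"
proof -
  have "locally_abs_continuous (nth_deriv 0 g)" using assms unfolding Sobolev_def by (metis (no_types, lifting) less_eq_Suc_le mem_Collect_eq One_nat_def)
  then show ?thesis by (simp add: lbm_continuous locally_abs_continuous_imp_continuous)
qed

text \<open>
Only \<open>s - 1\<close> differences are traded for everywhere existing derivatives. The remaining difference of the
derivative of order \<open>s - 1\<close> is bounded by \<open>abs_continuous_norm_increment_le\<close>, over an interval that
stays inside the window \<open>[x, x + s h]\<close>.
\<close>

lemma norm_forward_diff_le_Sobolev:
  fixes g :: "real \<Rightarrow> 'a::euclidean_space"
  assumes g: "g \<in> Sobolev s p" and "1 \<le> s" "0 \<le> h"
  shows "ennreal (norm (forward_diff s h g x)) \<le> ennreal (h ^ (s - 1)) *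
     window_integral x (x + real s * h) (\<lambda>t. norm (nth_deriv s g t))" (is "_ \<le> _ * ?I")
proof (cases "h = 0 \<or> ?I = \<infinity>")
  case True
  then show ?thesis
  proof
    assume "h = 0"
    then show ?thesis using forward_diff_zero_step[of s g x] \<open>1 \<le> s\<close> by simp
  next
    assume I: "?I = \<infinity>"
    show ?thesis
    proof (cases "h = 0")
      case True
      then show ?thesis using forward_diff_zero_step[of s g x] \<open>1 \<le> s\<close> by simp
    next
      case False
      then show ?thesis using I \<open>0 \<le> h\<close> by (simp add: ennreal_mult_top)
    qed
  qed
next
  case False
  then have "h > 0" using assms by auto
  obtain B where B: "?I = ennreal B" "0 \<le> B" using False by (cases ?I) auto
  obtain n where n: "s = Suc n" using \<open>1 \<le> s\<close> by (cases s) auto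
  have meas: "nth_deriv s g \<in> borel_measurable lebesgue" using g by (auto simp: Sobolev_def Lp_space_def)
  define G where "G = (\<lambda>k. forward_diff 1 h (nth_deriv k g))"
  have G: "G k y = nth_deriv k g (y + h) - nth_deriv k g y" for k y
    using forward_diff_Suc[of 0 h "nth_deriv k g" y] by (simp add: G_def)
  have "norm (forward_diff n h (G 0) x) \<le> h ^ n * B"
  proof (rule norm_forward_diff_le_deriv[OF _ assms(3)])
    fix k y assume "k < n"
    then have "nth_deriv k g differentiable (at y)" for y using g n by (auto simp: Sobolev_def)
    then have d: "(nth_deriv k g has_vector_derivative nth_deriv (Suc k) g y) (at y)" for y
      unfolding nth_deriv_Suc vector_derivative_works[symmetric] .
    have "((nth_deriv k g \<circ> (\<lambda>y. y + h)) has_vector_derivative (1 *\<^sub>R nth_deriv (Suc k) g (y + h))) (at y)"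
      by (rule vector_diff_chain_at) (use d in \<open>auto intro!: derivative_eq_intros\<close>)
    then show "(G k has_vector_derivative G (Suc k) y) (at y)"
      unfolding G[abs_def] using d by (auto simp: o_def intro!: has_vector_derivative_diff)
  next
    fix y assume y: "y \<in> {x..x + real n * h}"
    have ac: "abs_continuous_on_interval y (y + h) (nth_deriv n g)"
      using g n by (auto simp: Sobolev_def locally_abs_continuous_def)
    have "ennreal (norm (nth_deriv n g (y + h) - nth_deriv n g y)) \<le>
      window_integral y (y + h) (\<lambda>t. norm (nth_deriv s g t))"
      using abs_continuous_norm_increment_le[OF ac] meas \<open>0 \<le> h\<close> by (simp add: n nth_deriv_Suc)
    also have "\<dots> \<le> ?I"
      using y n by (intro nn_integral_mono mult_right_mono) (auto simp: indicator_def algebra_simps)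
    finally show "norm (G n y) \<le> B" using B by (simp add: G)
  qed
  moreover have "forward_diff s h g x = forward_diff n h (G 0) x"
    using forward_diff_add[of n 1 h g x] by (simp add: G_def n)
  ultimately have "norm (forward_diff s h g x) \<le> h ^ (s - 1) * B" by (simp add: n)
  then show ?thesis unfolding B(1) using B(2) \<open>0 \<le> h\<close> by (simp flip: ennreal_mult add: ennreal_leI)
qed

lemma modulus_smoothness_Sobolev_le:
  fixes g :: "real \<Rightarrow> 'a::euclidean_space"
  assumes g: "g \<in> Sobolev s p" and "1 \<le> s" "1 \<le> p" and h: "0 < h" "h \<le> \<delta>"
  shows "Lp_norm p (forward_diff s h g) \<le> ennreal (real s * \<delta> ^ s) * Lp_norm p (nth_deriv s g)"
proof -
  have meas: "nth_deriv s g \<in> borel_measurable lebesgue" using g by (auto simp: Sobolev_def Lp_space_def)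
  have "Lp_norm p (forward_diff s h g) \<le> ennreal (real s * h) * Lp_norm p (\<lambda>t. h ^ (s - 1) * norm (nth_deriv s g t))"
  proof (rule Lp_norm_window_integral_le)
    show "(\<lambda>t. h ^ (s - 1) * norm (nth_deriv s g t)) \<in> borel_measurable lebesgue" using meas by measurable
    show "ennreal (norm (forward_diff s h g x)) \<le>
      window_integral x (x + real s * h) (\<lambda>t. h ^ (s - 1) * norm (nth_deriv s g t))" for x
      using norm_forward_diff_le_Sobolev[OF g \<open>1 \<le> s\<close>, of h x] window_integral_cmult[OF meas, of "h ^ (s - 1)"] h
      by simp
  qed (use h assms in auto)
  also have "Lp_norm p (\<lambda>t. h ^ (s - 1) * norm (nth_deriv s g t)) = ennreal \<bar>h ^ (s - 1)\<bar> * Lp_norm p (nth_deriv s g)"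
    using meas \<open>1 \<le> p\<close> by (intro Lp_norm_cmult) (auto simp: abs_mult)
  also have "ennreal (real s * h) * (ennreal \<bar>h ^ (s - 1)\<bar> * Lp_norm p (nth_deriv s g)) = ennreal (real s * h ^ s) * Lp_norm p (nth_deriv s g)"
  proof -
    have "ennreal (real s * h) * ennreal \<bar>h ^ (s - 1)\<bar> = ennreal (real s * h * h ^ (s - 1))"
      using h by (simp flip: ennreal_mult)
    also have "real s * h * h ^ (s - 1) = real s * h ^ s" using \<open>1 \<le> s\<close> by (cases s) auto
    finally show ?thesis by (simp only: mult.assoc[symmetric])
  qed
  also have "\<dots> \<le> ennreal (real s * \<delta> ^ s) * Lp_norm p (nth_deriv s g)"
    using h by (intro mult_right_mono ennreal_leI mult_left_mono power_mono) auto
  finally show ?thesis .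
qed

lemma norm_set_integral_le_const:
  fixes f :: "real \<Rightarrow> 'a::euclidean_space"
  assumes "\<And>t. t \<in> {0..\<delta>} \<Longrightarrow> norm (f t) \<le> M" "0 \<le> \<delta>"
  shows "norm (LINT t:{0..\<delta>}|lebesgue. f t) \<le> \<delta> * M"
proof -
  have "0 \<le> M" using assms(1)[of 0] assms(2) norm_ge_zero[of "f 0"] by (smt (verit) atLeastAtMost_iff)
  have "ennreal (norm (LINT t:{0..\<delta>}|lebesgue. f t)) \<le> window_integral 0 \<delta> (\<lambda>t. norm (f t))"
    by (rule norm_set_integral_le_nn_integral)
  also have "\<dots> \<le> (\<integral>\<^sup>+t. ennreal M * indicator {0..\<delta>} t \<partial>lebesgue)"
    using assms by (intro nn_integral_mono) (auto simp: indicator_def intro: ennreal_leI)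
  also have "\<dots> = ennreal (\<delta> * M)"
    using assms \<open>0 \<le> M\<close> by (subst nn_integral_cmult_indicator) (auto simp: mult.commute simp flip: ennreal_mult)
  finally show ?thesis using assms \<open>0 \<le> M\<close> by simp
qed

lemma norm_iterated_integral_le:
  fixes F :: "real list \<Rightarrow> 'a::euclidean_space"
  assumes "\<And>ts. length ts = n \<Longrightarrow> set ts \<subseteq> {0..\<delta>} \<Longrightarrow> norm (F ts) \<le> M" "0 \<le> \<delta>"
  shows "norm (iterated_integral n \<delta> F) \<le> \<delta> ^ n * M"
  using assms(1)
proof (induction n arbitrary: F)
  case (Suc n)
  have "norm (LINT t:{0..\<delta>}|lebesgue. iterated_integral n \<delta> (\<lambda>ts. F (t # ts))) \<le> \<delta> * (\<delta> ^ n * M)"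
    using \<open>0 \<le> \<delta>\<close> by (intro norm_set_integral_le_const Suc.IH Suc.prems) auto
  then show ?case by (simp add: mult_ac)
qed simp

lemma sum_list_bounds:
  fixes ts :: "real list"
  assumes "set ts \<subseteq> {0..\<delta>}"
  shows "0 \<le> sum_list ts" "sum_list ts \<le> real (length ts) * \<delta>"
  using assms by (induction ts) (auto simp: algebra_simps)

text \<open>
By \<open>steklov_minus_eq\<close> it suffices to bound differences of order \<open>r\<close> with steps \<open>h \<le> \<delta>\<close>. Each is a
difference of order \<open>r - s\<close>, which costs at most \<open>2\<^sup>r\<close>, of a difference of order \<open>s\<close>.
\<close>

lemma steklov_minus_Sobolev_le:
  fixes g :: "real \<Rightarrow> 'a::euclidean_space"
  assumes g: "g \<in> Sobolev s p" and "1 \<le> s" "s \<le> r" "0 < \<delta>"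
  shows "ennreal (norm (steklov r \<delta> g x - g x)) \<le> ennreal (2 ^ r * \<delta> ^ (s - 1)) *
     window_integral x (x + real r * \<delta>) (\<lambda>t. norm (nth_deriv s g t))" (is "_ \<le> _ * ?I")
proof (cases "?I = \<infinity>")
  case True
  then show ?thesis using \<open>0 < \<delta>\<close> by (simp add: ennreal_mult_top)
next
  case False
  then obtain B where B: "?I = ennreal B" "0 \<le> B" by (cases ?I) auto
  define M where "M = 2 ^ r * (\<delta> ^ (s - 1) * B)"
  have "norm (iterated_integral r \<delta> (\<lambda>ts. forward_diff r (sum_list ts / real r) g x)) \<le> \<delta> ^ r * M"
  proof (rule norm_iterated_integral_le)
    fix ts :: "real list" assume ts: "length ts = r" "set ts \<subseteq> {0..\<delta>}"
    define h where "h = sum_list ts / real r"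
    have "r > 0" using assms by auto
    have h: "0 \<le> h" "h \<le> \<delta>"
      using sum_list_bounds[OF ts(2)] \<open>r > 0\<close> by (auto simp: h_def ts(1) field_simps)
    have "norm (forward_diff (r - s) h (forward_diff s h g) x) \<le> 2 ^ (r - s) * (\<delta> ^ (s - 1) * B)"
    proof (rule norm_forward_diff_le[OF _ h(1)])
      fix y assume y: "y \<in> {x..x + real (r - s) * h}"
      have "real (r - s) * h + real s * h = real r * h"
        using \<open>s \<le> r\<close> by (simp add: of_nat_diff algebra_simps)
      moreover have "real r * h \<le> real r * \<delta>" using h by (simp add: mult_left_mono)
      ultimately have sub: "y + real s * h \<le> x + real r * \<delta>" using y by auto
      have "ennreal (norm (forward_diff s h g y)) \<le> ennreal (h ^ (s - 1)) *
         window_integral y (y + real s * h) (\<lambda>t. norm (nth_deriv s g t))"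
        by (rule norm_forward_diff_le_Sobolev[OF g \<open>1 \<le> s\<close> h(1)])
      also have "\<dots> \<le> ennreal (\<delta> ^ (s - 1)) * ?I"
        using y sub h by (intro mult_mono ennreal_leI power_mono nn_integral_mono) (auto simp: indicator_def)
      also have "\<dots> = ennreal (\<delta> ^ (s - 1) * B)" unfolding B(1) using B(2) \<open>0 < \<delta>\<close> by (simp add: ennreal_mult)
      finally show "norm (forward_diff s h g y) \<le> \<delta> ^ (s - 1) * B"
        using B(2) \<open>0 < \<delta>\<close> by (subst (asm) ennreal_le_iff) auto
    qed
    also have "\<dots> \<le> M" unfolding M_def using B(2) \<open>0 < \<delta>\<close> by (intro mult_right_mono power_increasing) auto
    also have "forward_diff (r - s) h (forward_diff s h g) x = forward_diff r h g x"
      using forward_diff_add[of "r - s" s h g x] \<open>s \<le> r\<close> by simp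
    finally show "norm (forward_diff r (sum_list ts / real r) g x) \<le> M" by (simp add: h_def)
  qed (use assms in auto)
  then have "norm (steklov r \<delta> g x - g x) \<le> (1 / \<delta> ^ r) * (\<delta> ^ r * M)"
    unfolding steklov_minus_eq[OF Sobolev_lbm[OF g \<open>1 \<le> s\<close>] \<open>0 < \<delta>\<close>]
    using \<open>0 < \<delta>\<close> by (simp add: power_abs divide_le_eq mult.commute)
  also have "\<dots> = M" using \<open>0 < \<delta>\<close> by simp
  finally have "ennreal (norm (steklov r \<delta> g x - g x)) \<le> ennreal M" by (rule ennreal_leI)
  also have "M = 2 ^ r * \<delta> ^ (s - 1) * B" by (simp add: M_def)
  also have "ennreal (2 ^ r * \<delta> ^ (s - 1) * B) = ennreal (2 ^ r * \<delta> ^ (s - 1)) * ennreal B"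
    using B(2) \<open>0 < \<delta>\<close> by (intro ennreal_mult) auto
  finally show ?thesis by (simp only: B(1))
qed

text \<open>
The innermost average is an integral over a window of length \<open>c \<delta>\<close>, and each further average
enlarges the window by \<open>c \<delta>\<close> and costs a factor \<open>\<delta>\<close>.
\<close>

lemma smear_funpow_le_window:
  fixes f :: "real \<Rightarrow> 'a::euclidean_space"
  assumes f: "f \<in> borel_measurable lebesgue" and "0 < c" "0 < \<delta>"
  shows "ennreal (norm ((smear c \<delta> ^^ Suc n) f y)) \<le> ennreal (\<delta> ^ n / c) *
     window_integral y (y + real (Suc n) * (c * \<delta>)) (\<lambda>t. norm (f t))"
proof (induction n arbitrary: y)
  case 0
  have m: "(\<lambda>t. indicator {y..y + c * \<delta>} t * ennreal (norm (f t))) \<in> borel_measurable lebesgue"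
    using f by (intro measurable_window_integrand) auto
  have "ennreal (norm (smear c \<delta> f y)) \<le> window_integral 0 \<delta> (\<lambda>t. norm (f (y + c * t)))"
    unfolding smear_def by (rule norm_set_integral_le_nn_integral)
  also have "\<dots> = (\<integral>\<^sup>+t. indicator {y..y + c * \<delta>} (y + c * t) * ennreal (norm (f (y + c * t))) \<partial>lebesgue)"
    using \<open>0 < c\<close> by (intro nn_integral_cong) (auto simp: indicator_def zero_le_mult_iff)
  also have "\<dots> = ennreal (1 / c) * (ennreal c * (\<integral>\<^sup>+t. indicator {y..y + c * \<delta>} (y + c * t) * ennreal (norm (f (y + c * t))) \<partial>lebesgue))"
    using \<open>0 < c\<close> by (simp add: mult.assoc[symmetric] flip: ennreal_mult)
  also have "ennreal c * (\<integral>\<^sup>+t. indicator {y..y + c * \<delta>} (y + c * t) * ennreal (norm (f (y + c * t))) \<partial>lebesgue) =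
      window_integral y (y + c * \<delta>) (\<lambda>t. norm (f t))"
    using nn_integral_real_affine_lebesgue[OF m, of c y] \<open>0 < c\<close> by simp
  finally show ?case by simp
next
  case (Suc n)
  define J where "J = window_integral y (y + real (Suc (Suc n)) * (c * \<delta>)) (\<lambda>t. norm (f t))"
  have "ennreal (norm (smear c \<delta> ((smear c \<delta> ^^ Suc n) f) y)) \<le>
     window_integral 0 \<delta> (\<lambda>t. norm ((smear c \<delta> ^^ Suc n) f (y + c * t)))"
    unfolding smear_def[of c \<delta> "(smear c \<delta> ^^ Suc n) f"] by (rule norm_set_integral_le_nn_integral)
  also have "\<dots> \<le> (\<integral>\<^sup>+t. (ennreal (\<delta> ^ n / c) * J) * indicator {0..\<delta>} t \<partial>lebesgue)"
  proof (rule nn_integral_mono)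
    fix t
    have "ennreal (norm ((smear c \<delta> ^^ Suc n) f (y + c * t))) \<le> ennreal (\<delta> ^ n / c) * J" if "t \<in> {0..\<delta>}"
    proof -
      have ct: "0 \<le> c * t" "c * t \<le> c * \<delta>" using that assms by auto
      note Suc.IH[of "y + c * t"]
      also have "ennreal (\<delta> ^ n / c) * window_integral (y + c * t) (y + c * t + real (Suc n) * (c * \<delta>)) (\<lambda>z. norm (f z))
        \<le> ennreal (\<delta> ^ n / c) * J"
        unfolding J_def using ct
        by (intro mult_left_mono nn_integral_mono mult_right_mono) (auto simp: indicator_def algebra_simps)
      finally show ?thesis .
    qed
    then show "indicator {0..\<delta>} t * ennreal (norm ((smear c \<delta> ^^ Suc n) f (y + c * t))) \<le> (ennreal (\<delta> ^ n / c) * J) * indicator {0..\<delta>} t"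
      by (auto simp: indicator_def)
  qed
  also have "\<dots> = (ennreal (\<delta> ^ n / c) * J) * ennreal \<delta>"
    using assms by (subst nn_integral_cmult_indicator) auto
  also have "\<dots> = ennreal (\<delta> ^ Suc n / c) * J"
  proof -
    have "ennreal (\<delta> ^ Suc n / c) = ennreal (\<delta> ^ n / c) * ennreal \<delta>"
      using assms by (simp flip: ennreal_mult add: mult.commute)
    then show ?thesis by (simp only: mult_ac)
  qed
  finally show ?case by (simp only: funpow.simps o_apply J_def)
qed

text \<open>
Since \<open>1 / c = r / m \<le> r\<close> and \<open>c \<le> 1\<close>, every summand is controlled by the same window of length \<open>r \<delta>\<close>.
\<close>

lemma steklov_le_window:
  fixes f :: "real \<Rightarrow> 'a::euclidean_space"
  assumes f: "locally_bounded_measurable f" and "1 \<le> r" "0 < \<delta>"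
  shows "ennreal (norm (steklov r \<delta> f x)) \<le> ennreal (2 ^ r * real r / \<delta>) *
     window_integral x (x + real r * \<delta>) (\<lambda>t. norm (f t))" (is "_ \<le> _ * ?I")
proof -
  have summand: "ennreal (norm (steklov_weight r \<delta> m *\<^sub>R (smear (real m / real r) \<delta> ^^ r) f x)) \<le>
    ennreal (real (r choose m) * (real r / \<delta>)) * ?I" if m: "m \<in> {1..r}" for m
  proof -
    obtain n where n: "r = Suc n" using \<open>1 \<le> r\<close> by (cases r) auto
    define c where "c = real m / real r"
    have c: "0 < c" "c \<le> 1" "1 / c \<le> real r" using m by (auto simp: c_def field_simps)
    have "ennreal (norm ((smear c \<delta> ^^ r) f x)) \<le> ennreal (\<delta> ^ n / c) *
       window_integral x (x + real r * (c * \<delta>)) (\<lambda>t. norm (f t))"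
      using smear_funpow_le_window[OF lbm_measurable[OF f] c(1) \<open>0 < \<delta>\<close>, of n x] by (simp only: n)
    also have "\<dots> \<le> ennreal (\<delta> ^ n * real r) * ?I"
    proof (intro mult_mono ennreal_leI nn_integral_mono mult_right_mono)
      show "\<delta> ^ n / c \<le> \<delta> ^ n * real r" using mult_left_mono[OF c(3), of "\<delta> ^ n"] \<open>0 < \<delta>\<close> by simp
      have "real r * (c * \<delta>) \<le> real r * \<delta>" using c \<open>0 < \<delta>\<close> by (intro mult_left_mono) auto
      then show "indicator {x..x + real r * (c * \<delta>)} t \<le> (indicator {x..x + real r * \<delta>} t :: ennreal)" for t
        by (auto simp: indicator_def)
    qed auto
    finally have *: "ennreal (norm ((smear c \<delta> ^^ r) f x)) \<le> ennreal (\<delta> ^ n * real r) * ?I" .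
    have "ennreal (norm (steklov_weight r \<delta> m *\<^sub>R (smear c \<delta> ^^ r) f x)) =
      ennreal (real (r choose m) / \<delta> ^ r) * ennreal (norm ((smear c \<delta> ^^ r) f x))"
      unfolding norm_scaleR abs_steklov_weight[OF \<open>0 < \<delta>\<close>]
      using \<open>0 < \<delta>\<close> by (intro ennreal_mult) auto
    also have "\<dots> \<le> ennreal (real (r choose m) / \<delta> ^ r) * (ennreal (\<delta> ^ n * real r) * ?I)"
      by (intro mult_left_mono *) simp
    also have "\<dots> = ennreal (real (r choose m) / \<delta> ^ r * (\<delta> ^ n * real r)) * ?I"
      using \<open>0 < \<delta>\<close> by (intro ennreal_mult_mult) auto
    also have "real (r choose m) / \<delta> ^ r * (\<delta> ^ n * real r) = real (r choose m) * (real r / \<delta>)"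
      using \<open>0 < \<delta>\<close> by (simp add: n field_simps)
    finally show ?thesis by (simp only: c_def)
  qed
  have "ennreal (norm (steklov r \<delta> f x)) \<le> ennreal (\<Sum>m=1..r. norm (steklov_weight r \<delta> m *\<^sub>R (smear (real m / real r) \<delta> ^^ r) f x))"
    unfolding steklov_eq_smear[OF f \<open>0 < \<delta>\<close>] by (intro ennreal_leI norm_sum)
  also have "\<dots> = (\<Sum>m=1..r. ennreal (norm (steklov_weight r \<delta> m *\<^sub>R (smear (real m / real r) \<delta> ^^ r) f x)))"
    by (rule sum_ennreal[symmetric]) simp
  also have "\<dots> \<le> (\<Sum>m=1..r. ennreal (real (r choose m) * (real r / \<delta>)) * ?I)"
    by (intro sum_mono summand)
  also have "\<dots> = ennreal (\<Sum>m=1..r. real (r choose m) * (real r / \<delta>)) * ?I"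
    using \<open>0 < \<delta>\<close> by (subst sum_distrib_right[symmetric], subst sum_ennreal) auto
  also have "\<dots> \<le> ennreal (2 ^ r * real r / \<delta>) * ?I"
  proof (intro mult_right_mono ennreal_leI)
    have "(\<Sum>m=1..r. real (r choose m)) * (real r / \<delta>) \<le> 2 ^ r * (real r / \<delta>)"
      using \<open>0 < \<delta>\<close> by (intro mult_right_mono sum_choose_le) auto
    then show "(\<Sum>m=1..r. real (r choose m) * (real r / \<delta>)) \<le> 2 ^ r * real r / \<delta>"
      unfolding sum_distrib_right by simp
  qed simp
  finally show ?thesis .
qed


section \<open>The modulus is dominated by the K-functional\<close>

lemma Lp_norm_forward_diff_le:
  fixes f :: "real \<Rightarrow> 'a::euclidean_space"
  assumes f: "f \<in> borel_measurable lebesgue" and "1 \<le> p"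
  shows "Lp_norm p (forward_diff n h f) \<le> ennreal (2 ^ Suc n * 2 ^ n) * Lp_norm p f"
proof -
  define w where "w = (\<lambda>k. real (n choose k) * (-1) ^ (n - k))"
  have tr: "(\<lambda>x. f (x + a)) \<in> borel_measurable lebesgue" for a
    using measurable_affine_lebesgue[OF f, of 1 a] by (simp add: add.commute)
  have "Lp_norm p (\<lambda>x. \<Sum>k=0..n. w k *\<^sub>R f (x + real k * h)) \<le>
      ennreal (2 ^ card {0..n} * (\<Sum>k=0..n. real (n choose k))) * Lp_norm p f"
  proof (rule Lp_norm_sum_le)
    fix k
    show "(\<lambda>x. w k *\<^sub>R f (x + real k * h)) \<in> borel_measurable lebesgue"
      using tr by (intro borel_measurable_scaleR) auto
    have "Lp_norm p (\<lambda>x. w k *\<^sub>R f (x + real k * h)) = ennreal \<bar>w k\<bar> * Lp_norm p (\<lambda>x. f (x + real k * h))"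
      using \<open>1 \<le> p\<close> tr by (intro Lp_norm_cmult) auto
    then show "Lp_norm p (\<lambda>x. w k *\<^sub>R f (x + real k * h)) \<le> ennreal (real (n choose k)) * Lp_norm p f"
      by (simp add: Lp_norm_translate[OF f] w_def abs_mult power_abs)
  qed (use assms in auto)
  also have "(\<Sum>k=0..n. real (n choose k)) = 2 ^ n"
    using choose_row_sum[of n] by (metis atLeast0AtMost of_nat_numeral of_nat_power of_nat_sum)
  also have "(\<lambda>x. \<Sum>k=0..n. w k *\<^sub>R f (x + real k * h)) = forward_diff n h f"
    by (simp add: forward_diff_def w_def fun_eq_iff)
  finally show ?thesis by simp
qed

lemma weighted_sum_le_ennreal:
  fixes A B D :: ennreal and a b d :: real
  assumes "0 \<le> a" "0 \<le> b" "0 \<le> d"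
  shows "ennreal a * A + ennreal b * B + ennreal d * D \<le> ennreal (a + b + d) * (A + B + D)"
proof -
  have "ennreal a * A + ennreal b * B + ennreal d * D \<le>
      ennreal (a + b + d) * A + ennreal (a + b + d) * B + ennreal (a + b + d) * D"
    using assms by (intro add_mono mult_right_mono ennreal_leI) auto
  then show ?thesis by (simp add: distrib_left)
qed

text \<open>
With \<open>h = f - g\<close>, estimate \<open>steklov r \<delta> h\<close> and \<open>steklov r \<delta> g - g\<close> at the nodes by the sampling
inequality, and the differences of \<open>h\<close> and \<open>g\<close> in the continuous norm. The three groups in
the constant belong to the three parts of the K-functional; their factors \<open>2\<close> and \<open>4\<close> come from
one and two applications of the quasi-triangle inequality.
\<close>

lemma semidiscrete_modulus_le_approximant:
  fixes f g :: "real \<Rightarrow> 'a::euclidean_space"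
  assumes rs: "1 \<le> s" "s \<le> r" and p: "1 \<le> p" and W: "0 < W"
    and f: "locally_bounded_measurable f" and g: "g \<in> Sobolev s p"
  shows "semidiscrete_modulus r s p f W \<le>
    ennreal (4 + (2 * (real r + 1) * real r * 2 ^ r + 4 * 2 ^ s * 2 ^ s) + (4 * (real r + 1) * 2 ^ r + 2 * real s)) *
    (lp_norm p (uniform_nodes W) (\<lambda>x. f x - g x) + Lp_norm p (\<lambda>x. f x - g x) + ennreal (1 / W ^ s) * Lp_norm p (nth_deriv s g))"
proof -
  define \<delta> where "\<delta> = 1 / W"
  have \<delta>: "0 < \<delta>" using W by (simp add: \<delta>_def)
  have r: "1 \<le> r" using rs by simp
  have lg: "locally_bounded_measurable g" using Sobolev_lbm[OF g rs(1)] .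
  define h where "h = (\<lambda>x. f x - g x)"
  have lh: "locally_bounded_measurable h" unfolding h_def by (rule lbm_diff[OF f lg])
  have gm: "nth_deriv s g \<in> borel_measurable lebesgue" using g by (auto simp: Sobolev_def Lp_space_def)
  define A where "A = lp_norm p (uniform_nodes W) h"
  define B where "B = Lp_norm p h"
  define D where "D = ennreal (1 / W ^ s) * Lp_norm p (nth_deriv s g)"
  have \<delta>s: "1 / W ^ s = \<delta> ^ s" by (simp add: \<delta>_def power_one_over)
  have win: "(real r + 1) / W = (real r + 1) * \<delta>" "real r / W = real r * \<delta>" by (simp_all add: \<delta>_def)

  have 1: "lp_norm p (uniform_nodes W) (steklov r \<delta> h) \<le> ennreal ((real r + 1) * real r * 2 ^ r) * B"
  proof -
    have "lp_norm p (uniform_nodes W) (steklov r \<delta> h) \<le> ennreal ((real r + 1) / W * (2 ^ r * real r / \<delta>)) * B"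
      unfolding B_def using steklov_le_window[OF lh r \<delta>] \<delta>
      by (intro lp_norm_uniform_cmult_le lbm_measurable lh W p r) (auto simp: win)
    also have "(real r + 1) / W * (2 ^ r * real r / \<delta>) = (real r + 1) * real r * 2 ^ r"
      using \<delta> by (simp add: win)
    finally show ?thesis .
  qed

  have 2: "lp_norm p (uniform_nodes W) (\<lambda>x. steklov r \<delta> g x - g x) \<le> ennreal ((real r + 1) * 2 ^ r) * D"
  proof -
    have "lp_norm p (uniform_nodes W) (\<lambda>x. steklov r \<delta> g x - g x) \<le>
        ennreal ((real r + 1) / W * (2 ^ r * \<delta> ^ (s - 1))) * Lp_norm p (nth_deriv s g)"
      using steklov_minus_Sobolev_le[OF g rs \<delta>] \<delta>
      by (intro lp_norm_uniform_cmult_le gm W p r) (auto simp: win)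
    also have "(real r + 1) / W * (2 ^ r * \<delta> ^ (s - 1)) = (real r + 1) * 2 ^ r * \<delta> ^ s"
    proof -
      have "\<delta> * \<delta> ^ (s - 1) = \<delta> ^ s" using rs by (cases s) auto
      then show ?thesis by (simp add: win mult_ac)
    qed
    also have "ennreal ((real r + 1) * 2 ^ r * \<delta> ^ s) * Lp_norm p (nth_deriv s g) = ennreal ((real r + 1) * 2 ^ r) * D"
      unfolding D_def \<delta>s using \<delta> by (intro ennreal_mult_mult[symmetric]) auto
    finally show ?thesis .
  qed

  have 3: "lp_norm p (uniform_nodes W) (\<lambda>x. steklov r \<delta> f x - f x) \<le>
      2 * (lp_norm p (uniform_nodes W) (steklov r \<delta> h) + lp_norm p (uniform_nodes W) (\<lambda>x. (steklov r \<delta> g x - g x) - h x))"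
  proof (rule lp_norm_quasi_add[where x = "uniform_nodes W", OF p uniform_nodes_mono[OF W]])
    fix j
    have "steklov r \<delta> f x - f x = steklov r \<delta> h x + ((steklov r \<delta> g x - g x) - h x)" for x
      unfolding h_def by (subst steklov_diff[OF f lg \<delta>]) simp
    then show "norm (steklov r \<delta> f (uniform_nodes W j) - f (uniform_nodes W j)) \<le>
      norm (steklov r \<delta> h (uniform_nodes W j)) + norm ((steklov r \<delta> g (uniform_nodes W j) - g (uniform_nodes W j)) - h (uniform_nodes W j))"
      by (metis norm_triangle_ineq)
  qed
  have 4: "lp_norm p (uniform_nodes W) (\<lambda>x. (steklov r \<delta> g x - g x) - h x) \<le>
      2 * (lp_norm p (uniform_nodes W) (\<lambda>x. steklov r \<delta> g x - g x) + A)"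
    unfolding A_def
    by (rule lp_norm_quasi_add[where x = "uniform_nodes W", OF p uniform_nodes_mono[OF W]]) (rule norm_triangle_ineq4)
  also have "\<dots> \<le> 2 * (ennreal ((real r + 1) * 2 ^ r) * D + A)"
    by (intro mult_left_mono add_mono 2) auto
  finally have 5: "lp_norm p (uniform_nodes W) (\<lambda>x. (steklov r \<delta> g x - g x) - h x) \<le> \<dots>" .
  note 3
  also have "2 * (lp_norm p (uniform_nodes W) (steklov r \<delta> h) + lp_norm p (uniform_nodes W) (\<lambda>x. (steklov r \<delta> g x - g x) - h x)) \<le>
      2 * (ennreal ((real r + 1) * real r * 2 ^ r) * B + 2 * (ennreal ((real r + 1) * 2 ^ r) * D + A))"
    by (rule mult_left_mono[OF add_mono[OF 1 5]]) simp
  also have "\<dots> = ennreal 4 * A + ennreal (2 * ((real r + 1) * real r * 2 ^ r)) * B + ennreal (4 * ((real r + 1) * 2 ^ r)) * D"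
    by (simp add: ennreal_mult distrib_left mult.assoc[symmetric] add_ac)
  finally have lp: "lp_norm p (uniform_nodes W) (\<lambda>x. steklov r \<delta> f x - f x) \<le> \<dots>" .

  have om: "modulus_smoothness s p f \<delta> \<le> ennreal (4 * 2 ^ s * 2 ^ s) * B + ennreal (2 * real s) * D"
    unfolding modulus_smoothness_def
  proof (rule SUP_least)
    fix t assume t: "t \<in> {0<..\<delta>}"
    have "Lp_norm p (forward_diff s t f) \<le> 2 * (Lp_norm p (forward_diff s t h) + Lp_norm p (forward_diff s t g))"
    proof (rule Lp_norm_quasi_add[OF _ _ p])
      show "norm (forward_diff s t f x) \<le> norm (forward_diff s t h x) + norm (forward_diff s t g x)" for x
        unfolding h_def forward_diff_diff by (metis diff_add_cancel norm_triangle_ineq)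
    qed (intro lbm_measurable lbm_forward_diff lh lg)+
    also have "\<dots> \<le> 2 * (ennreal (2 ^ Suc s * 2 ^ s) * B + ennreal (real s * \<delta> ^ s) * Lp_norm p (nth_deriv s g))"
      unfolding B_def using t p rs g lbm_measurable[OF lh]
      by (intro mult_left_mono add_mono Lp_norm_forward_diff_le modulus_smoothness_Sobolev_le) auto
    also have "ennreal (real s * \<delta> ^ s) * Lp_norm p (nth_deriv s g) = ennreal (real s) * D"
      unfolding D_def \<delta>s using \<delta> by (intro ennreal_mult_mult[symmetric]) auto
    also have "2 * (ennreal (2 ^ Suc s * 2 ^ s) * B + ennreal (real s) * D) = ennreal (4 * 2 ^ s * 2 ^ s) * B + ennreal (2 * real s) * D"
    proof -
      have "2 * ennreal (2 ^ Suc s * 2 ^ s) = ennreal (4 * 2 ^ s * 2 ^ s)"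
        using ennreal_mult[of 2 "2 ^ Suc s * 2 ^ s"] by (simp add: mult_ac)
      moreover have "2 * ennreal (real s) = ennreal (2 * real s)" by (simp add: ennreal_mult)
      ultimately show ?thesis by (simp only: distrib_left mult.assoc[symmetric])
    qed
    finally show "Lp_norm p (forward_diff s t f) \<le> \<dots>" .
  qed
  have "semidiscrete_modulus r s p f W \<le>
     (ennreal 4 * A + ennreal (2 * ((real r + 1) * real r * 2 ^ r)) * B + ennreal (4 * ((real r + 1) * 2 ^ r)) * D) +
     (ennreal (4 * 2 ^ s * 2 ^ s) * B + ennreal (2 * real s) * D)"
    unfolding semidiscrete_modulus_def \<delta>_def[symmetric] by (intro add_mono lp om)
  also have "\<dots> = ennreal 4 * A + ennreal (2 * ((real r + 1) * real r * 2 ^ r) + 4 * 2 ^ s * 2 ^ s) * B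
      + ennreal (4 * ((real r + 1) * 2 ^ r) + 2 * real s) * D"
  proof -
    have "ennreal (2 * ((real r + 1) * real r * 2 ^ r) + 4 * 2 ^ s * 2 ^ s) = ennreal (2 * ((real r + 1) * real r * 2 ^ r)) + ennreal (4 * 2 ^ s * 2 ^ s)"
      by (rule ennreal_plus) auto
    moreover have "ennreal (4 * ((real r + 1) * 2 ^ r) + 2 * real s) = ennreal (4 * ((real r + 1) * 2 ^ r)) + ennreal (2 * real s)"
      by (rule ennreal_plus) auto
    ultimately show ?thesis by (simp only: distrib_right add_ac)
  qed
  also have "\<dots> \<le> ennreal (4 + (2 * ((real r + 1) * real r * 2 ^ r) + 4 * 2 ^ s * 2 ^ s) + (4 * ((real r + 1) * 2 ^ r) + 2 * real s)) * (A + B + D)"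
    by (rule weighted_sum_le_ennreal) auto
  finally show ?thesis unfolding A_def B_def D_def h_def by (simp only: mult.assoc)
qed

section \<open>Averages in the continuous norm\<close>

text \<open>
Needed to exchange integrals in \<open>Lp_norm_iterated_integral_le\<close>. The additional parameter \<open>u\<close>
collects the variables that have already been split off.
\<close>

lemma iterated_integral_joint_measurable:
  fixes \<Psi> :: "real \<Rightarrow> real \<Rightarrow> 'a::euclidean_space"
  assumes "(\<lambda>(v, x). \<Psi> v x) \<in> borel_measurable borel"
  shows "(\<lambda>(u, x). iterated_integral n \<delta> (\<lambda>ts. \<Psi> (u + sum_list ts) x)) \<in> borel_measurable borel"
proof (induction n)
  case 0
  then show ?case using assms by simp
next
  case (Suc n)
  define J where "J = (\<lambda>u x. iterated_integral n \<delta> (\<lambda>ts. \<Psi> (u + sum_list ts) x))"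
  have "(\<lambda>(u, x). J u x) = (\<lambda>z. J (fst z) (snd z))" by auto
  then have Jm [measurable]: "(\<lambda>z. J (fst z) (snd z)) \<in> borel_measurable (borel \<Otimes>\<^sub>M borel)"
    using Suc.IH unfolding J_def[symmetric] borel_prod by simp
  have comp: "(\<lambda>t. J (u + t) x) \<in> borel_measurable borel" for u x
    using measurable_compose[of "\<lambda>t. (u + t, x)" borel "borel \<Otimes>\<^sub>M borel" "\<lambda>z. J (fst z) (snd z)" borel] Jm
    by simp
  have "iterated_integral (Suc n) \<delta> (\<lambda>ts. \<Psi> (u + sum_list ts) x) = (LINT t|lborel. indicator {0..\<delta>} t *\<^sub>R J (u + t) x)" for u x
  proof -
    have "iterated_integral (Suc n) \<delta> (\<lambda>ts. \<Psi> (u + sum_list ts) x) = (LINT t|lebesgue. indicator {0..\<delta>} t *\<^sub>R J (u + t) x)"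
      by (simp add: J_def set_lebesgue_integral_def add.assoc)
    also have "\<dots> = (LINT t|lborel. indicator {0..\<delta>} t *\<^sub>R J (u + t) x)"
      using comp by (intro integral_completion) simp
    finally show ?thesis .
  qed
  moreover have "(\<lambda>z. LINT t|lborel. indicator {0..\<delta>} t *\<^sub>R J (fst z + t) (snd z)) \<in> borel_measurable (borel \<Otimes>\<^sub>M borel)"
  proof (rule lborel.borel_measurable_lebesgue_integral)
    have "(\<lambda>q. J (fst (fst q) + snd q) (snd (fst q))) \<in> borel_measurable ((borel \<Otimes>\<^sub>M borel) \<Otimes>\<^sub>M lborel)"
      using measurable_compose[of "\<lambda>q. (fst (fst q) + snd q, snd (fst q))" "(borel \<Otimes>\<^sub>M borel) \<Otimes>\<^sub>M lborel" "borel \<Otimes>\<^sub>M borel" "\<lambda>z. J (fst z) (snd z)" borel] Jm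
      by simp
    then show "(\<lambda>(z, t). indicator {0..\<delta>} t *\<^sub>R J (fst z + t) (snd z)) \<in> borel_measurable ((borel \<Otimes>\<^sub>M borel) \<Otimes>\<^sub>M lborel)"
      unfolding case_prod_beta' by measurable
  qed
  ultimately show ?case by (simp only: case_prod_beta' borel_prod)
qed

text \<open>
Minkowski's integral inequality, one variable at a time.
\<close>

lemma Lp_norm_iterated_integral_le:
  fixes \<Psi> :: "real \<Rightarrow> real \<Rightarrow> 'a::euclidean_space"
  assumes m: "(\<lambda>(v, x). \<Psi> v x) \<in> borel_measurable borel" and "0 < \<delta>" "1 \<le> p"
    and K: "\<And>v. v \<in> {u..u + real n * \<delta>} \<Longrightarrow> Lp_norm p (\<Psi> v) \<le> K"
  shows "Lp_norm p (\<lambda>x. iterated_integral n \<delta> (\<lambda>ts. \<Psi> (u + sum_list ts) x)) \<le> ennreal (\<delta> ^ n) * K"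
  using K
proof (induction n arbitrary: u)
  case (Suc n)
  define J where "J = (\<lambda>u x. iterated_integral n \<delta> (\<lambda>ts. \<Psi> (u + sum_list ts) x))"
  have "(\<lambda>(u, x). J u x) = (\<lambda>z. J (fst z) (snd z))" by auto
  then have Jm [measurable]: "(\<lambda>z. J (fst z) (snd z)) \<in> borel_measurable (borel \<Otimes>\<^sub>M borel)"
    using iterated_integral_joint_measurable[OF m, of n \<delta>] unfolding J_def[symmetric] borel_prod by simp
  have "Lp_norm p (\<lambda>x. iterated_integral (Suc n) \<delta> (\<lambda>ts. \<Psi> (u + sum_list ts) x)) \<le> ennreal \<delta> * (ennreal (\<delta> ^ n) * K)"
  proof (rule Lp_norm_integral_le[where H = "\<lambda>t x. norm (J (u + t) x)"])
    have "(\<lambda>z. J (u + fst z) (snd z)) \<in> borel_measurable (borel \<Otimes>\<^sub>M borel)"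
      using measurable_compose[of "\<lambda>z. (u + fst z, snd z)" "borel \<Otimes>\<^sub>M borel" "borel \<Otimes>\<^sub>M borel" "\<lambda>z. J (fst z) (snd z)" borel] Jm
      by simp
    then show "(\<lambda>(t, x). norm (J (u + t) x)) \<in> borel_measurable borel"
      unfolding case_prod_beta' borel_prod by measurable
    fix x
    have "iterated_integral (Suc n) \<delta> (\<lambda>ts. \<Psi> (u + sum_list ts) x) = (LINT t:{0..\<delta>}|lebesgue. J (u + t) x)"
      by (simp add: J_def add.assoc)
    then show "ennreal (norm (iterated_integral (Suc n) \<delta> (\<lambda>ts. \<Psi> (u + sum_list ts) x))) \<le>
        (\<integral>\<^sup>+t. indicator {0..\<delta>} t * ennreal (norm (J (u + t) x)) \<partial>lborel)"
      using norm_set_integral_le_nn_integral[of 0 \<delta> "\<lambda>t. J (u + t) x"] by (simp add: nn_integral_completion)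
  next
    fix t assume t: "t \<in> {0..\<delta>}"
    have "Lp_norm p (J (u + t)) \<le> ennreal (\<delta> ^ n) * K"
      unfolding J_def using t by (intro Suc.IH Suc.prems) (auto simp: algebra_simps)
    then show "Lp_norm p (\<lambda>x. norm (J (u + t) x)) \<le> ennreal (\<delta> ^ n) * K"
      by (simp add: Lp_norm_def)
  qed (use assms in auto)
  also have "\<dots> = ennreal (\<delta> ^ Suc n) * K" using \<open>0 < \<delta>\<close> by (subst ennreal_mult_mult) auto
  finally show ?case .
next
  case 0
  then show ?case by simp
qed

lemma smear_funpow_eq_iterated_integral:
  "(smear c \<delta> ^^ n) f y = iterated_integral n \<delta> (\<lambda>ts. f (y + c * sum_list ts))"
  by (induction n arbitrary: y) (simp_all add: smear_def algebra_simps)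

lemma Lp_norm_smear_funpow_le:
  fixes f :: "real \<Rightarrow> 'a::euclidean_space"
  assumes [measurable]: "f \<in> borel_measurable borel" and "0 < \<delta>" "1 \<le> p"
  shows "Lp_norm p ((smear c \<delta> ^^ n) f) \<le> ennreal (\<delta> ^ n) * Lp_norm p f"
proof -
  have "Lp_norm p (\<lambda>x. iterated_integral n \<delta> (\<lambda>ts. f (x + c * (0 + sum_list ts)))) \<le> ennreal (\<delta> ^ n) * Lp_norm p f"
  proof (rule Lp_norm_iterated_integral_le[where \<Psi> = "\<lambda>v x. f (x + c * v)"])
    show "(\<lambda>(v, x). f (x + c * v)) \<in> borel_measurable borel"
      unfolding borel_prod[symmetric] by measurable
    have "f \<in> borel_measurable lebesgue" by (rule measurable_completion) simp
    then show "Lp_norm p (\<lambda>x. f (x + c * v)) \<le> Lp_norm p f" for v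
      by (simp add: Lp_norm_translate)
  qed (use assms in auto)
  then show ?thesis by (simp add: smear_funpow_eq_iterated_integral[abs_def])
qed

lemma borel_measurable_forward_diff:
  fixes f :: "real \<Rightarrow> 'a::euclidean_space"
  assumes [measurable]: "f \<in> borel_measurable borel"
  shows "forward_diff n h f \<in> borel_measurable borel"
  unfolding forward_diff_def[abs_def] by measurable

lemma steklov_measurable:
  fixes f :: "real \<Rightarrow> 'a::euclidean_space"
  assumes "locally_bounded_measurable f" "0 < \<delta>"
  shows "steklov r \<delta> f \<in> borel_measurable lebesgue"
proof -
  have "(\<lambda>x. \<Sum>m=1..r. steklov_weight r \<delta> m *\<^sub>R (smear (real m / real r) \<delta> ^^ r) f x) \<in> borel_measurable lebesgue"
  proof (intro borel_measurable_sum)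
    fix m
    have "(smear (real m / real r) \<delta> ^^ r) f \<in> borel_measurable lebesgue"
      using assms by (intro lbm_measurable lbm_smear_funpow) auto
    then show "(\<lambda>x. steklov_weight r \<delta> m *\<^sub>R (smear (real m / real r) \<delta> ^^ r) f x) \<in> borel_measurable lebesgue"
      by (intro borel_measurable_scaleR) auto
  qed
  then show ?thesis by (simp add: steklov_eq_smear[OF assms, abs_def])
qed

text \<open>
By \<open>steklov_minus_eq\<close> the error is a mean of differences of order \<open>r\<close> with steps in \<open>[0, \<delta>]\<close>, and
a difference of order \<open>r\<close> is one of order \<open>r - s\<close> of a difference of order \<open>s\<close>.
\<close>

lemma Lp_norm_steklov_minus_le:
  fixes f :: "real \<Rightarrow> 'a::euclidean_space"
  assumes f [measurable]: "f \<in> borel_measurable borel" and lf: "locally_bounded_measurable f"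
    and "0 < \<delta>" "1 \<le> p" "1 \<le> s" "s \<le> r"
  shows "Lp_norm p (\<lambda>x. f x - steklov r \<delta> f x) \<le> ennreal (2 * 2 ^ r * 2 ^ r) * modulus_smoothness s p f \<delta>"
proof -
  define K where "K = ennreal (2 * 2 ^ r * 2 ^ r) * modulus_smoothness s p f \<delta>"
  define I where "I = (\<lambda>x. iterated_integral r \<delta> (\<lambda>ts. forward_diff r (sum_list ts / real r) f x))"
  define \<Psi> where "\<Psi> = (\<lambda>v x. forward_diff r (v / real r) f x)"
  have m: "(\<lambda>(v, x). \<Psi> v x) \<in> borel_measurable borel"
    unfolding \<Psi>_def forward_diff_def borel_prod[symmetric] by measurable
  have "Lp_norm p (\<lambda>x. iterated_integral r \<delta> (\<lambda>ts. \<Psi> (0 + sum_list ts) x)) \<le> ennreal (\<delta> ^ r) * K"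
  proof (rule Lp_norm_iterated_integral_le[OF m \<open>0 < \<delta>\<close> \<open>1 \<le> p\<close>])
    fix v assume v: "v \<in> {0..0 + real r * \<delta>}"
    show "Lp_norm p (\<Psi> v) \<le> K"
    proof (cases "v = 0")
      case True
      then have "\<Psi> v = (\<lambda>x. 0)" using assms by (simp add: \<Psi>_def forward_diff_zero_step fun_eq_iff)
      then show ?thesis using \<open>1 \<le> p\<close> by (simp add: Lp_norm_zero)
    next
      case False
      define h where "h = v / real r"
      have h: "0 < h" "h \<le> \<delta>" using v False assms by (auto simp: h_def field_simps)
      have "\<Psi> v = forward_diff (r - s) h (forward_diff s h f)"
        using forward_diff_add[of "r - s" s h f] assms by (simp add: \<Psi>_def h_def fun_eq_iff)
      then have "Lp_norm p (\<Psi> v) \<le> ennreal (2 ^ Suc (r - s) * 2 ^ (r - s)) * Lp_norm p (forward_diff s h f)"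
        using Lp_norm_forward_diff_le[OF lbm_measurable[OF lbm_forward_diff[OF lf]] \<open>1 \<le> p\<close>] by simp
      also have "\<dots> \<le> K" unfolding K_def modulus_smoothness_def
      proof (rule mult_mono)
        have "(2::real) ^ (r - s) \<le> 2 ^ r" by (rule power_increasing) auto
        then have "(2::real) ^ (r - s) * 2 ^ (r - s) \<le> 2 ^ r * 2 ^ r" by (intro mult_mono) auto
        then show "ennreal (2 ^ Suc (r - s) * 2 ^ (r - s)) \<le> ennreal (2 * 2 ^ r * 2 ^ r)"
          by (intro ennreal_leI) simp
        show "Lp_norm p (forward_diff s h f) \<le> (SUP h\<in>{0<..\<delta>}. Lp_norm p (forward_diff s h f))"
          using h by (intro SUP_upper) auto
      qed auto
      finally show ?thesis .
    qed
  qed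
  then have IK: "Lp_norm p I \<le> ennreal (\<delta> ^ r) * K" by (simp add: \<Psi>_def I_def)
  have "Lp_norm p (\<lambda>x. f x - steklov r \<delta> f x) = ennreal \<bar>1 / \<delta> ^ r\<bar> * Lp_norm p I"
  proof (rule Lp_norm_cmult)
    have "I = (\<lambda>x. (- ((- \<delta>) ^ r)) *\<^sub>R (steklov r \<delta> f x - f x))"
      unfolding I_def using steklov_minus_eq[OF lf \<open>0 < \<delta>\<close>, of r] \<open>0 < \<delta>\<close> by (simp add: fun_eq_iff)
    moreover have "steklov r \<delta> f \<in> borel_measurable lebesgue"
      by (rule steklov_measurable[OF lf \<open>0 < \<delta>\<close>])
    ultimately show "I \<in> borel_measurable lebesgue"
      using lbm_measurable[OF lf] by (simp add: borel_measurable_scaleR borel_measurable_diff)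
    show "norm (f x - steklov r \<delta> f x) = \<bar>1 / \<delta> ^ r\<bar> * norm (I x)" for x
      using arg_cong[OF steklov_minus_eq[OF lf \<open>0 < \<delta>\<close>, of r x], of norm] \<open>0 < \<delta>\<close>
      by (simp add: I_def norm_minus_commute power_abs)
  qed (use \<open>1 \<le> p\<close> in simp)
  also have "\<dots> \<le> ennreal \<bar>1 / \<delta> ^ r\<bar> * (ennreal (\<delta> ^ r) * K)" by (rule mult_left_mono[OF IK]) simp
  also have "\<dots> = K" using \<open>0 < \<delta>\<close> by (subst ennreal_mult_mult) auto
  finally show ?thesis by (simp only: K_def)
qed


section \<open>Derivatives of averages\<close>

lemma AE_lebesgue_translate:
  fixes a :: real
  assumes "AE x in lebesgue. P x"
  shows "AE x in lebesgue. P (x + a)"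
proof -
  obtain N where N: "N \<in> null_sets lebesgue" "\<And>x. x \<notin> N \<Longrightarrow> P x"
    using AE_E3[OF assms] by auto
  have "negligible ((+) (- a) ` N)"
    using N(1) by (intro negligible_translation) (simp add: negligible_iff_null_sets)
  moreover have "{x \<in> space lebesgue. \<not> P (x + a)} \<subseteq> (+) (- a) ` N"
  proof
    fix x assume "x \<in> {x \<in> space lebesgue. \<not> P (x + a)}"
    then have "x + a \<in> N" using N(2) by auto
    then show "x \<in> (+) (- a) ` N" by (intro image_eqI[of _ _ "x + a"]) auto
  qed
  ultimately show ?thesis
    by (intro AE_I'[of "(+) (- a) ` N"]) (auto simp: negligible_iff_null_sets)
qed

lemma lipschitz_imp_abs_continuous:
  assumes "\<And>u v. a \<le> u \<Longrightarrow> u \<le> v \<Longrightarrow> v \<le> b \<Longrightarrow> norm (F v - F u) \<le> B * (v - u)"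
  shows "abs_continuous_on_interval a b F"
  unfolding abs_continuous_on_interval_def
proof (intro allI impI)
  fix \<epsilon> :: real assume "0 < \<epsilon>"
  define C where "C = \<bar>B\<bar> + 1"
  have "0 < C" by (simp add: C_def)
  show "\<exists>\<delta>>0. \<forall>(n::nat) u v. (\<forall>i<n. a \<le> u i \<and> u i < v i \<and> v i \<le> b) \<and>
      disjoint_family_on (\<lambda>i. {u i<..<v i}) {..<n} \<and> (\<Sum>i<n. v i - u i) < \<delta> \<longrightarrow>
      (\<Sum>i<n. norm (F (v i) - F (u i))) < \<epsilon>"
  proof (intro exI[of _ "\<epsilon> / C"] conjI allI impI)
    fix n :: nat and u v :: "nat \<Rightarrow> real"
    assume *: "(\<forall>i<n. a \<le> u i \<and> u i < v i \<and> v i \<le> b) \<and>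
      disjoint_family_on (\<lambda>i. {u i<..<v i}) {..<n} \<and> (\<Sum>i<n. v i - u i) < \<epsilon> / C"
    have "(\<Sum>i<n. norm (F (v i) - F (u i))) \<le> (\<Sum>i<n. C * (v i - u i))"
    proof (rule sum_mono)
      fix i assume "i \<in> {..<n}"
      then have i: "a \<le> u i" "u i < v i" "v i \<le> b" using * by auto
      then have "norm (F (v i) - F (u i)) \<le> B * (v i - u i)" by (intro assms) auto
      also have "\<dots> \<le> C * (v i - u i)" using i by (intro mult_right_mono) (auto simp: C_def)
      finally show "norm (F (v i) - F (u i)) \<le> C * (v i - u i)" .
    qed
    also have "\<dots> = C * (\<Sum>i<n. v i - u i)" by (simp add: sum_distrib_left)
    also have "\<dots> < C * (\<epsilon> / C)" using * \<open>0 < C\<close> by (intro mult_strict_left_mono) auto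
    finally show "(\<Sum>i<n. norm (F (v i) - F (u i))) < \<epsilon>" using \<open>0 < C\<close> by simp
  qed (use \<open>0 < \<epsilon>\<close> \<open>0 < C\<close> in auto)
qed

lemma primitive_lipschitz:
  fixes f :: "real \<Rightarrow> 'a::euclidean_space"
  assumes f: "locally_bounded_measurable f" and B: "\<And>x. x \<in> {a..b} \<Longrightarrow> norm (f x) \<le> B"
    and uv: "a \<le> u" "u \<le> v" "v \<le> b"
  shows "norm (integral {a..v} f - integral {a..u} f) \<le> B * (v - u)"
proof -
  have "0 \<le> B" using B[of u] uv norm_ge_zero[of "f u"] by (smt (verit) atLeastAtMost_iff)
  have "norm (integral (cbox u v) f) \<le> B * measure lborel (cbox u v)"
    using lbm_integrable_on[OF f] uv \<open>0 \<le> B\<close> by (intro integrable_bound) (auto intro!: B)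
  then show ?thesis using uv lbm_integral_diff[OF f uv(1,2)] by simp
qed

text \<open>
Lebesgue's differentiation theorem with two-sided derivatives. The primitive is Lipschitz
continuous, hence differentiable almost everywhere, and the value of the derivative is
identified by the right derivative from \<open>integrable_ccontinuous_explicit\<close>.
\<close>

lemma primitive_has_derivative_AE:
  fixes f :: "real \<Rightarrow> 'a::euclidean_space"
  assumes f: "locally_bounded_measurable f"
  shows "AE x in lebesgue. x \<in> {a<..<b} \<longrightarrow> ((\<lambda>u. integral {a..u} f) has_vector_derivative f x) (at x)"
proof -
  define F where "F = (\<lambda>u. integral {a..u} f)"
  obtain B where B: "\<And>x. x \<in> {a..b} \<Longrightarrow> norm (f x) \<le> B" using lbm_boundE[OF f] by metis
  have "abs_continuous_on_interval a b F"
    unfolding F_def by (rule lipschitz_imp_abs_continuous) (rule primitive_lipschitz[OF f B])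
  then have neg: "negligible {x \<in> {a<..<b}. \<not> F differentiable (at x)}"
    by (rule abs_continuous_differentiable_AE)
  obtain N where N: "negligible N" "\<And>x e. \<lbrakk>x \<notin> N; 0 < e\<rbrakk> \<Longrightarrow>
      \<exists>d>0. \<forall>h. 0 < h \<and> h < d \<longrightarrow> norm (integral (cbox x (x + h *\<^sub>R One)) f /\<^sub>R h ^ DIM(real) - f x) < e"
    using integrable_ccontinuous_explicit[of f] lbm_integrable_on[OF f] by (metis box_real(2))
  have "(F has_vector_derivative f x) (at x)"
    if x: "x \<in> {a<..<b}" "F differentiable (at x)" "x \<notin> N" for x
  proof -
    define D where "D = vector_derivative F (at x)"
    have D: "(F has_vector_derivative D) (at x)" using x(2) unfolding D_def vector_derivative_works .
    have "norm (D - f x) \<le> e" if "0 < e" for e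
    proof -
      obtain d1 where d1: "d1 > 0" "\<And>y. norm (y - x) < d1 \<Longrightarrow> norm (F y - F x - (y - x) *\<^sub>R D) \<le> (e / 2) * norm (y - x)"
        using D half_gt_zero[OF \<open>0 < e\<close>] unfolding has_vector_derivative_def has_derivative_at_alt by blast
      obtain d2 where d2: "d2 > 0" "\<And>h. 0 < h \<Longrightarrow> h < d2 \<Longrightarrow> norm (integral {x..x + h} f /\<^sub>R h - f x) < e / 2"
        using N(2)[OF x(3), of "e / 2"] \<open>0 < e\<close> by auto
      define h where "h = min d1 d2 / 2"
      have h: "0 < h" "h < d1" "h < d2" using d1(1) d2(1) by (auto simp: h_def)
      have int: "F (x + h) - F x = integral {x..x + h} f"
        unfolding F_def using x(1) h by (intro lbm_integral_diff[OF f]) auto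
      have "norm ((1 / h) *\<^sub>R (F (x + h) - F x - h *\<^sub>R D)) \<le> (1 / h) * ((e / 2) * h)"
        unfolding norm_scaleR using d1(2)[of "x + h"] h by (intro mult_mono) auto
      moreover have "(1 / h) *\<^sub>R (F (x + h) - F x - h *\<^sub>R D) = integral {x..x + h} f /\<^sub>R h - D"
        using h by (simp add: int scaleR_diff_right inverse_eq_divide)
      ultimately have "norm (integral {x..x + h} f /\<^sub>R h - D) \<le> e / 2" using h by simp
      moreover have "norm (D - f x) \<le> norm (integral {x..x + h} f /\<^sub>R h - D) + norm (integral {x..x + h} f /\<^sub>R h - f x)"
        using norm_triangle_ineq4[of "integral {x..x + h} f /\<^sub>R h - f x" "integral {x..x + h} f /\<^sub>R h - D"]
        by (simp add: algebra_simps)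
      ultimately show ?thesis using d2(2)[OF h(1,3)] by linarith
    qed
    then have "norm (D - f x) \<le> 0" by (rule dense_ge)
    then show ?thesis using D by simp
  qed
  then have *: "{x \<in> space lebesgue. \<not> (x \<in> {a<..<b} \<longrightarrow> (F has_vector_derivative f x) (at x))} \<subseteq>
      N \<union> {x \<in> {a<..<b}. \<not> F differentiable (at x)}" by blast
  have "N \<union> {x \<in> {a<..<b}. \<not> F differentiable (at x)} \<in> null_sets lebesgue"
    using negligible_Un[OF N(1) neg] by (simp add: negligible_iff_null_sets)
  from AE_I'[OF this *] show ?thesis by (simp only: F_def)
qed

lemma primitive_has_derivative_continuous:
  fixes f :: "real \<Rightarrow> 'a::euclidean_space"
  assumes "continuous_on UNIV f" "a < x"
  shows "((\<lambda>u. integral {a..u} f) has_vector_derivative f x) (at x)"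
proof -
  have "((\<lambda>u. integral {a..u} f) has_vector_derivative f x) (at x within {a..x + 1})"
    using assms by (intro integral_has_vector_derivative) (auto intro: continuous_on_subset)
  moreover have "at x within {a..x + 1} = at x"
    by (rule at_within_interior) (use assms(2) in simp)
  ultimately show ?thesis by simp
qed

text \<open>
The average is \<open>1 / c\<close> times the difference of a primitive at the two ends of the window.
\<close>

lemma smear_has_derivative_of_primitive:
  fixes f :: "real \<Rightarrow> 'a::euclidean_space"
  assumes f: "locally_bounded_measurable f" and "0 < c" "0 < \<delta>" and a: "a < x"
    and d1: "((\<lambda>u. integral {a..u} f) has_vector_derivative f x) (at x)"
    and d2: "((\<lambda>u. integral {a..u} f) has_vector_derivative f (x + c * \<delta>)) (at (x + c * \<delta>))"
  shows "(smear c \<delta> f has_vector_derivative (1 / c) *\<^sub>R forward_diff 1 (c * \<delta>) f x) (at x)"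
proof -
  define F where "F = (\<lambda>u. integral {a..u} f)"
  have d: "((\<lambda>y. (1 / c) *\<^sub>R (F (y + c * \<delta>) - F y)) has_vector_derivative (1 / c) *\<^sub>R (f (x + c * \<delta>) - f x)) (at x)"
  proof (rule has_vector_derivative_scaleR[where f = "\<lambda>_. 1 / c" and f' = 0, simplified])
    have "((F \<circ> (\<lambda>y. y + c * \<delta>)) has_vector_derivative (1 *\<^sub>R f (x + c * \<delta>))) (at x)"
      by (rule vector_diff_chain_at) (use d2 in \<open>auto simp: F_def intro!: derivative_eq_intros\<close>)
    then show "((\<lambda>y. F (y + c * \<delta>) - F y) has_vector_derivative (f (x + c * \<delta>) - f x)) (at x)"
      using d1 by (auto simp: o_def F_def intro!: has_vector_derivative_diff)
  qed
  have "(smear c \<delta> f has_vector_derivative (1 / c) *\<^sub>R (f (x + c * \<delta>) - f x)) (at x)"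
  proof (rule has_vector_derivative_transform_within_open[OF d, of "{a<..}"])
    fix y assume "y \<in> {a<..}"
    then show "(1 / c) *\<^sub>R (F (y + c * \<delta>) - F y) = smear c \<delta> f y"
      unfolding smear_eq_integral[OF f assms(2,3)] F_def
      using lbm_integral_diff[OF f, of a y "y + c * \<delta>"] assms(2,3) by simp
  qed (use a in auto)
  moreover have "forward_diff 1 (c * \<delta>) f x = f (x + c * \<delta>) - f x"
    using forward_diff_Suc[of 0 "c * \<delta>" f x] by simp
  ultimately show ?thesis by simp
qed

lemma smear_has_derivative_continuous:
  fixes f :: "real \<Rightarrow> 'a::euclidean_space"
  assumes f: "continuous_on UNIV f" and "0 < c" "0 < \<delta>"
  shows "(smear c \<delta> f has_vector_derivative (1 / c) *\<^sub>R forward_diff 1 (c * \<delta>) f x) (at x)"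
proof (rule smear_has_derivative_of_primitive[OF lbm_continuous[OF f] assms(2,3), where a = "x - 1"])
  have "0 < c * \<delta>" using assms by simp
  then show "((\<lambda>u. integral {x - 1..u} f) has_vector_derivative f (x + c * \<delta>)) (at (x + c * \<delta>))"
    by (intro primitive_has_derivative_continuous[OF f]) auto
qed (auto intro: primitive_has_derivative_continuous[OF f])

text \<open>
The exceptional set consists of the \<open>x\<close> for which \<open>x\<close> or \<open>x + c \<delta>\<close> is exceptional for
the primitive. Countably many starting points \<open>- n\<close> of the primitive reach all of the line.
\<close>

lemma smear_has_derivative_AE:
  fixes f :: "real \<Rightarrow> 'a::euclidean_space"
  assumes f: "locally_bounded_measurable f" and "0 < c" "0 < \<delta>"
  shows "AE x in lebesgue. (smear c \<delta> f has_vector_derivative (1 / c) *\<^sub>R forward_diff 1 (c * \<delta>) f x) (at x)"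
proof -
  define Q where "Q = (\<lambda>x. \<forall>n::nat. x \<in> {- real n<..<real n} \<longrightarrow> ((\<lambda>u. integral {- real n..u} f) has_vector_derivative f x) (at x))"
  have Q: "AE x in lebesgue. Q x"
    unfolding Q_def using primitive_has_derivative_AE[OF f] by (subst AE_all_countable) blast
  have pos: "0 < c * \<delta>" using assms by simp
  from Q AE_lebesgue_translate[OF Q, of "c * \<delta>"] show ?thesis
  proof eventually_elim
    case (elim x)
    obtain n :: nat where n: "\<bar>x\<bar> + c * \<delta> < real n" using reals_Archimedean2 by blast
    have mem: "- real n < x" "x < real n" "- real n < x + c * \<delta>" "x + c * \<delta> < real n"
      using n pos by linarith+
    show ?case
    proof (rule smear_has_derivative_of_primitive[OF f assms(2,3), where a = "- real n"])
      show "((\<lambda>u. integral {- real n..u} f) has_vector_derivative f x) (at x)"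
        using elim(1)[unfolded Q_def, rule_format, of n] mem by simp
      show "((\<lambda>u. integral {- real n..u} f) has_vector_derivative f (x + c * \<delta>)) (at (x + c * \<delta>))"
        using elim(2)[unfolded Q_def, rule_format, of n] mem by simp
    qed (use mem in auto)
  qed
qed

lemma forward_diff_has_derivative:
  assumes "\<And>j. j \<le> k \<Longrightarrow> (F has_vector_derivative F' (x + real j * h)) (at (x + real j * h))"
  shows "(forward_diff k h F has_vector_derivative forward_diff k h F' x) (at x)"
  unfolding forward_diff_def[abs_def]
proof (rule has_vector_derivative_sum)
  fix j assume "j \<in> {0..k}"
  then have "(F has_vector_derivative F' (x + real j * h)) (at (x + real j * h))" using assms by auto
  then have "((F \<circ> (\<lambda>y. y + real j * h)) has_vector_derivative (1 *\<^sub>R F' (x + real j * h))) (at x)"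
    by (intro vector_diff_chain_at) (auto intro!: derivative_eq_intros)
  then have "((\<lambda>y. F (y + real j * h)) has_vector_derivative F' (x + real j * h)) (at x)"
    by (simp add: o_def)
  from has_vector_derivative_scaleR[OF DERIV_const this]
  show "((\<lambda>y. (real (k choose j) * (-1) ^ (k - j)) *\<^sub>R F (y + real j * h)) has_vector_derivative
      (real (k choose j) * (-1) ^ (k - j)) *\<^sub>R F' (x + real j * h)) (at x)"
    by simp
qed

lemma forward_diff_scaleR: "forward_diff k h (\<lambda>y. a *\<^sub>R F y) x = a *\<^sub>R forward_diff k h F x"
  by (simp add: forward_diff_def scaleR_sum_right mult.commute)

text \<open>
Differentiating one average produces one further difference and a factor \<open>1 / c\<close>.
\<close>

lemma smear_difference_has_derivative:
  fixes f :: "real \<Rightarrow> 'a::euclidean_space"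
  assumes d: "\<And>j. j \<le> k \<Longrightarrow> (smear c \<delta> f has_vector_derivative
      (1 / c) *\<^sub>R forward_diff 1 (c * \<delta>) f (x + real j * (c * \<delta>))) (at (x + real j * (c * \<delta>)))"
  shows "((\<lambda>y. (1 / c ^ k) *\<^sub>R forward_diff k (c * \<delta>) (smear c \<delta> f) y) has_vector_derivative
    (1 / c ^ Suc k) *\<^sub>R forward_diff (Suc k) (c * \<delta>) f x) (at x)"
proof -
  have "(forward_diff k (c * \<delta>) (smear c \<delta> f) has_vector_derivative
      forward_diff k (c * \<delta>) (\<lambda>y. (1 / c) *\<^sub>R forward_diff 1 (c * \<delta>) f y) x) (at x)"
    by (rule forward_diff_has_derivative) (rule d)
  also have "forward_diff k (c * \<delta>) (\<lambda>y. (1 / c) *\<^sub>R forward_diff 1 (c * \<delta>) f y) x =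
      (1 / c) *\<^sub>R forward_diff (Suc k) (c * \<delta>) f x"
    using forward_diff_add[of k 1 "c * \<delta>" f x] by (simp add: forward_diff_scaleR)
  finally have "(forward_diff k (c * \<delta>) (smear c \<delta> f) has_vector_derivative
      (1 / c) *\<^sub>R forward_diff (Suc k) (c * \<delta>) f x) (at x)" .
  from has_vector_derivative_scaleR[OF DERIV_const[of "1 / c ^ k"] this]
  show ?thesis by (simp add: mult.commute)
qed

text \<open>
The \<open>k\<close>-th derivative of the \<open>r\<close>-fold average of \<open>f\<close>, for \<open>k \<le> r\<close>.
\<close>

definition smear_deriv :: "nat \<Rightarrow> nat \<Rightarrow> real \<Rightarrow> real \<Rightarrow> (real \<Rightarrow> 'a::euclidean_space) \<Rightarrow> real \<Rightarrow> 'a" where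
  "smear_deriv r k c \<delta> f x = (1 / c ^ k) *\<^sub>R forward_diff k (c * \<delta>) ((smear c \<delta> ^^ (r - k)) f) x"

text \<open>
For \<open>k + 1 < r\<close> an average of a continuous function is differentiated, so the derivative
exists everywhere. In the last step \<open>k + 1 = r\<close> it is \<open>f\<close> itself that is averaged, which leads to
\<open>smear_deriv_has_derivative_AE\<close>.
\<close>

lemma smear_deriv_has_derivative:
  fixes f :: "real \<Rightarrow> 'a::euclidean_space"
  assumes f: "locally_bounded_measurable f" and c: "0 < c" "0 < \<delta>" and "Suc k < r"
  shows "(smear_deriv r k c \<delta> f has_vector_derivative smear_deriv r (Suc k) c \<delta> f x) (at x)"
proof -
  obtain n where n: "r - k = Suc (Suc n)" using \<open>Suc k < r\<close> by (metis Suc_diff_Suc Suc_lessD)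
  then have n': "r - Suc k = Suc n" by simp
  have "continuous_on UNIV ((smear c \<delta> ^^ Suc n) f)"
    unfolding funpow.simps o_apply using c by (intro smear_continuous lbm_smear_funpow f) auto
  then show ?thesis
    unfolding smear_deriv_def[abs_def] n n' funpow.simps(2)[of "Suc n"] o_apply
    by (intro smear_difference_has_derivative smear_has_derivative_continuous c)
qed

lemma smear_deriv_has_derivative_AE:
  fixes f :: "real \<Rightarrow> 'a::euclidean_space"
  assumes f: "locally_bounded_measurable f" and c: "0 < c" "0 < \<delta>" and "k < r"
  shows "AE x in lebesgue. (smear_deriv r k c \<delta> f has_vector_derivative smear_deriv r (Suc k) c \<delta> f x) (at x)"
proof -
  obtain n where n: "r - k = Suc n" using \<open>k < r\<close> by (metis Suc_diff_Suc)
  then have n': "r - Suc k = n" by simp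
  define F where "F = (smear c \<delta> ^^ n) f"
  have "locally_bounded_measurable F" unfolding F_def using c by (intro lbm_smear_funpow f) auto
  then have 1: "AE x in lebesgue. (smear c \<delta> F has_vector_derivative (1 / c) *\<^sub>R forward_diff 1 (c * \<delta>) F x) (at x)"
    by (rule smear_has_derivative_AE[OF _ c])
  have "AE x in lebesgue. \<forall>j. (smear c \<delta> F has_vector_derivative
      (1 / c) *\<^sub>R forward_diff 1 (c * \<delta>) F (x + real j * (c * \<delta>))) (at (x + real j * (c * \<delta>)))"
    unfolding AE_all_countable using AE_lebesgue_translate[OF 1] by blast
  then show ?thesis
  proof eventually_elim
    case (elim x)
    then show ?case
      unfolding smear_deriv_def[abs_def] n n' funpow.simps(2) o_apply F_def[symmetric]
      by (intro smear_difference_has_derivative) simp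
  qed
qed

lemma has_vector_derivative_scaleR_sum:
  assumes "\<And>m. m \<in> M \<Longrightarrow> (F m has_vector_derivative F' m) (at x)"
  shows "((\<lambda>x. \<Sum>m\<in>M. a m *\<^sub>R F m x) has_vector_derivative (\<Sum>m\<in>M. a m *\<^sub>R F' m)) (at x)"
proof (rule has_vector_derivative_sum)
  fix m assume "m \<in> M"
  from has_vector_derivative_scaleR[OF DERIV_const[of "a m"] assms[OF this]]
  show "((\<lambda>x. a m *\<^sub>R F m x) has_vector_derivative a m *\<^sub>R F' m) (at x)" by simp
qed

context
  fixes f :: "real \<Rightarrow> 'a::euclidean_space" and M :: "'i set" and a c :: "'i \<Rightarrow> real" and \<delta> :: real and r :: nat
  assumes f: "locally_bounded_measurable f" and c: "\<And>m. m \<in> M \<Longrightarrow> 0 < c m" and \<delta>: "0 < \<delta>"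
begin

lemma nth_deriv_smear_sum:
  assumes "k < r"
  shows "nth_deriv k (\<lambda>x. \<Sum>m\<in>M. a m *\<^sub>R (smear (c m) \<delta> ^^ r) f x) = (\<lambda>x. \<Sum>m\<in>M. a m *\<^sub>R smear_deriv r k (c m) \<delta> f x)"
  using assms
proof (induction k)
  case 0
  then show ?case by (simp add: smear_deriv_def)
next
  case (Suc k)
  show ?case unfolding nth_deriv_Suc Suc.IH[OF Suc_lessD[OF Suc.prems]]
    by (intro ext vector_derivative_at has_vector_derivative_scaleR_sum smear_deriv_has_derivative f c \<delta> Suc.prems)
qed

lemma nth_deriv_smear_sum_differentiable:
  assumes "Suc k < r"
  shows "nth_deriv k (\<lambda>x. \<Sum>m\<in>M. a m *\<^sub>R (smear (c m) \<delta> ^^ r) f x) differentiable (at x)"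
  unfolding nth_deriv_smear_sum[OF Suc_lessD[OF assms]]
  by (rule differentiableI_vector, rule has_vector_derivative_scaleR_sum, rule smear_deriv_has_derivative)
    (use f c \<delta> assms in auto)

lemma nth_deriv_smear_sum_AE:
  assumes "k \<le> r" "finite M"
  shows "AE x in lebesgue. nth_deriv k (\<lambda>x. \<Sum>m\<in>M. a m *\<^sub>R (smear (c m) \<delta> ^^ r) f x) x = (\<Sum>m\<in>M. a m *\<^sub>R smear_deriv r k (c m) \<delta> f x)"
proof (cases "k < r")
  case True
  show ?thesis by (simp add: nth_deriv_smear_sum[OF True])
next
  case False
  show ?thesis
  proof (cases r)
    case 0
    then show ?thesis using \<open>k \<le> r\<close> by (simp add: smear_deriv_def)
  next
    case (Suc n)
    then have k: "k = Suc n" "n < r" using False \<open>k \<le> r\<close> by auto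
    have "AE x in lebesgue. \<forall>m\<in>M. (smear_deriv r n (c m) \<delta> f has_vector_derivative smear_deriv r (Suc n) (c m) \<delta> f x) (at x)"
      using smear_deriv_has_derivative_AE[OF f c \<delta> k(2)] \<open>finite M\<close> by (intro AE_finite_allI) auto
    then show ?thesis
    proof eventually_elim
      case (elim x)
      then show ?case unfolding k(1) nth_deriv_Suc nth_deriv_smear_sum[OF k(2)]
        by (intro vector_derivative_at has_vector_derivative_scaleR_sum) auto
    qed
  qed
qed

end



section \<open>Steklov means as Sobolev functions\<close>

text \<open>
A sufficient condition for local absolute continuity that is visibly stable under sums and translations.
\<close>

definition locally_lipschitz :: "(real \<Rightarrow> 'a::real_normed_vector) \<Rightarrow> bool" where
  "locally_lipschitz F \<longleftrightarrow> (\<forall>a b. \<exists>B. \<forall>u v. a \<le> u \<longrightarrow> u \<le> v \<longrightarrow> v \<le> b \<longrightarrow> norm (F v - F u) \<le> B * (v - u))"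

lemma locally_lipschitz_imp_locally_abs_continuous:
  assumes "locally_lipschitz F"
  shows "locally_abs_continuous F"
  unfolding locally_abs_continuous_def
proof (intro allI)
  fix a b
  obtain B where "\<And>u v. a \<le> u \<Longrightarrow> u \<le> v \<Longrightarrow> v \<le> b \<Longrightarrow> norm (F v - F u) \<le> B * (v - u)"
    using assms unfolding locally_lipschitz_def by metis
  then show "abs_continuous_on_interval a b F" by (rule lipschitz_imp_abs_continuous)
qed

lemma locally_lipschitz_sum:
  assumes "finite M" "\<And>m. m \<in> M \<Longrightarrow> locally_lipschitz (F m)"
  shows "locally_lipschitz (\<lambda>x. \<Sum>m\<in>M. a m *\<^sub>R F m x)"
  unfolding locally_lipschitz_def
proof (intro allI)
  fix c d :: real
  have "\<forall>m\<in>M. \<exists>B. \<forall>u v. c \<le> u \<longrightarrow> u \<le> v \<longrightarrow> v \<le> d \<longrightarrow> norm (F m v - F m u) \<le> B * (v - u)"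
    using assms(2) unfolding locally_lipschitz_def by blast
  then obtain B where B: "\<And>m u v. m \<in> M \<Longrightarrow> c \<le> u \<Longrightarrow> u \<le> v \<Longrightarrow> v \<le> d \<Longrightarrow> norm (F m v - F m u) \<le> B m * (v - u)"
    unfolding bchoice_iff by blast
  have "norm ((\<Sum>m\<in>M. a m *\<^sub>R F m v) - (\<Sum>m\<in>M. a m *\<^sub>R F m u)) \<le> (\<Sum>m\<in>M. \<bar>a m\<bar> * B m) * (v - u)"
    if uv: "c \<le> u" "u \<le> v" "v \<le> d" for u v
  proof -
    have "norm ((\<Sum>m\<in>M. a m *\<^sub>R F m v) - (\<Sum>m\<in>M. a m *\<^sub>R F m u)) = norm (\<Sum>m\<in>M. a m *\<^sub>R (F m v - F m u))"
      by (simp add: sum_subtractf scaleR_diff_right)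
    also have "\<dots> \<le> (\<Sum>m\<in>M. \<bar>a m\<bar> * B m * (v - u))"
    proof (rule sum_norm_le)
      fix m assume "m \<in> M"
      then show "norm (a m *\<^sub>R (F m v - F m u)) \<le> \<bar>a m\<bar> * B m * (v - u)"
        using mult_left_mono[OF B[OF _ uv], of m "\<bar>a m\<bar>"] by (simp add: mult.assoc)
    qed
    finally show ?thesis by (simp add: sum_distrib_right)
  qed
  then show "\<exists>B. \<forall>u v. c \<le> u \<longrightarrow> u \<le> v \<longrightarrow> v \<le> d \<longrightarrow>
      norm ((\<Sum>m\<in>M. a m *\<^sub>R F m v) - (\<Sum>m\<in>M. a m *\<^sub>R F m u)) \<le> B * (v - u)" by blast
qed

lemma locally_lipschitz_translate:
  assumes "locally_lipschitz F"
  shows "locally_lipschitz (\<lambda>x. F (x + t))"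
  unfolding locally_lipschitz_def
proof (intro allI)
  fix a b
  obtain B where B: "\<And>u v. a + t \<le> u \<Longrightarrow> u \<le> v \<Longrightarrow> v \<le> b + t \<Longrightarrow> norm (F v - F u) \<le> B * (v - u)"
    using assms unfolding locally_lipschitz_def by metis
  show "\<exists>B. \<forall>u v. a \<le> u \<longrightarrow> u \<le> v \<longrightarrow> v \<le> b \<longrightarrow> norm (F (v + t) - F (u + t)) \<le> B * (v - u)"
    using B[of "u + t" "v + t" for u v] by (intro exI[of _ B]) auto
qed

lemma locally_lipschitz_smear:
  fixes f :: "real \<Rightarrow> 'a::euclidean_space"
  assumes f: "locally_bounded_measurable f" and "0 < c" "0 < \<delta>"
  shows "locally_lipschitz (smear c \<delta> f)"
  unfolding locally_lipschitz_def
proof (intro allI)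
  fix a b
  obtain B where B: "\<And>x. x \<in> {a..b + c * \<delta>} \<Longrightarrow> norm (f x) \<le> B" using lbm_boundE[OF f] by metis
  have "norm (smear c \<delta> f v - smear c \<delta> f u) \<le> (2 * B / c) * (v - u)" if "a \<le> u" "u \<le> v" "v \<le> b" for u v
    using that by (intro smear_increment_bound[OF assms] B) auto
  then show "\<exists>B. \<forall>u v. a \<le> u \<longrightarrow> u \<le> v \<longrightarrow> v \<le> b \<longrightarrow> norm (smear c \<delta> f v - smear c \<delta> f u) \<le> B * (v - u)" by blast
qed

lemma locally_lipschitz_smear_deriv:
  fixes f :: "real \<Rightarrow> 'a::euclidean_space"
  assumes f: "locally_bounded_measurable f" and c: "0 < c" "0 < \<delta>" and "k < r"
  shows "locally_lipschitz (smear_deriv r k c \<delta> f)"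
proof -
  obtain n where n: "r - k = Suc n" using \<open>k < r\<close> by (metis Suc_diff_Suc)
  have L: "locally_lipschitz ((smear c \<delta> ^^ (r - k)) f)"
    unfolding n funpow.simps o_apply using c by (intro locally_lipschitz_smear lbm_smear_funpow f) auto
  have "locally_lipschitz (\<lambda>x. \<Sum>j=0..k. (1 / c ^ k * (real (k choose j) * (-1) ^ (k - j))) *\<^sub>R ((smear c \<delta> ^^ (r - k)) f (x + real j * (c * \<delta>))))"
    by (intro locally_lipschitz_sum locally_lipschitz_translate L) simp
  then show ?thesis by (simp add: smear_deriv_def[abs_def] forward_diff_def scaleR_sum_right)
qed

lemma steklov_eq_smear_sum:
  fixes f :: "real \<Rightarrow> 'a::euclidean_space"
  assumes "locally_bounded_measurable f" "0 < \<delta>"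
  shows "steklov r \<delta> f = (\<lambda>x. \<Sum>m\<in>{1..r}. steklov_weight r \<delta> m *\<^sub>R (smear (real m / real r) \<delta> ^^ r) f x)"
  by (rule ext) (rule steklov_eq_smear[OF assms])

text \<open>
The derivative of order \<open>s\<close> is a sum of terms \<open>c\<^sup>-\<^sup>s A\<^sub>c\<^sup>r\<^sup>-\<^sup>s\<close> applied to the differences of order \<open>s\<close> with step
\<open>c \<delta> \<le> \<delta>\<close>. Each application of \<open>A\<^sub>c\<close> costs a factor \<open>\<delta>\<close>, against the factor \<open>\<delta>\<^sup>-\<^sup>r\<close> of the weight.
\<close>

lemma Lp_norm_steklov_deriv_le:
  fixes f :: "real \<Rightarrow> 'a::euclidean_space"
  assumes fb: "f \<in> borel_measurable borel" and lf: "locally_bounded_measurable f"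
    and \<delta>: "0 < \<delta>" and p: "1 \<le> p" and s: "1 \<le> s" "s \<le> r"
  shows "Lp_norm p (nth_deriv s (steklov r \<delta> f)) \<le>
    ennreal (2 ^ r * 2 ^ r * real r ^ s / \<delta> ^ s) * modulus_smoothness s p f \<delta>"
    and "nth_deriv s (steklov r \<delta> f) \<in> borel_measurable lebesgue"
proof -
  define c where "c = (\<lambda>m. real m / real r)"
  have c: "0 < c m" if "m \<in> {1..r}" for m using that by (auto simp: c_def)
  define D where "D = (\<lambda>m x. steklov_weight r \<delta> m *\<^sub>R smear_deriv r s (c m) \<delta> f x)"
  have st: "steklov r \<delta> f = (\<lambda>x. \<Sum>m\<in>{1..r}. steklov_weight r \<delta> m *\<^sub>R (smear (c m) \<delta> ^^ r) f x)"
    unfolding c_def by (rule steklov_eq_smear_sum[OF lf \<delta>])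
  have ae: "AE x in lebesgue. nth_deriv s (steklov r \<delta> f) x = (\<Sum>m\<in>{1..r}. D m x)"
    unfolding st D_def
    by (rule nth_deriv_smear_sum_AE[OF lf c \<delta> s(2)]) auto
  have Dm: "D m \<in> borel_measurable lebesgue" if "m \<in> {1..r}" for m
  proof -
    have "forward_diff s (c m * \<delta>) ((smear (c m) \<delta> ^^ (r - s)) f) \<in> borel_measurable lebesgue"
      using c[OF that] \<delta> by (intro lbm_measurable lbm_forward_diff lbm_smear_funpow lf) auto
    then show ?thesis unfolding D_def smear_deriv_def by (intro borel_measurable_scaleR borel_measurable_const)
  qed
  have "(\<lambda>x. \<Sum>m\<in>{1..r}. D m x) \<in> borel_measurable lebesgue" using Dm by (intro borel_measurable_sum)
  then show "nth_deriv s (steklov r \<delta> f) \<in> borel_measurable lebesgue"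
    by (rule borel_measurable_AE) (use ae in \<open>eventually_elim, simp\<close>)
  have "Lp_norm p (nth_deriv s (steklov r \<delta> f)) = Lp_norm p (\<lambda>x. \<Sum>m\<in>{1..r}. D m x)"
    by (rule Lp_norm_cong_AE) (use p ae in \<open>auto elim: eventually_mono\<close>)
  also have "\<dots> \<le> ennreal (2 ^ card {1..r} * (\<Sum>m\<in>{1..r}. real (r choose m) * (real r ^ s / \<delta> ^ s))) * modulus_smoothness s p f \<delta>"
  proof (rule Lp_norm_sum_le)
    fix m assume m: "m \<in> {1..r}"
    show "D m \<in> borel_measurable lebesgue" by (rule Dm[OF m])
    have c1: "0 < c m" "c m \<le> 1" using m by (auto simp: c_def)
    have "1 / c m \<le> real r" using m by (auto simp: c_def field_simps)
    then have "(1 / c m) ^ s \<le> real r ^ s" using c1 by (intro power_mono) auto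
    then have cr: "1 / c m ^ s \<le> real r ^ s" by (simp add: power_one_over)
    define E where "E = (smear (c m) \<delta> ^^ (r - s)) (forward_diff s (c m * \<delta>) f)"
    have E: "E = forward_diff s (c m * \<delta>) ((smear (c m) \<delta> ^^ (r - s)) f)"
      unfolding E_def using c1 \<delta> by (intro smear_funpow_forward_diff lf) auto
    have LE: "Lp_norm p E \<le> ennreal (\<delta> ^ (r - s)) * modulus_smoothness s p f \<delta>"
    proof -
      have "Lp_norm p E \<le> ennreal (\<delta> ^ (r - s)) * Lp_norm p (forward_diff s (c m * \<delta>) f)"
        unfolding E_def by (intro Lp_norm_smear_funpow_le borel_measurable_forward_diff fb \<delta> p)
      also have "\<dots> \<le> ennreal (\<delta> ^ (r - s)) * modulus_smoothness s p f \<delta>"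
        unfolding modulus_smoothness_def using c1 \<delta> by (intro mult_left_mono SUP_upper) (auto simp: mult_le_cancel_right1)
      finally show ?thesis .
    qed
    have Em: "E \<in> borel_measurable lebesgue"
      unfolding E using c1 \<delta> by (intro lbm_measurable lbm_forward_diff lbm_smear_funpow lf) auto
    define a where "a = steklov_weight r \<delta> m * (1 / c m ^ s)"
    have "Lp_norm p (D m) = ennreal \<bar>a\<bar> * Lp_norm p E"
      using p by (intro Lp_norm_cmult Em) (auto simp: D_def smear_deriv_def E a_def abs_mult)
    also have "\<dots> \<le> ennreal \<bar>a\<bar> * (ennreal (\<delta> ^ (r - s)) * modulus_smoothness s p f \<delta>)"
      by (rule mult_left_mono[OF LE]) simp
    also have "\<dots> = ennreal (\<bar>a\<bar> * \<delta> ^ (r - s)) * modulus_smoothness s p f \<delta>"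
      using \<delta> by (intro ennreal_mult_mult) auto
    also have "\<dots> \<le> ennreal (real (r choose m) * (real r ^ s / \<delta> ^ s)) * modulus_smoothness s p f \<delta>"
    proof (intro mult_right_mono ennreal_leI)
      have "\<bar>a\<bar> * \<delta> ^ (r - s) = real (r choose m) * (1 / c m ^ s) * (\<delta> ^ (r - s) / \<delta> ^ r)"
        using c1 by (simp add: a_def abs_mult abs_steklov_weight[OF \<delta>])
      also have "\<delta> ^ (r - s) / \<delta> ^ r = 1 / \<delta> ^ s"
      proof -
        have "\<delta> ^ r = \<delta> ^ (r - s) * \<delta> ^ s" using s by (simp flip: power_add)
        then show ?thesis using \<delta> by simp
      qed
      also have "real (r choose m) * (1 / c m ^ s) * (1 / \<delta> ^ s) \<le> real (r choose m) * real r ^ s * (1 / \<delta> ^ s)"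
        using \<delta> by (intro mult_right_mono mult_left_mono cr) auto
      finally show "\<bar>a\<bar> * \<delta> ^ (r - s) \<le> real (r choose m) * (real r ^ s / \<delta> ^ s)" by simp
    qed simp
    finally show "Lp_norm p (D m) \<le> ennreal (real (r choose m) * (real r ^ s / \<delta> ^ s)) * modulus_smoothness s p f \<delta>" .
  qed (use p \<delta> in auto)
  also have "\<dots> \<le> ennreal (2 ^ r * 2 ^ r * real r ^ s / \<delta> ^ s) * modulus_smoothness s p f \<delta>"
  proof (intro mult_right_mono ennreal_leI)
    have "(\<Sum>m\<in>{1..r}. real (r choose m)) * (real r ^ s / \<delta> ^ s) \<le> 2 ^ r * (real r ^ s / \<delta> ^ s)"
      using \<delta> by (intro mult_right_mono sum_choose_le) auto
    then have "2 ^ r * ((\<Sum>m\<in>{1..r}. real (r choose m)) * (real r ^ s / \<delta> ^ s)) \<le> 2 ^ r * (2 ^ r * (real r ^ s / \<delta> ^ s))"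
      by (rule mult_left_mono) simp
    then show "2 ^ card {1..r} * (\<Sum>m\<in>{1..r}. real (r choose m) * (real r ^ s / \<delta> ^ s)) \<le> 2 ^ r * 2 ^ r * real r ^ s / \<delta> ^ s"
      by (simp only: sum_distrib_right[symmetric]) simp
  qed simp
  finally show "Lp_norm p (nth_deriv s (steklov r \<delta> f)) \<le>
    ennreal (2 ^ r * 2 ^ r * real r ^ s / \<delta> ^ s) * modulus_smoothness s p f \<delta>" .
qed

text \<open>
The derivatives of order below \<open>s\<close> are combinations of differences of at least one average of \<open>f\<close>, hence
locally Lipschitz continuous. The derivative of order \<open>s\<close> has finite norm because the modulus of smoothness
is at most a multiple of the norm of \<open>f\<close>.
\<close>

lemma steklov_in_Sobolev:
  fixes f :: "real \<Rightarrow> 'a::euclidean_space"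
  assumes fb: "f \<in> borel_measurable borel" and lf: "locally_bounded_measurable f" and fin: "Lp_norm p f < \<infinity>"
    and \<delta>: "0 < \<delta>" and p: "1 \<le> p" and s: "1 \<le> s" "s \<le> r"
  shows "steklov r \<delta> f \<in> Sobolev s p"
proof -
  define c where "c = (\<lambda>m. real m / real r)"
  have c: "0 < c m" if "m \<in> {1..r}" for m using that by (auto simp: c_def)
  have st: "steklov r \<delta> f = (\<lambda>x. \<Sum>m\<in>{1..r}. steklov_weight r \<delta> m *\<^sub>R (smear (c m) \<delta> ^^ r) f x)"
    unfolding c_def by (rule steklov_eq_smear_sum[OF lf \<delta>])
  have "Lp_norm p (steklov r \<delta> f) \<le> ennreal (2 ^ card {1..r} * (\<Sum>m\<in>{1..r}. real (r choose m))) * Lp_norm p f"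
    unfolding st
  proof (rule Lp_norm_sum_le)
    fix m assume m: "m \<in> {1..r}"
    have sm: "(smear (c m) \<delta> ^^ r) f \<in> borel_measurable lebesgue"
      using c[OF m] \<delta> by (intro lbm_measurable lbm_smear_funpow lf) auto
    then show "(\<lambda>x. steklov_weight r \<delta> m *\<^sub>R (smear (c m) \<delta> ^^ r) f x) \<in> borel_measurable lebesgue"
      by (intro borel_measurable_scaleR) auto
    have "Lp_norm p (\<lambda>x. steklov_weight r \<delta> m *\<^sub>R (smear (c m) \<delta> ^^ r) f x) =
        ennreal \<bar>steklov_weight r \<delta> m\<bar> * Lp_norm p ((smear (c m) \<delta> ^^ r) f)"
      using p by (intro Lp_norm_cmult sm) auto
    also have "\<dots> \<le> ennreal \<bar>steklov_weight r \<delta> m\<bar> * (ennreal (\<delta> ^ r) * Lp_norm p f)"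
      by (intro mult_left_mono Lp_norm_smear_funpow_le fb \<delta> p) simp
    also have "\<dots> = ennreal (\<bar>steklov_weight r \<delta> m\<bar> * \<delta> ^ r) * Lp_norm p f"
      using \<delta> by (intro ennreal_mult_mult) auto
    also have "\<bar>steklov_weight r \<delta> m\<bar> * \<delta> ^ r = real (r choose m)"
      using \<delta> by (simp add: abs_steklov_weight[OF \<delta>])
    finally show "Lp_norm p (\<lambda>x. steklov_weight r \<delta> m *\<^sub>R (smear (c m) \<delta> ^^ r) f x) \<le> ennreal (real (r choose m)) * Lp_norm p f" by simp
  qed (use p in auto)
  also have "\<dots> < \<infinity>" using fin by (simp add: ennreal_mult_less_top)
  finally have 1: "steklov r \<delta> f \<in> Lp_space p"
    using steklov_measurable[OF lf \<delta>] by (simp add: Lp_space_def)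

  have 2: "nth_deriv k (steklov r \<delta> f) differentiable (at x)" if "Suc k < s" for k x
    unfolding st by (rule nth_deriv_smear_sum_differentiable[OF lf c \<delta>]) (use that s in auto)

  have 3: "locally_abs_continuous (nth_deriv k (steklov r \<delta> f))" if "k < s" for k
  proof -
    have kr: "k < r" using that s by simp
    have "nth_deriv k (steklov r \<delta> f) = (\<lambda>x. \<Sum>m\<in>{1..r}. steklov_weight r \<delta> m *\<^sub>R smear_deriv r k (c m) \<delta> f x)"
      unfolding st by (rule nth_deriv_smear_sum[OF lf c \<delta> kr])
    then show ?thesis
      by (simp only:) (intro locally_lipschitz_imp_locally_abs_continuous locally_lipschitz_sum locally_lipschitz_smear_deriv lf c \<delta> kr finite_atLeastAtMost)
  qed

  have "modulus_smoothness s p f \<delta> \<le> ennreal (2 ^ Suc s * 2 ^ s) * Lp_norm p f"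
    unfolding modulus_smoothness_def by (intro SUP_least Lp_norm_forward_diff_le lbm_measurable lf p)
  also have "\<dots> < \<infinity>" using fin by (simp add: ennreal_mult_less_top)
  finally have "modulus_smoothness s p f \<delta> < \<infinity>" .
  then have "Lp_norm p (nth_deriv s (steklov r \<delta> f)) < \<infinity>"
    using Lp_norm_steklov_deriv_le(1)[OF fb lf \<delta> p s] by (auto simp: ennreal_mult_less_top elim: le_less_trans)
  then have 4: "nth_deriv s (steklov r \<delta> f) \<in> Lp_space p"
    using Lp_norm_steklov_deriv_le(2)[OF fb lf \<delta> p s] by (simp add: Lp_space_def)
  show ?thesis unfolding Sobolev_def using 1 2 3 4 by blast
qed

section \<open>Passing to a Borel representative\<close>

text \<open>
At every point the Steklov mean is built from integrals of \<open>f\<close> over windows of positive length, since its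
sum starts at \<open>m = 1\<close>, and these do not see null sets.
\<close>

lemma steklov_cong_AE:
  fixes f g :: "real \<Rightarrow> 'a::euclidean_space"
  assumes f: "locally_bounded_measurable f" and g: "locally_bounded_measurable g"
    and ae: "AE x in lebesgue. f x = g x" and \<delta>: "0 < \<delta>" and "1 \<le> r"
  shows "steklov r \<delta> f = steklov r \<delta> g"
proof -
  obtain N where N: "N \<in> null_sets lebesgue" and fg: "\<And>x. x \<notin> N \<Longrightarrow> f x = g x"
    using AE_E3[OF ae] by auto
  have sm: "smear c \<delta> f = smear c \<delta> g" if "0 < c" for c
  proof
    fix y
    have "integral {y..y + c * \<delta>} f = integral {y..y + c * \<delta>} g"
      by (rule integral_spike[of N]) (use N fg in \<open>simp_all add: negligible_iff_null_sets\<close>)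
    then show "smear c \<delta> f y = smear c \<delta> g y"
      by (simp add: smear_eq_integral[OF f that \<delta>] smear_eq_integral[OF g that \<delta>])
  qed
  obtain n where n: "r = Suc n" using \<open>1 \<le> r\<close> by (cases r) auto
  have "(smear (real m / real r) \<delta> ^^ r) f = (smear (real m / real r) \<delta> ^^ r) g" if "m \<in> {1..r}" for m
    using that sm[of "real m / real r"] unfolding n funpow_Suc_right by simp
  then show ?thesis by (simp add: steklov_eq_smear_sum[OF f \<delta>] steklov_eq_smear_sum[OF g \<delta>])
qed

lemma modulus_smoothness_cong_AE:
  fixes f g :: "real \<Rightarrow> 'a::euclidean_space"
  assumes ae: "AE x in lebesgue. f x = g x" and "1 \<le> p"
  shows "modulus_smoothness s p f \<delta> = modulus_smoothness s p g \<delta>"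
proof -
  have "Lp_norm p (forward_diff s h f) = Lp_norm p (forward_diff s h g)" for h
  proof (rule Lp_norm_cong_AE)
    have "AE x in lebesgue. \<forall>k::nat. f (x + real k * h) = g (x + real k * h)"
      unfolding AE_all_countable using AE_lebesgue_translate[OF ae] by blast
    then show "AE x in lebesgue. norm (forward_diff s h f x) = norm (forward_diff s h g x)"
      by eventually_elim (simp add: forward_diff_def)
  qed (use \<open>1 \<le> p\<close> in simp)
  then show ?thesis by (simp add: modulus_smoothness_def)
qed

lemma ex_bounded_borel_version:
  fixes f :: "real \<Rightarrow> 'a::euclidean_space"
  assumes "f \<in> borel_measurable lebesgue" "bounded (range f)"
  obtains f0 where "f0 \<in> borel_measurable borel" "locally_bounded_measurable f0" "AE x in lebesgue. f x = f0 x"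
proof -
  obtain g where g [measurable]: "g \<in> borel_measurable borel" and ae: "AE x in lebesgue. f x = g x"
    using ex_borel_version[OF assms(1)] .
  obtain B where B: "0 < B" "\<And>x. norm (f x) \<le> B" using assms(2) unfolding bounded_pos by auto
  define f0 where "f0 = (\<lambda>x. if norm (g x) \<le> B then g x else 0)"
  have m: "f0 \<in> borel_measurable borel" unfolding f0_def by measurable
  have "norm (f0 x) \<le> B" for x using B(1) by (simp add: f0_def)
  then have "bounded (range f0)" unfolding bounded_iff by auto
  then have "locally_bounded_measurable f0"
    by (intro lbm_bounded measurable_completion) (simp add: m)
  moreover have "AE x in lebesgue. f x = f0 x"
    using ae by eventually_elim (metis B(2) f0_def)
  ultimately show thesis using that m by blast
qed

text \<open>
The estimates for a Borel representative carry over: the Steklov mean, the continuous norms and the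
modulus of smoothness see \<open>f\<close> only up to null sets.
\<close>

lemma steklov_approximation:
  fixes f :: "real \<Rightarrow> 'a::euclidean_space"
  assumes f: "f \<in> borel_measurable lebesgue" "bounded (range f)" and fin: "Lp_norm p f < \<infinity>"
    and \<delta>: "0 < \<delta>" and p: "1 \<le> p" and s: "1 \<le> s" "s \<le> r"
  shows "steklov r \<delta> f \<in> Sobolev s p"
    and "Lp_norm p (\<lambda>x. f x - steklov r \<delta> f x) \<le> ennreal (2 * 2 ^ r * 2 ^ r) * modulus_smoothness s p f \<delta>"
    and "Lp_norm p (nth_deriv s (steklov r \<delta> f)) \<le>
      ennreal (2 ^ r * 2 ^ r * real r ^ s / \<delta> ^ s) * modulus_smoothness s p f \<delta>"
proof -
  obtain f0 where b: "f0 \<in> borel_measurable borel" and l0: "locally_bounded_measurable f0"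
    and ae: "AE x in lebesgue. f x = f0 x"
    using ex_bounded_borel_version[OF f] .
  have st: "steklov r \<delta> f = steklov r \<delta> f0"
    using s by (intro steklov_cong_AE lbm_bounded f l0 ae \<delta>) auto
  have om: "modulus_smoothness s p f \<delta> = modulus_smoothness s p f0 \<delta>"
    by (rule modulus_smoothness_cong_AE[OF ae p])
  have "Lp_norm p f = Lp_norm p f0"
    by (rule Lp_norm_cong_AE) (use p ae in \<open>auto elim: eventually_mono\<close>)
  then have fin0: "Lp_norm p f0 < \<infinity>" using fin by simp
  show "steklov r \<delta> f \<in> Sobolev s p" unfolding st by (rule steklov_in_Sobolev[OF b l0 fin0 \<delta> p s])
  have "Lp_norm p (\<lambda>x. f x - steklov r \<delta> f0 x) = Lp_norm p (\<lambda>x. f0 x - steklov r \<delta> f0 x)"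
    by (rule Lp_norm_cong_AE) (use p ae in \<open>auto elim: eventually_mono\<close>)
  then show "Lp_norm p (\<lambda>x. f x - steklov r \<delta> f x) \<le> ennreal (2 * 2 ^ r * 2 ^ r) * modulus_smoothness s p f \<delta>"
    unfolding st om using Lp_norm_steklov_minus_le[OF b l0 \<delta> p s] by simp
  show "Lp_norm p (nth_deriv s (steklov r \<delta> f)) \<le>
      ennreal (2 ^ r * 2 ^ r * real r ^ s / \<delta> ^ s) * modulus_smoothness s p f \<delta>"
    unfolding st om by (rule Lp_norm_steklov_deriv_le(1)[OF b l0 \<delta> p s])
qed

section \<open>Integrability of functions with summable samples\<close>

text \<open>
On an interval of length \<open>1\<close> not all values can stay below half of the integral. Half of it,
instead of the integral itself, is enough and avoids strict inequalities between integrals.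
\<close>

lemma ex_point_above_half_mean:
  fixes F :: "real \<Rightarrow> real"
  assumes F: "\<And>x. 0 \<le> F x" "\<And>x. F x \<le> B"
  obtains x where "x \<in> {a..a + 1}" "(\<integral>\<^sup>+t. ennreal (F t) * indicator {a..a + 1} t \<partial>lebesgue) \<le> 2 * ennreal (F x)"
proof -
  define J where "J = (\<integral>\<^sup>+t. ennreal (F t) * indicator {a..a + 1} t \<partial>lebesgue)"
  have "\<exists>x\<in>{a..a + 1}. J \<le> 2 * ennreal (F x)"
  proof (rule ccontr)
    assume "\<not> (\<exists>x\<in>{a..a + 1}. J \<le> 2 * ennreal (F x))"
    then have *: "2 * ennreal (F x) < J" if "x \<in> {a..a + 1}" for x using that by (simp add: not_le)
    have "J \<le> (\<integral>\<^sup>+t. ennreal B * indicator {a..a + 1} t \<partial>lebesgue)"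
      unfolding J_def using F by (intro nn_integral_mono mult_right_mono ennreal_leI) auto
    also have "\<dots> = ennreal B" by (subst nn_integral_cmult_indicator) auto
    finally obtain j where j: "J = ennreal j" "0 \<le> j" by (cases J) (auto simp: top_unique)
    have "J \<le> (\<integral>\<^sup>+t. ennreal (j / 2) * indicator {a..a + 1} t \<partial>lebesgue)"
      unfolding J_def
    proof (rule nn_integral_mono)
      fix t
      have "ennreal (F t) \<le> ennreal (j / 2)" if "t \<in> {a..a + 1}"
      proof -
        have "ennreal (2 * F t) < ennreal j" using *[OF that] F(1)[of t] by (simp add: j ennreal_mult)
        then show ?thesis using j(2) by (intro ennreal_leI) (simp add: ennreal_less_iff F(1))
      qed
      then show "ennreal (F t) * indicator {a..a + 1} t \<le> ennreal (j / 2) * indicator {a..a + 1} t"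
        by (auto simp: indicator_def)
    qed
    also have "\<dots> = ennreal (j / 2)" by (subst nn_integral_cmult_indicator) auto
    finally have "j \<le> j / 2" using j by simp
    then have "J = 0" using j by simp
    then show False using *[of a] by simp
  qed
  then show thesis using that unfolding J_def by blast
qed

abbreviation block :: "real \<Rightarrow> int \<Rightarrow> real set" where
  "block e j \<equiv> {2 * of_int j + e..2 * of_int j + e + 1}"

text \<open>
In every interval \<open>[2 j + e, 2 j + e + 1]\<close> choose a node at which \<open>|f|\<^sup>p\<close> is at least half of its
integral there. The gaps between these nodes lie between \<open>1\<close> and \<open>3\<close>, so the nodes are admissible, and
finiteness of the discrete norm bounds the sum of the integrals.
\<close>

lemma Lambda_space_block_integrals:
  fixes f :: "real \<Rightarrow> 'a::real_normed_vector"
  assumes f: "f \<in> Lambda_space p" and p: "1 \<le> p"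
  obtains S where "S < \<infinity>"
    "\<And>F. finite F \<Longrightarrow> (\<Sum>j\<in>F. \<integral>\<^sup>+t. ennreal (norm (f t) powr p) * indicator (block e j) t \<partial>lebesgue) \<le> S"
proof -
  obtain B where B: "\<And>x. norm (f x) \<le> B" using f unfolding Lambda_space_def bounded_iff by auto
  have Bp: "norm (f t) powr p \<le> B powr p" for t using B p by (intro powr_mono2) auto
  have "\<exists>x. x \<in> block e j \<and>
      (\<integral>\<^sup>+t. ennreal (norm (f t) powr p) * indicator (block e j) t \<partial>lebesgue) \<le> 2 * ennreal (norm (f x) powr p)" for j :: int
    by (rule ex_point_above_half_mean[OF powr_ge_zero Bp]) (intro exI conjI; assumption)
  then have "\<forall>j::int. \<exists>x. x \<in> block e j \<and>
      (\<integral>\<^sup>+t. ennreal (norm (f t) powr p) * indicator (block e j) t \<partial>lebesgue) \<le> 2 * ennreal (norm (f x) powr p)"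
    by (rule allI)
  from choice[OF this] obtain x where x': "\<forall>j::int. x j \<in> block e j \<and>
      (\<integral>\<^sup>+t. ennreal (norm (f t) powr p) * indicator (block e j) t \<partial>lebesgue) \<le> 2 * ennreal (norm (f (x j)) powr p)"
    by (elim exE)
  have x: "x j \<in> block e j"
    "(\<integral>\<^sup>+t. ennreal (norm (f t) powr p) * indicator (block e j) t \<partial>lebesgue) \<le> 2 * ennreal (norm (f (x j)) powr p)"
    for j :: int
    using spec[OF x', of j] by (simp_all only:)
  have gap: "1 \<le> x j - x (j - 1)" "x j - x (j - 1) \<le> 3" for j
    using x(1)[of j] x(1)[of "j - 1"] by auto
  have "admissible x" unfolding admissible_def
  proof
    have "ereal 1 \<le> (INF j. ereal (x j - x (j - 1)))" using gap by (intro INF_greatest) auto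
    then show "0 < (INF j. ereal (x j - x (j - 1)))" by (rule less_le_trans[rotated]) simp
    have "(SUP j. ereal (x j - x (j - 1))) \<le> ereal 3" using gap by (intro SUP_least) auto
    then show "(SUP j. ereal (x j - x (j - 1))) < \<infinity>" by (rule le_less_trans) simp
  qed
  then have "lp_norm p x f < \<infinity>" using f by (simp add: Lambda_space_def)
  define S where "S = (\<Sum>\<^sub>\<infinity>j. lp_summand p x f j)"
  have "S < \<infinity>" using \<open>lp_norm p x f < \<infinity>\<close> unfolding lp_norm_def S_def[symmetric] ennreal_root_def
    by (auto simp: less_top split: if_splits)
  show thesis
  proof
    show "2 * S < \<infinity>" using \<open>S < \<infinity>\<close> by (simp add: ennreal_mult_less_top)
    fix F :: "int set" assume "finite F"
    have "(\<Sum>j\<in>F. \<integral>\<^sup>+t. ennreal (norm (f t) powr p) * indicator (block e j) t \<partial>lebesgue) \<le>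
      (\<Sum>j\<in>F. 2 * lp_summand p x f j)"
    proof (rule sum_mono)
      fix j
      note x(2)[of j]
      also have "2 * ennreal (norm (f (x j)) powr p) \<le> 2 * lp_summand p x f j"
        using mult_left_mono[OF gap(1)[of j], of "norm (f (x j)) powr p"] by (intro mult_left_mono ennreal_leI) auto
      finally show "(\<integral>\<^sup>+t. ennreal (norm (f t) powr p) * indicator (block e j) t \<partial>lebesgue) \<le> \<dots>" .
    qed
    also have "\<dots> = 2 * (\<Sum>j\<in>F. lp_summand p x f j)" by (simp only: sum_distrib_left)
    also have "\<dots> \<le> 2 * S" unfolding S_def using \<open>finite F\<close> by (intro mult_left_mono finite_sum_le_infsum_ennreal) auto
    finally show "(\<Sum>j\<in>F. \<integral>\<^sup>+t. ennreal (norm (f t) powr p) * indicator (block e j) t \<partial>lebesgue) \<le> 2 * S" .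
  qed
qed

text \<open>
The intervals \<open>[2 j, 2 j + 1]\<close> and \<open>[2 j + 1, 2 j + 2]\<close> cover the line.
\<close>

lemma Lambda_space_imp_Lp_finite:
  fixes f :: "real \<Rightarrow> 'a::euclidean_space"
  assumes f: "f \<in> Lambda_space p" and p: "1 \<le> p"
  shows "Lp_norm p f < \<infinity>"
proof -
  have [measurable]: "f \<in> borel_measurable lebesgue" using f by (simp add: Lambda_space_def)
  define \<phi> where "\<phi> = (\<lambda>t. ennreal (norm (f t) powr p))"
  have [measurable]: "\<phi> \<in> borel_measurable lebesgue" unfolding \<phi>_def by measurable
  obtain S0 where S0: "S0 < \<infinity>" "\<And>F. finite F \<Longrightarrow> (\<Sum>j\<in>F. \<integral>\<^sup>+t. \<phi> t * indicator (block 0 j) t \<partial>lebesgue) \<le> S0"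
    unfolding \<phi>_def by (rule Lambda_space_block_integrals[OF f p, of 0]) blast
  obtain S1 where S1: "S1 < \<infinity>" "\<And>F. finite F \<Longrightarrow> (\<Sum>j\<in>F. \<integral>\<^sup>+t. \<phi> t * indicator (block 1 j) t \<partial>lebesgue) \<le> S1"
    unfolding \<phi>_def by (rule Lambda_space_block_integrals[OF f p, of 1]) blast
  have part: "(\<integral>\<^sup>+t. \<phi> t * indicator {- 2 * real n..2 * real n} t \<partial>lebesgue) \<le> S0 + S1" for n
  proof -
    define F where "F = {- int n..int n}"
    have "(\<integral>\<^sup>+t. \<phi> t * indicator {- 2 * real n..2 * real n} t \<partial>lebesgue) \<le>
      (\<integral>\<^sup>+t. (\<Sum>j\<in>F. \<phi> t * indicator (block 0 j) t) + (\<Sum>j\<in>F. \<phi> t * indicator (block 1 j) t) \<partial>lebesgue)"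
    proof (rule nn_integral_mono)
      fix t :: real
      show "\<phi> t * indicator {- 2 * real n..2 * real n} t \<le>
        (\<Sum>j\<in>F. \<phi> t * indicator (block 0 j) t) + (\<Sum>j\<in>F. \<phi> t * indicator (block 1 j) t)"
      proof (cases "t \<in> {- 2 * real n..2 * real n}")
        case True
        define j where "j = \<lfloor>t / 2\<rfloor>"
        have jt: "2 * of_int j \<le> t" "t < 2 * of_int j + 2" unfolding j_def by linarith+
        have "- real n \<le> t / 2" "t / 2 \<le> real n" using True by auto
        then have jF: "j \<in> F" unfolding j_def F_def by (auto simp: le_floor_iff) linarith
        have mem: "\<phi> t * indicator (block e j) t \<le> (\<Sum>j\<in>F. \<phi> t * indicator (block e j) t)" for e
          using jF by (intro member_le_sum) (auto simp: F_def)
        have "\<phi> t \<le> \<phi> t * indicator (block 0 j) t + \<phi> t * indicator (block 1 j) t"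
          using jt by (auto simp: indicator_def)
        also have "\<dots> \<le> (\<Sum>j\<in>F. \<phi> t * indicator (block 0 j) t) + (\<Sum>j\<in>F. \<phi> t * indicator (block 1 j) t)"
          by (intro add_mono mem)
        finally show ?thesis using True by simp
      qed simp
    qed
    also have "\<dots> = (\<Sum>j\<in>F. \<integral>\<^sup>+t. \<phi> t * indicator (block 0 j) t \<partial>lebesgue) + (\<Sum>j\<in>F. \<integral>\<^sup>+t. \<phi> t * indicator (block 1 j) t \<partial>lebesgue)"
    proof -
      have m: "(\<lambda>t. \<phi> t * indicator {a..b} t) \<in> borel_measurable lebesgue" for a b :: real
        by (intro borel_measurable_times_ennreal borel_measurable_indicator) auto
      show ?thesis by (subst nn_integral_add) (auto simp only: nn_integral_sum[OF m] intro!: borel_measurable_sum m)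
    qed
    also have "\<dots> \<le> S0 + S1" by (intro add_mono S0(2) S1(2)) (simp_all add: F_def)
    finally show ?thesis .
  qed
  have "(\<integral>\<^sup>+t. \<phi> t \<partial>lebesgue) = (\<integral>\<^sup>+t. (SUP n. \<phi> t * indicator {- 2 * real n..2 * real n} t) \<partial>lebesgue)"
  proof (rule nn_integral_cong)
    fix t :: real
    obtain n where n: "\<bar>t\<bar> \<le> real n" using real_arch_simple by blast
    show "\<phi> t = (SUP n. \<phi> t * indicator {- 2 * real n..2 * real n} t)"
    proof (rule antisym)
      have "\<phi> t = \<phi> t * indicator {- 2 * real n..2 * real n} t" using n by (auto simp: indicator_def)
      also have "\<dots> \<le> (SUP n. \<phi> t * indicator {- 2 * real n..2 * real n} t)" by (rule SUP_upper) simp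
      finally show "\<phi> t \<le> (SUP n. \<phi> t * indicator {- 2 * real n..2 * real n} t)" .
    qed (auto intro!: SUP_least simp: indicator_def)
  qed
  also have "\<dots> = (SUP n. \<integral>\<^sup>+t. \<phi> t * indicator {- 2 * real n..2 * real n} t \<partial>lebesgue)"
  proof (rule nn_integral_monotone_convergence_SUP)
    show "incseq (\<lambda>n t. \<phi> t * indicator {- 2 * real n..2 * real n} t)"
      by (auto simp: incseq_def le_fun_def indicator_def)
    show "(\<lambda>t. \<phi> t * indicator {- 2 * real n..2 * real n} t) \<in> borel_measurable lebesgue" for n
      by (intro borel_measurable_times_ennreal borel_measurable_indicator) auto
  qed
  also have "\<dots> \<le> S0 + S1" by (intro SUP_least part)
  also have "\<dots> < \<infinity>" using S0(1) S1(1) by simp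
  finally have "(\<integral>\<^sup>+t. \<phi> t \<partial>lebesgue) < \<infinity>" .
  then show ?thesis unfolding Lp_norm_def \<phi>_def ennreal_root_def by auto
qed

section \<open>Equivalence\<close>

theorem theorem4p3:
  fixes r s :: nat and p :: real
  assumes "1 \<le> s" and "s \<le> r" and "1 \<le> p"
  shows "\<exists>c C :: real. 0 < c \<and> 0 < C \<and>
    (\<forall>f \<in> (Lambda_space p :: (real \<Rightarrow> 'a::{real_normed_field, euclidean_space}) set). \<forall>W>0.
       K_functional s p f W \<le> ennreal C * semidiscrete_modulus r s p f W \<and>
       semidiscrete_modulus r s p f W \<le> ennreal c * K_functional s p f W)"
proof -
  define C where "C = 1 + (2 * 2 ^ r * 2 ^ r + 2 ^ r * 2 ^ r * real r ^ s)"
  define c where "c = 4 + (2 * (real r + 1) * real r * 2 ^ r + 4 * 2 ^ s * 2 ^ s) + (4 * (real r + 1) * 2 ^ r + 2 * real s)"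
  have "0 < C" unfolding C_def by (intro add_pos_nonneg) auto
  have "0 < c" unfolding c_def by (intro add_pos_nonneg) auto
  have upper: "K_functional s p f W \<le> ennreal C * semidiscrete_modulus r s p f W"
    if f: "f \<in> Lambda_space p" and W: "0 < W" for f :: "real \<Rightarrow> 'a" and W
  proof -
    define \<delta> where "\<delta> = 1 / W"
    have \<delta>: "0 < \<delta>" using W by (simp add: \<delta>_def)
    have fm: "f \<in> borel_measurable lebesgue" "bounded (range f)" using f by (auto simp: Lambda_space_def)
    note approx = steklov_approximation[OF fm Lambda_space_imp_Lp_finite[OF f assms(3)] \<delta> assms(3,1,2)]
    define X where "X = lp_norm p (uniform_nodes W) (\<lambda>x. steklov r \<delta> f x - f x)"
    define \<omega> where "\<omega> = modulus_smoothness s p f \<delta>"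
    have "K_functional s p f W \<le> lp_norm p (uniform_nodes W) (\<lambda>x. f x - steklov r \<delta> f x) + Lp_norm p (\<lambda>x. f x - steklov r \<delta> f x)
        + ennreal (1 / W ^ s) * Lp_norm p (nth_deriv s (steklov r \<delta> f))"
      unfolding K_functional_def by (rule INF_lower[OF approx(1)])
    also have "lp_norm p (uniform_nodes W) (\<lambda>x. f x - steklov r \<delta> f x) = X"
      by (simp add: X_def lp_norm_def norm_minus_commute)
    also have "ennreal (1 / W ^ s) * Lp_norm p (nth_deriv s (steklov r \<delta> f)) \<le>
        ennreal (1 / W ^ s) * (ennreal (2 ^ r * 2 ^ r * real r ^ s / \<delta> ^ s) * \<omega>)"
      unfolding \<omega>_def by (rule mult_left_mono[OF approx(3)]) simp
    also have "\<dots> = ennreal (1 / W ^ s * (2 ^ r * 2 ^ r * real r ^ s / \<delta> ^ s)) * \<omega>"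
      using W \<delta> by (intro ennreal_mult_mult) auto
    also have "1 / W ^ s * (2 ^ r * 2 ^ r * real r ^ s / \<delta> ^ s) = 2 ^ r * 2 ^ r * real r ^ s"
      using W by (simp add: \<delta>_def power_one_over)
    also have "Lp_norm p (\<lambda>x. f x - steklov r \<delta> f x) \<le> ennreal (2 * 2 ^ r * 2 ^ r) * \<omega>"
      unfolding \<omega>_def by (rule approx(2))
    finally have "K_functional s p f W \<le> X + ennreal (2 * 2 ^ r * 2 ^ r) * \<omega> + ennreal (2 ^ r * 2 ^ r * real r ^ s) * \<omega>"
      by (simp add: add_left_mono add_right_mono)
    also have "\<dots> = ennreal 1 * X + ennreal (2 * 2 ^ r * 2 ^ r + 2 ^ r * 2 ^ r * real r ^ s) * \<omega> + ennreal 0 * 0"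
      by (subst ennreal_plus) (auto simp: distrib_right add.assoc)
    also have "\<dots> \<le> ennreal (1 + (2 * 2 ^ r * 2 ^ r + 2 ^ r * 2 ^ r * real r ^ s) + 0) * (X + \<omega> + 0)"
      by (rule weighted_sum_le_ennreal) auto
    finally show ?thesis by (simp add: C_def X_def \<omega>_def semidiscrete_modulus_def \<delta>_def)
  qed
  have lower: "semidiscrete_modulus r s p f W \<le> ennreal c * K_functional s p f W"
    if f: "f \<in> Lambda_space p" and W: "0 < W" for f :: "real \<Rightarrow> 'a" and W
  proof -
    have lf: "locally_bounded_measurable f" using f by (intro lbm_bounded) (auto simp: Lambda_space_def)
    have "ennreal (1 / c) * semidiscrete_modulus r s p f W \<le> K_functional s p f W"
      unfolding K_functional_def
    proof (rule INF_greatest)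
      fix g :: "real \<Rightarrow> 'a" assume g: "g \<in> Sobolev s p"
      define Y where "Y = lp_norm p (uniform_nodes W) (\<lambda>x. f x - g x) + Lp_norm p (\<lambda>x. f x - g x)
        + ennreal (1 / W ^ s) * Lp_norm p (nth_deriv s g)"
      have "ennreal (1 / c) * semidiscrete_modulus r s p f W \<le> ennreal (1 / c) * (ennreal c * Y)"
        unfolding c_def Y_def
        by (rule mult_left_mono[OF semidiscrete_modulus_le_approximant[OF assms W lf g]]) simp
      also have "\<dots> = Y" using \<open>0 < c\<close> by (subst ennreal_mult_mult) auto
      finally show "ennreal (1 / c) * semidiscrete_modulus r s p f W \<le> lp_norm p (uniform_nodes W) (\<lambda>x. f x - g x) + Lp_norm p (\<lambda>x. f x - g x)
        + ennreal (1 / W ^ s) * Lp_norm p (nth_deriv s g)" by (simp only: Y_def)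
    qed
    then have "ennreal c * (ennreal (1 / c) * semidiscrete_modulus r s p f W) \<le> ennreal c * K_functional s p f W"
      by (rule mult_left_mono) simp
    moreover have "ennreal c * (ennreal (1 / c) * semidiscrete_modulus r s p f W) = semidiscrete_modulus r s p f W"
      using \<open>0 < c\<close> by (subst ennreal_mult_mult) auto
    ultimately show ?thesis by simp
  qed
  show ?thesis using \<open>0 < c\<close> \<open>0 < C\<close> upper lower by blast
qed

end
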